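(* Let $N>p>1$, $s>-p$, $0<\mu<\bar\mu:=\big(\frac{N-p}{p}\big)^p$ and $q_S<q<p^*_s-1$, and let $v>0$ be a solution on $(R_0,+\infty)$, $R_0>0$, of $$-\big(r^{N-1}|v'|^{p-2}v'\big)'=\mu\,r^{N-1-p}v^{p-1}+r^{N-1+s}v^{q}\qquad(\ast).$$ Then exactly one of the following holds. (I) $v(r)=A_*\,r^{-\gamma_*}$ for every $r>R_0$, with $A_*=\big(h(\gamma_* )-\mu\big)^{1/(q-p+1)}$; (III) $\displaystyle\lim_{r\to+\infty}r^{\nu_+}v(r)=C\in(0,+\infty)$ and $\displaystyle\lim_{r\to+\infty}\frac{rv'(r)}{v(r)}=-\nu_+$. Both occur; the solutions of type (III) correspond to the single orbit of the planar system (given in the context) which is the branch of the one-dimensional stable manifold of $P_+=(\nu_+,0)$ contained in $\{Y>0\}$, and therefore form a one-parameter family, the parameter being the scaling $v\mapsto\lambda^{\gamma_*}v(\lambda\,\cdot\,)$, $\lambda>0$, under which $(\ast)$ is invariant.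
   Context: $N,p,s,\mu,q$ are real parameters. A solution of the ODE on $(R_0,+\infty)$ means a positive function $v\in C^1((R_0,+\infty))$ such that $r\mapsto r^{N-1}|v'|^{p-2}v'$ is of class $C^1$ and the equation holds pointwise. Notation: $h(\gamma):=\gamma^{p-1}\big(N-p-(p-1)\gamma\big)$ for $\gamma>0$; $\nu_-<\nu_+$ are the two roots of $h(\nu)=\mu$, which satisfy $0<\nu_-<\frac{N-p}{p}<\nu_+<\frac{N-p}{p-1}$; $\gamma_*:=\frac{p+s}{q-p+1}$; $p^*_s:=\frac{p(N+s)}{N-p}$; $q_S:=p-1+\frac{p+s}{\nu_+}$. One has $p-1<q_S<p^*_s-1$, and $q_S<q<p^*_s-1$ is equivalent to $\frac{N-p}{p}<\gamma_*<\nu_+$ (so $h(\gamma_* )>\mu$). The orbit associated with $v$ is $x(t):=-\frac{r v'(r)}{v(r)}$, $Y(t):=r^{p+s}v(r)^{q-p+1}$, $t=\ln r$, where $v'<0$ (every positive solution on an exterior interval has $v'<0$ for large $r$). It solves the planar system $$\dot x=\frac{x^{2-p}}{p-1}\big[\mu+Y-h(x)\big],\qquad \dot Y=(q-p+1)\,Y\,(\gamma_*-x)$$ in $\{x>0,\ Y>0\}$. In the present range of $q$, $P_+=(\nu_+,0)$ is a hyperbolic saddle of this system. *)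

theory Defs
  imports "HOL-Analysis.Analysis"
begin

subsection \<open>Solutions of the radial equation\<close>

definition flux :: "real \<Rightarrow> real \<Rightarrow> (real \<Rightarrow> real) \<Rightarrow> real \<Rightarrow> real" where
  "flux N p v r = r powr (N - 1) * \<bar>deriv v r\<bar> powr (p - 2) * deriv v r"

text \<open>Only the values of \<^term>\<open>v\<close> on \<open>(R0, \<infinity>)\<close> matter, since \<^const>\<open>deriv\<close> is local.\<close>

definition is_solution ::
  "real \<Rightarrow> real \<Rightarrow> real \<Rightarrow> real \<Rightarrow> real \<Rightarrow> real \<Rightarrow> (real \<Rightarrow> real) \<Rightarrow> bool" where
  "is_solution N p s mu q R0 v \<longleftrightarrow>
     (\<forall>r>R0. v r > 0) \<and>
     (\<forall>r>R0. v field_differentiable at r) \<and> continuous_on {R0<..} (deriv v) \<and>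
     (\<forall>r>R0. flux N p v field_differentiable at r) \<and> continuous_on {R0<..} (deriv (flux N p v)) \<and>
     (\<forall>r>R0. - deriv (flux N p v) r
        = mu * r powr (N - 1 - p) * v r powr (p - 1) + r powr (N - 1 + s) * v r powr q)"

subsection \<open>Exponents\<close>

definition h_fun :: "real \<Rightarrow> real \<Rightarrow> real \<Rightarrow> real" where
  "h_fun N p x = x powr (p - 1) * (N - p - (p - 1) * x)"

text \<open>For \<open>0 < mu < ((N - p) / p) powr p\<close> the set below has exactly two elements;
  \<open>nu_plus\<close> is the larger one.\<close>

definition nu_plus :: "real \<Rightarrow> real \<Rightarrow> real \<Rightarrow> real" where
  "nu_plus N p mu = Max {nu. nu > 0 \<and> h_fun N p nu = mu}"

definition gam :: "real \<Rightarrow> real \<Rightarrow> real \<Rightarrow> real" where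
  "gam p s q = (p + s) / (q - p + 1)"

definition q_S :: "real \<Rightarrow> real \<Rightarrow> real \<Rightarrow> real \<Rightarrow> real" where
  "q_S N p s mu = p - 1 + (p + s) / nu_plus N p mu"

definition p_star :: "real \<Rightarrow> real \<Rightarrow> real \<Rightarrow> real" where
  "p_star N p s = p * (N + s) / (N - p)"

definition A_star :: "real \<Rightarrow> real \<Rightarrow> real \<Rightarrow> real \<Rightarrow> real \<Rightarrow> real" where
  "A_star N p s mu q = (h_fun N p (gam p s q) - mu) powr (1 / (q - p + 1))"

subsection \<open>The two behaviours, and the scaling\<close>

definition type_I ::
  "real \<Rightarrow> real \<Rightarrow> real \<Rightarrow> real \<Rightarrow> real \<Rightarrow> real \<Rightarrow> (real \<Rightarrow> real) \<Rightarrow> bool" where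
  "type_I N p s mu q R0 v \<longleftrightarrow>
     (\<forall>r>R0. v r = A_star N p s mu q * r powr (- gam p s q))"

definition type_III :: "real \<Rightarrow> real \<Rightarrow> real \<Rightarrow> (real \<Rightarrow> real) \<Rightarrow> bool" where
  "type_III N p mu v \<longleftrightarrow>
     (\<exists>C>0. ((\<lambda>r. r powr nu_plus N p mu * v r) \<longlongrightarrow> C) at_top) \<and>
     ((\<lambda>r. r * deriv v r / v r) \<longlongrightarrow> - nu_plus N p mu) at_top"

definition rescale :: "real \<Rightarrow> real \<Rightarrow> real \<Rightarrow> real \<Rightarrow> (real \<Rightarrow> real) \<Rightarrow> real \<Rightarrow> real" where
  "rescale p s q lam v r = lam powr gam p s q * v (lam * r)"

subsection \<open>Autonomous planar systems\<close>

definition solves_on ::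
  "(real \<times> real \<Rightarrow> real \<times> real) \<Rightarrow> (real \<times> real) set \<Rightarrow> real set \<Rightarrow> (real \<Rightarrow> real \<times> real) \<Rightarrow> bool" where
  "solves_on F U I c \<longleftrightarrow>
     (\<forall>t\<in>I. c t \<in> U \<and> (c has_vector_derivative F (c t)) (at t within I))"

text \<open>The complete orbit through \<^term>\<open>z\<close> in the phase space \<^term>\<open>U\<close>, i.e. the image of the
  maximal solution through \<^term>\<open>z\<close>: each of its points lies on a solution over some bounded
  open interval around \<open>0\<close>.\<close>

definition orbit_through ::
  "(real \<times> real \<Rightarrow> real \<times> real) \<Rightarrow> (real \<times> real) set \<Rightarrow> real \<times> real \<Rightarrow> (real \<times> real) set" where
  "orbit_through F U z =
     {w. \<exists>a b c. a < 0 \<and> 0 < b \<and> solves_on F U {a<..<b} c \<and> c 0 = z \<and> w \<in> c ` {a<..<b}}"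

text \<open>Global stable manifold of an equilibrium \<^term>\<open>P\<close>.\<close>

definition stable_manifold ::
  "(real \<times> real \<Rightarrow> real \<times> real) \<Rightarrow> (real \<times> real) set \<Rightarrow> real \<times> real \<Rightarrow> (real \<times> real) set" where
  "stable_manifold F U P =
     {z. \<exists>c. solves_on F U {0..} c \<and> c 0 = z \<and> (c \<longlongrightarrow> P) at_top}"

text \<open>In the plane, two nonzero real eigenvalues of opposite sign: the stable eigenspace, and
  hence the stable manifold, is one-dimensional.\<close>

definition hyperbolic_saddle :: "(real \<times> real \<Rightarrow> real \<times> real) \<Rightarrow> real \<times> real \<Rightarrow> bool" where
  "hyperbolic_saddle F P \<longleftrightarrow> F P = 0 \<and>
     (\<exists>F' a b. (F has_derivative F') (at P) \<and> a < 0 \<and> 0 < b \<and>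
        (\<exists>w. w \<noteq> 0 \<and> F' w = a *\<^sub>R w) \<and> (\<exists>w. w \<noteq> 0 \<and> F' w = b *\<^sub>R w))"

subsection \<open>The planar system of the radial equation\<close>

definition vec_field ::
  "real \<Rightarrow> real \<Rightarrow> real \<Rightarrow> real \<Rightarrow> real \<Rightarrow> real \<times> real \<Rightarrow> real \<times> real" where
  "vec_field N p s mu q = (\<lambda>(x, Y).
     (x powr (2 - p) / (p - 1) * (mu + Y - h_fun N p x),
      (q - p + 1) * Y * (gam p s q - x)))"

definition P_plus :: "real \<Rightarrow> real \<Rightarrow> real \<Rightarrow> real \<times> real" where
  "P_plus N p mu = (nu_plus N p mu, 0)"

text \<open>\<open>P_plus\<close> lies on the boundary of the open quadrant, so its stable manifold is taken for
  the system on the half plane \<open>x > 0\<close>, on which the vector field is smooth.\<close>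

definition half_plane :: "(real \<times> real) set" where
  "half_plane = {(x, Y). x > 0}"

definition quadrant :: "(real \<times> real) set" where
  "quadrant = {(x, Y). x > 0 \<and> Y > 0}"

definition W_s ::
  "real \<Rightarrow> real \<Rightarrow> real \<Rightarrow> real \<Rightarrow> real \<Rightarrow> (real \<times> real) set" where
  "W_s N p s mu q = stable_manifold (vec_field N p s mu q) half_plane (P_plus N p mu)"

definition upper_branch ::
  "real \<Rightarrow> real \<Rightarrow> real \<Rightarrow> real \<Rightarrow> real \<Rightarrow> (real \<times> real) set" where
  "upper_branch N p s mu q = W_s N p s mu q \<inter> {(x, Y). Y > 0}"

definition orbit_of :: "real \<Rightarrow> real \<Rightarrow> real \<Rightarrow> (real \<Rightarrow> real) \<Rightarrow> real \<Rightarrow> real \<times> real" where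
  "orbit_of p s q v t =
     (- (exp t * deriv v (exp t) / v (exp t)),
      exp t powr (p + s) * v (exp t) powr (q - p + 1))"

end

theory Submission
  imports Defs
begin

text \<open>In the variables \<open>x = - r v' / v\<close>, \<open>Y = r powr (p + s) * v powr (q - p + 1)\<close>, \<open>t = ln r\<close> a solution
  is an orbit of the planar system that exists for all large \<open>t\<close>, which forces \<open>x < nu\<close> and bounds
  \<open>Y\<close>. The system has a Lyapunov function which increases strictly along orbits other than the
  equilibrium \<open>(gam, h gam - mu)\<close> and has its strict minimum there. Two applications of Barbalat's
  lemma show that every other orbit has \<open>Y \<longlonglongrightarrow> 0\<close>, and then \<open>x \<longlonglongrightarrow> nu\<close>. Integrability of
  \<open>nu - x\<close> turns this into \<open>v \<sim> C r powr (- nu)\<close>.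

  An orbit converging to the saddle is obtained as a bounded solution by a contraction argument, and
  an expanding cone shows that it is unique up to translations of time, i.e. up to the scaling.
  Solutions that agree for large \<open>r\<close> agree on their common interval, also across the points where
  \<open>v' = 0\<close>.\<close>

section \<open>Growth and limits of real functions\<close>

text \<open>The two bounds on \<open>q\<close> act through the exponent \<open>g\<close>. The lower
  one gives \<open>g < nu\<close>, so that \<open>Y\<close> decays near \<open>P_plus\<close>. The
  upper one gives \<open>p * g > N - p\<close>; this number is the divergence of the system in
  suitable variables and hence the sign of the derivative of the Lyapunov function. Because that
  function grows from a value above its minimum, no orbit off the equilibrium can approach the
  equilibrium, and compactness leaves only \<open>Y = 0\<close>. Two degeneracies shape the proof.
  For \<open>p > 2\<close> the field is singular at \<open>x = 0\<close>, so the estimates are made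
  for \<open>X = x powr (p - 1)\<close>, whose derivative \<open>mu + Y - h x\<close> stays bounded.
  Further, \<open>v\<close> is merely C^1 and may have \<open>v' >= 0\<close> near
  \<open>R0\<close>, where the orbit is not in the half plane; there one argues in the variable
  \<open>r\<close>, with the flux, which is strictly decreasing. Existence for all large times is
  what forces \<open>x < nu\<close>: otherwise \<open>1 / x\<close> would reach 0 in finite
  time.\<close>

lemma DERIV_ge_imp_growth:
  fixes f :: "real \<Rightarrow> real"
  assumes "a \<le> b" and "\<And>t. a \<le> t \<Longrightarrow> t \<le> b \<Longrightarrow> (f has_real_derivative f' t) (at t)"
    and "\<And>t. a \<le> t \<Longrightarrow> t \<le> b \<Longrightarrow> c \<le> f' t"
  shows "f a + c * (b - a) \<le> f b"
proof (cases "a = b")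
  case False
  then have "a < b" using assms(1) by simp
  from MVT2[OF this assms(2)] obtain z where "a < z" "z < b" "f b - f a = (b - a) * f' z"
    by blast
  moreover have "(b - a) * c \<le> (b - a) * f' z"
    using assms(1,3) \<open>a < z\<close> \<open>z < b\<close> by (intro mult_left_mono) auto
  ultimately show ?thesis by (simp add: algebra_simps)
qed simp

lemma DERIV_le_imp_growth:
  fixes f :: "real \<Rightarrow> real"
  assumes "a \<le> b" and "\<And>t. a \<le> t \<Longrightarrow> t \<le> b \<Longrightarrow> (f has_real_derivative f' t) (at t)"
    and "\<And>t. a \<le> t \<Longrightarrow> t \<le> b \<Longrightarrow> f' t \<le> c"
  shows "f b \<le> f a + c * (b - a)"
proof -
  have "- f a + (- c) * (b - a) \<le> - f b"
    by (rule DERIV_ge_imp_growth[where f' = "\<lambda>t. - f' t"]) (use assms in \<open>auto intro!: DERIV_minus\<close>)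
  then show ?thesis by simp
qed

text \<open>The derivative is controlled only at the level \<open>y\<close>. At the last time with
  \<open>f t >= y\<close>, if it precedes \<open>b\<close>, one has \<open>f t = y\<close>, and the
  positive derivative lifts \<open>f\<close> above \<open>y\<close> right afterwards, a
  contradiction.\<close>

lemma DERIV_barrier:
  fixes f :: "real \<Rightarrow> real"
  assumes deriv: "\<And>t. a \<le> t \<Longrightarrow> t \<le> b \<Longrightarrow> (f has_real_derivative f' t) (at t)"
    and "y \<le> f a" and up: "\<And>t. a \<le> t \<Longrightarrow> t \<le> b \<Longrightarrow> f t = y \<Longrightarrow> 0 < f' t" and "a \<le> b"
  shows "y \<le> f b"
proof (rule ccontr)
  assume "\<not> y \<le> f b"
  have cont: "continuous_on {a..b} f"
    using deriv by (meson DERIV_isCont atLeastAtMost_iff continuous_at_imp_continuous_on)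
  define S where "S = {a..b} \<inter> f -` {y..}"
  have "closed S"
    unfolding S_def using cont by (intro continuous_closed_preimage) auto
  then have "compact S"
    by (simp add: S_def compact_eq_bounded_closed bounded_Int)
  moreover have "a \<in> S" using assms by (auto simp: S_def)
  ultimately obtain t where t: "t \<in> S" "\<And>u. u \<in> S \<Longrightarrow> u \<le> t"
    using compact_attains_sup[of S] by auto
  have "t < b" using t(1) \<open>\<not> y \<le> f b\<close> by (cases "t = b") (auto simp: S_def)
  have "f t = y"
  proof (rule ccontr)
    assume "f t \<noteq> y"
    then have "y < f t" using t(1) by (auto simp: S_def)
    then obtain u where u: "t \<le> u" "u \<le> b" "f u = y"
      using IVT2'[of f b y t] \<open>\<not> y \<le> f b\<close> \<open>t < b\<close> t(1) continuous_on_subset[OF cont, of "{t..b}"]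
      by (auto simp: S_def)
    with t have "u \<le> t" by (auto simp: S_def)
    then show False using u \<open>f t \<noteq> y\<close> by auto
  qed
  have "0 < f' t" "(f has_real_derivative f' t) (at t)"
    using up deriv t \<open>f t = y\<close> by (auto simp: S_def)
  from DERIV_pos_inc_right[OF this(2,1)] obtain d where
    d: "d > 0" "\<And>h. h > 0 \<Longrightarrow> h < d \<Longrightarrow> f t < f (t + h)" by auto
  define e where "e = min (d / 2) (b - t)"
  have "e > 0" "e < d" "t + e \<le> b" using d(1) \<open>t < b\<close> by (auto simp: e_def)
  then have "t + e \<in> S" using d(2)[of e] \<open>f t = y\<close> t(1) by (auto simp: S_def)
  with t(2) \<open>e > 0\<close> show False by fastforce
qed

text \<open>Over a fixed length \<open>c\<close> the increment of \<open>f\<close> tends to 0 and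
  equals \<open>c * g z\<close> at an intermediate point; uniform continuity carries the smallness
  of \<open>g z\<close> over to \<open>g t\<close>.\<close>

lemma barbalat:
  fixes f g :: "real \<Rightarrow> real"
  assumes deriv: "\<And>t. T < t \<Longrightarrow> (f has_real_derivative g t) (at t)"
    and uc: "uniformly_continuous_on {T<..} g" and lim: "(f \<longlongrightarrow> l) at_top"
  shows "(g \<longlongrightarrow> 0) at_top"
proof (rule tendstoI)
  fix e :: real assume "e > 0"
  with uc obtain d where d: "d > 0"
    "\<And>s t. s > T \<Longrightarrow> t > T \<Longrightarrow> dist s t < d \<Longrightarrow> dist (g s) (g t) < e / 2"
    unfolding uniformly_continuous_on_def
    by (metis greaterThan_iff half_gt_zero)
  define c where "c = d / 2"
  have c: "c > 0" "c < d" using d(1) by (auto simp: c_def)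
  have "eventually (\<lambda>t. dist (f t) l < e * c / 4) at_top"
    using lim \<open>e > 0\<close> c by (intro tendstoD) auto
  then obtain T1 where T1: "\<And>t. t \<ge> T1 \<Longrightarrow> dist (f t) l < e * c / 4"
    by (auto simp: eventually_at_top_linorder)
  have "dist (g t) 0 < e" if "t \<ge> max T1 (T + 1)" for t
  proof -
    have "t < t + c" using c by simp
    from MVT2[OF this deriv] that obtain z where z: "t < z" "z < t + c" "f (t + c) - f t = c * g z"
      by force
    have "\<bar>f (t + c) - f t\<bar> < e * c / 2"
      using T1[of t] T1[of "t + c"] that c unfolding dist_real_def by linarith
    then have "c * \<bar>g z\<bar> < c * (e / 2)" using z(3) c(1) by (simp add: abs_mult mult.commute)
    then have "\<bar>g z\<bar> < e / 2" using c(1) mult_less_cancel_left_pos by blast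
    moreover have "dist (g t) (g z) < e / 2"
      using z that c by (intro d(2)) (auto simp: dist_real_def)
    ultimately show ?thesis unfolding dist_real_def by linarith
  qed
  then show "eventually (\<lambda>t. dist (g t) 0 < e) at_top"
    unfolding eventually_at_top_linorder by blast
qed

text \<open>On the compact part of \<open>K\<close> where \<open>abs (Z z) >= e\<close>, the
  function \<open>abs (D z)\<close> has a positive minimum, so the path has left that part once
  \<open>D\<close> is small. This extracts information from a path that is not known to
  converge.\<close>

lemma tendsto_zero_on_compact:
  fixes D Z :: "'a::t2_space \<Rightarrow> real"
  assumes "compact K" and "continuous_on K D" and "continuous_on K Z"
    and zero: "\<And>z. z \<in> K \<Longrightarrow> D z = 0 \<Longrightarrow> Z z = 0"
    and "eventually (\<lambda>t. s t \<in> K) F" and "((\<lambda>t. D (s t)) \<longlongrightarrow> 0) F"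
  shows "((\<lambda>t. Z (s t)) \<longlongrightarrow> 0) F"
proof (rule tendstoI)
  fix e :: real assume "e > 0"
  define K' where "K' = K \<inter> (\<lambda>z. \<bar>Z z\<bar>) -` {e..}"
  have "compact K'"
  proof -
    have "closed K" using assms(1) compact_imp_closed by blast
    have "continuous_on K (\<lambda>z. \<bar>Z z\<bar>)" using assms(3) by (intro continuous_intros)
    then have "closed K'"
      unfolding K'_def using \<open>closed K\<close> by (intro continuous_closed_preimage) auto
    moreover have "K' = K \<inter> K'" by (auto simp: K'_def)
    ultimately show ?thesis using assms(1) by (metis compact_Int_closed)
  qed
  show "eventually (\<lambda>t. dist (Z (s t)) 0 < e) F"
  proof (cases "K' = {}")
    case True
    then show ?thesis using assms(5) by (auto simp: K'_def elim!: eventually_mono)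
  next
    case False
    have "continuous_on K' (\<lambda>z. \<bar>D z\<bar>)"
      using assms(2) by (intro continuous_intros continuous_on_subset[OF assms(2)]) (auto simp: K'_def)
    with False \<open>compact K'\<close> obtain z where z: "z \<in> K'" "\<And>w. w \<in> K' \<Longrightarrow> \<bar>D z\<bar> \<le> \<bar>D w\<bar>"
      using continuous_attains_inf[of K' "\<lambda>z. \<bar>D z\<bar>"] by blast
    have "D z \<noteq> 0" using z(1) zero \<open>e > 0\<close> by (auto simp: K'_def)
    then have "eventually (\<lambda>t. dist (D (s t)) 0 < \<bar>D z\<bar>) F"
      using assms(6) by (intro tendstoD) auto
    with assms(5) show ?thesis
    proof eventually_elim
      case (elim t)
      then have "s t \<notin> K'" using z(2) by force
      with elim show ?case by (auto simp: K'_def)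
    qed
  qed
qed

lemma uniformly_continuous_on_lipschitz_path:
  fixes s :: "real \<Rightarrow> 'a::metric_space" and G :: "'a \<Rightarrow> 'b::metric_space"
  assumes "C-lipschitz_on S s" and "s ` S \<subseteq> K" and "compact K" and "continuous_on K G"
  shows "uniformly_continuous_on S (\<lambda>t. G (s t))"
proof -
  have "uniformly_continuous_on S s"
    using assms(1) by (rule lipschitz_on_uniformly_continuous)
  moreover have "uniformly_continuous_on (s ` S) G"
    using compact_uniformly_continuous[OF assms(4,3)] assms(2)
    unfolding uniformly_continuous_on_def by (meson subset_iff)
  ultimately show ?thesis using uniformly_continuous_on_compose by (auto simp: o_def)
qed

lemma strict_min_of_deriv_sign:
  fixes f :: "real \<Rightarrow> real"
  assumes deriv: "\<And>x. x > 0 \<Longrightarrow> (f has_real_derivative f' x) (at x)"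
    and sgn: "\<And>x. x > 0 \<Longrightarrow> x \<noteq> a \<Longrightarrow> 0 < f' x * (x - a)"
    and "a > 0" "x > 0" "x \<noteq> a"
  shows "f a < f x"
proof (cases "a < x")
  case True
  from MVT2[OF this deriv] assms(3) obtain z where "a < z" "z < x" "f x - f a = (x - a) * f' z" by force
  moreover have "0 < f' z" using sgn[of z] \<open>a < z\<close> assms(3) by (simp add: zero_less_mult_iff)
  ultimately show ?thesis using True by (smt (verit) mult_pos_pos)
next
  case False
  then have "x < a" using assms by simp
  from MVT2[OF this deriv] assms(4) obtain z where "x < z" "z < a" "f a - f x = (a - x) * f' z" by force
  moreover have "f' z < 0" using sgn[of z] \<open>x < z\<close> \<open>z < a\<close> assms(4) by (simp add: zero_less_mult_iff)
  ultimately show ?thesis using \<open>x < a\<close> by (smt (verit) mult_pos_neg)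
qed

section \<open>Ordinary differential equations\<close>

definition lipschitz_near :: "('a::metric_space \<Rightarrow> 'b::metric_space) \<Rightarrow> 'a \<Rightarrow> bool" where
  "lipschitz_near f z \<longleftrightarrow> (\<exists>r>0. \<exists>L. L-lipschitz_on (cball z r) f)"

text \<open>The sum of the norms of the derivatives along the basis vectors dominates the operator
  norm, so continuity of these finitely many directional derivatives gives a bound on a closed
  ball.\<close>

lemma C1_imp_lipschitz_near:
  fixes f :: "'a::euclidean_space \<Rightarrow> 'b::euclidean_space"
  assumes "open U" "z \<in> U"
    and deriv: "\<And>x. x \<in> U \<Longrightarrow> (f has_derivative f' x) (at x)"
    and cont: "\<And>w. w \<in> Basis \<Longrightarrow> continuous_on U (\<lambda>x. f' x w)"
  shows "lipschitz_near f z"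
proof -
  obtain r where r: "r > 0" "cball z r \<subseteq> U" using assms(1,2) open_contains_cball by blast
  define N where "N = (\<lambda>x. \<Sum>w\<in>Basis. norm (f' x w))"
  have "continuous_on (cball z r) N"
    unfolding N_def by (intro continuous_intros continuous_on_subset[OF cont r(2)])
  then have "bounded (N ` cball z r)"
    by (intro compact_imp_bounded compact_continuous_image) auto
  then obtain L where L: "\<And>x. x \<in> cball z r \<Longrightarrow> \<bar>N x\<bar> \<le> L"
    unfolding bounded_iff by (metis imageI real_norm_def)
  have *: "norm (f x - f y) \<le> L * norm (x - y)" if "x \<in> cball z r" "y \<in> cball z r" for x y
  proof (rule differentiable_bound[where f' = f', OF _ _ _ that])
    fix u assume u: "u \<in> cball z r"
    then have d: "(f has_derivative f' u) (at u)" using deriv r(2) by auto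
    then show "(f has_derivative f' u) (at u within cball z r)" by (rule has_derivative_at_withinI)
    have "onorm (f' u) \<le> N u"
      unfolding N_def by (rule onorm_componentwise) (rule has_derivative_bounded_linear[OF d])
    then show "onorm (f' u) \<le> L" using L[OF u] by linarith
  qed simp
  have "0 \<le> L" using L[of z] r(1) by (auto intro: order_trans[OF abs_ge_zero])
  then have "L-lipschitz_on (cball z r) f"
    by (intro lipschitz_onI) (auto simp: dist_norm intro: *)
  then show ?thesis unfolding lipschitz_near_def using r(1) by blast
qed

text \<open>The set of agreement is closed by continuity. It is open because on an interval of
  radius \<open>d\<close> with \<open>L * d < 1\<close> the supremum \<open>S\<close> of the
  distance satisfies \<open>S <= L * S * d\<close>, hence vanishes. Connectedness of
  \<open>I\<close> finishes the proof.\<close>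

lemma ode_unique:
  fixes c1 c2 :: "real \<Rightarrow> 'a::real_normed_vector"
  assumes lip: "\<And>z. z \<in> U \<Longrightarrow> lipschitz_near F z"
    and U: "\<And>t. t \<in> I \<Longrightarrow> c1 t \<in> U" and I: "is_interval I"
    and c1: "\<And>t. t \<in> I \<Longrightarrow> (c1 has_vector_derivative F (c1 t)) (at t within I)"
    and c2: "\<And>t. t \<in> I \<Longrightarrow> (c2 has_vector_derivative F (c2 t)) (at t within I)"
    and t0: "t0 \<in> I" "c1 t0 = c2 t0" and t: "t \<in> I"
  shows "c1 t = c2 t"
proof -
  have cont: "continuous_on I c1" "continuous_on I c2"
    using c1 c2 has_vector_derivative_continuous continuous_on_eq_continuous_within by blast+
  define A where "A = {t\<in>I. c1 t = c2 t}"
  have "closedin (top_of_set I) A"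
  proof -
    have "A = I \<inter> (\<lambda>t. c1 t - c2 t) -` {0}" by (auto simp: A_def)
    then show ?thesis using cont by (auto intro!: continuous_closedin_preimage continuous_intros)
  qed
  moreover have "openin (top_of_set I) A"
    unfolding openin_euclidean_subtopology_iff
  proof (intro conjI ballI)
    show "A \<subseteq> I" by (auto simp: A_def)
    fix a assume a: "a \<in> A"
    then obtain r L where r: "r > 0" and L: "L-lipschitz_on (cball (c1 a) r) F"
      using lip[OF U[of a]] by (auto simp: A_def lipschitz_near_def)
    have "\<exists>d>0. \<forall>x\<in>I. dist x a < d \<longrightarrow> dist (c1 x) (c1 a) < r"
      using cont(1) a r unfolding continuous_on_iff A_def by blast
    then obtain d1 where d1: "d1 > 0" "\<And>x. x \<in> I \<Longrightarrow> dist x a < d1 \<Longrightarrow> dist (c1 x) (c1 a) < r" by blast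
    have "\<exists>d>0. \<forall>x\<in>I. dist x a < d \<longrightarrow> dist (c2 x) (c2 a) < r"
      using cont(2) a r unfolding continuous_on_iff A_def by blast
    then obtain d2 where d2: "d2 > 0" "\<And>x. x \<in> I \<Longrightarrow> dist x a < d2 \<Longrightarrow> dist (c2 x) (c2 a) < r" by blast
    \<comment> \<open>The first term gives \<open>L * d < 1\<close>; the other two keep both curves
      in the ball on which \<open>F\<close> is Lipschitz.\<close>
    define d where "d = min (1 / (2 * (L + 1))) (min (d1 / 2) (d2 / 2))"
    have "L \<ge> 0" using L by (rule lipschitz_on_nonneg)
    then have d: "d > 0" "d < d1" "d < d2" using d1 d2 by (auto simp: d_def)
    have "L * d \<le> L * (1 / (2 * (L + 1)))" using \<open>L \<ge> 0\<close> by (intro mult_left_mono) (auto simp: d_def)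
    also have "\<dots> < 1" using \<open>L \<ge> 0\<close> by (simp add: field_simps)
    finally have Ld: "L * d < 1" .
    define J where "J = I \<inter> cball a d"
    define b where "b = (\<lambda>x. norm (c1 x - c2 x))"
    have bound: "b x \<le> L * S * d" if "0 \<le> S" and S: "\<And>y. y \<in> J \<Longrightarrow> b y \<le> S" and x: "x \<in> J" for x S
    proof -
      have "norm ((\<lambda>x. c1 x - c2 x) x - (\<lambda>x. c1 x - c2 x) a) \<le> (L * S) * norm (x - a)"
      proof (rule differentiable_bound[where f' = "\<lambda>y h. h *\<^sub>R (F (c1 y) - F (c2 y))"])
        show "convex J" unfolding J_def using I is_interval_convex by (intro convex_Int) auto
        show "x \<in> J" "a \<in> J" using x a d by (auto simp: J_def A_def)
        fix y assume y: "y \<in> J"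
        show "((\<lambda>x. c1 x - c2 x) has_derivative (\<lambda>h. h *\<^sub>R (F (c1 y) - F (c2 y)))) (at y within J)"
        proof -
          have "(c1 has_vector_derivative F (c1 y)) (at y within J)" "(c2 has_vector_derivative F (c2 y)) (at y within J)"
            using c1[of y] c2[of y] y unfolding J_def by (auto intro: has_vector_derivative_within_subset)
          from has_vector_derivative_diff[OF this] show ?thesis unfolding has_vector_derivative_def .
        qed
        have "dist (F (c1 y)) (F (c2 y)) \<le> L * dist (c1 y) (c2 y)"
        proof (rule lipschitz_onD[OF L])
          have "dist y a < d1" "dist y a < d2" "y \<in> I" using y d by (auto simp: J_def dist_commute)
          moreover have "c1 a = c2 a" using a by (simp add: A_def)
          ultimately show "c1 y \<in> cball (c1 a) r" "c2 y \<in> cball (c1 a) r"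
            using d1(2)[of y] d2(2)[of y] by (auto simp: dist_commute)
        qed
        also have "\<dots> \<le> L * S" using S[OF y] \<open>L \<ge> 0\<close> by (intro mult_left_mono) (auto simp: b_def dist_norm)
        finally show "onorm (\<lambda>h. h *\<^sub>R (F (c1 y) - F (c2 y))) \<le> L * S"
          by (subst onorm_scaleR_left) (auto simp: onorm_id dist_norm bounded_linear_ident)
      qed
      then have "b x \<le> L * S * \<bar>x - a\<bar>" using a by (simp add: b_def A_def)
      also have "\<dots> \<le> L * S * d" using x \<open>L \<ge> 0\<close> \<open>0 \<le> S\<close>
        by (intro mult_left_mono) (auto simp: J_def dist_real_def)
      finally show ?thesis .
    qed
    have bdd: "b y \<le> 2 * r" if "y \<in> J" for y
    proof -
      have "dist y a < d1" "dist y a < d2" "y \<in> I" using that d by (auto simp: J_def dist_commute)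
      then have "dist (c1 y) (c1 a) < r" "dist (c2 y) (c2 a) < r" using d1(2) d2(2) by auto
      moreover have "c1 a = c2 a" using a by (simp add: A_def)
      ultimately show ?thesis
        using dist_triangle2[of "c1 y" "c2 y" "c1 a"] by (simp add: b_def dist_norm)
    qed
    define S where "S = Sup (b ` J)"
    have aJ: "a \<in> J" using a d by (auto simp: J_def A_def)
    have bddab: "bdd_above (b ` J)" using bdd by (auto intro!: bdd_aboveI)
    have S: "b y \<le> S" if "y \<in> J" for y
      unfolding S_def using that bddab by (intro cSUP_upper)
    have "0 \<le> S" using S[OF aJ] by (simp add: b_def order_trans[OF norm_ge_zero])
    then have "S \<le> L * S * d"
      unfolding S_def using aJ bound[of S, unfolded S_def] S by (intro cSUP_least) (auto simp: S_def)
    then have "S * (1 - L * d) \<le> 0" by (simp add: algebra_simps)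
    then have "S \<le> 0" using Ld by (simp add: mult_le_0_iff)
    then have "b y \<le> 0" if "y \<in> J" for y using S[OF that] by linarith
    then have "\<forall>x\<in>I. dist x a < d \<longrightarrow> x \<in> A"
      by (auto simp: J_def A_def b_def dist_commute)
    then show "\<exists>e>0. \<forall>x\<in>I. dist x a < e \<longrightarrow> x \<in> A" using d(1) by blast
  qed
  moreover have "connected I" using I is_interval_connected by blast
  ultimately have "A = {} \<or> A = I" unfolding connected_clopen by blast
  then show ?thesis using t0 t by (auto simp: A_def)
qed

lemma at_within_atLeast_eq: "0 \<le> t \<Longrightarrow> t < b \<Longrightarrow> at t within {0..b} = at t within {0::real..}"
  by (rule at_within_nhd[of t "{..<b}"]) auto

text \<open>Composing \<open>F\<close> with the projection onto a closed ball makes it bounded and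
  globally Lipschitz, so the integral operator acts on all bounded continuous functions. A short
  time interval keeps the fixed point inside the ball, where the projection is the identity.\<close>

lemma picard_local_solution:
  fixes F :: "'a::euclidean_space \<Rightarrow> 'a"
  assumes "lipschitz_near F z" "open U" "z \<in> U"
  obtains d c where "0 < d" "c 0 = z"
    "\<And>t. t \<in> {0..d} \<Longrightarrow> c t \<in> U \<and> (c has_vector_derivative F (c t)) (at t within {0..d})"
proof -
  obtain r0 L where r0: "r0 > 0" and L0: "L-lipschitz_on (cball z r0) F"
    using assms(1) unfolding lipschitz_near_def by blast
  obtain r1 where r1: "r1 > 0" "cball z r1 \<subseteq> U" using assms(2,3) open_contains_cball by blast
  define r where "r = min r0 r1"
  have r: "r > 0" "cball z r \<subseteq> U" and L: "L-lipschitz_on (cball z r) F"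
    using r0 r1 by (auto simp: r_def intro!: lipschitz_on_subset[OF L0])
  have "L \<ge> 0" using L by (rule lipschitz_on_nonneg)
  define P where "P = closest_point (cball z r)"
  define G where "G = (\<lambda>x. F (P x))"
  have P: "P x \<in> cball z r" for x
    unfolding P_def using r(1) by (intro closest_point_in_set) auto
  have GL: "dist (G x) (G y) \<le> L * dist x y" for x y
  proof -
    have "dist (G x) (G y) \<le> L * dist (P x) (P y)" unfolding G_def by (rule lipschitz_onD[OF L P P])
    also have "\<dots> \<le> L * dist x y"
      unfolding P_def using \<open>L \<ge> 0\<close> r(1) by (intro mult_left_mono closest_point_lipschitz) auto
    finally show ?thesis .
  qed
  then have Gcont: "continuous_on UNIV G"
    using \<open>L \<ge> 0\<close> by (intro lipschitz_on_continuous_on[of L] lipschitz_onI) auto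
  define B where "B = norm (F z) + L * r"
  have "0 \<le> B" using \<open>L \<ge> 0\<close> r(1) by (simp add: B_def)
  have GB: "norm (G x) \<le> B" for x
  proof -
    have "dist (F (P x)) (F z) \<le> L * dist (P x) z" using r(1) by (intro lipschitz_onD[OF L P]) auto
    also have "\<dots> \<le> L * r" using P[of x] \<open>L \<ge> 0\<close> by (intro mult_left_mono) (auto simp: dist_commute)
    finally have "norm (F (P x) - F z) \<le> L * r" by (simp add: dist_norm)
    then show ?thesis unfolding G_def B_def using norm_triangle_sub[of "F (P x)" "F z"] by linarith
  qed
  \<comment> \<open>The first term makes the operator a contraction with factor 1/2, the second
    bounds the displacement \<open>B * d\<close> by the radius \<open>r\<close>.\<close>
  define d where "d = min (1 / (2 * (L + 1))) (r / (B + 1))"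
  have "d > 0" using \<open>L \<ge> 0\<close> \<open>B \<ge> 0\<close> r(1) by (auto simp: d_def)
  have "L * d \<le> L * (1 / (2 * (L + 1)))" using \<open>L \<ge> 0\<close> by (intro mult_left_mono) (auto simp: d_def)
  also have "\<dots> \<le> 1 / 2" using \<open>L \<ge> 0\<close> by (simp add: field_simps)
  finally have Ld: "L * d \<le> 1 / 2" .
  have "B * d \<le> B * (r / (B + 1))" using \<open>B \<ge> 0\<close> by (intro mult_left_mono) (auto simp: d_def)
  also have "\<dots> \<le> r" using \<open>B \<ge> 0\<close> r(1) by (simp add: field_simps)
  finally have Bd: "B * d \<le> r" .
  \<comment> \<open>Clamping time to \<open>{0..d}\<close> turns functions on the interval into
    bounded continuous functions on the whole line.\<close>
  define cl where "cl = (\<lambda>t::real. max 0 (min t d))"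
  have cl: "cl t \<in> {0..d}" for t using \<open>d > 0\<close> by (auto simp: cl_def)
  define T where "T = (\<lambda>(u :: real \<Rightarrow>\<^sub>C 'a) t. z + integral {0..cl t} (\<lambda>s. G (u s)))"
  have gc: "continuous_on S (\<lambda>s. G (apply_bcontfun u s))" for u :: "real \<Rightarrow>\<^sub>C 'a" and S
    by (rule continuous_on_compose2[OF Gcont]) auto
  have gi: "(\<lambda>s. G (apply_bcontfun u s)) integrable_on {a..b}" for u :: "real \<Rightarrow>\<^sub>C 'a" and a b
    by (intro integrable_continuous_real gc)
  have dT: "norm (T u t - z) \<le> B * d" for u t
  proof -
    have "norm (integral {0..cl t} (\<lambda>s. G (u s))) \<le> B * (cl t - 0)"
      using cl[of t] GB gc by (intro integral_bound) auto
    also have "\<dots> \<le> B * d" using cl[of t] \<open>B \<ge> 0\<close> by (intro mult_left_mono) auto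
    finally show ?thesis by (simp add: T_def)
  qed
  have Tb: "T u \<in> bcontfun" for u
  proof (rule bcontfun_normI)
    have "continuous_on {0..d} (\<lambda>t. integral {0..t} (\<lambda>s. G (u s)))"
      by (intro indefinite_integral_continuous_1 gi)
    then have "continuous_on UNIV (\<lambda>t. integral {0..cl t} (\<lambda>s. G (u s)))"
      by (rule continuous_on_compose2) (use cl in \<open>auto simp: cl_def intro!: continuous_intros\<close>)
    then show "continuous_on UNIV (T u)" unfolding T_def by (intro continuous_intros)
    show "norm (T u t) \<le> norm z + B * d" for t
      using dT[of u t] norm_triangle_sub[of "T u t" z] by linarith
  qed
  have contr: "dist (Bcontfun (T u)) (Bcontfun (T v)) \<le> 1 / 2 * dist u v" for u v
  proof (rule dist_bound)
    fix t
    have "norm (integral {0..cl t} (\<lambda>s. G (u s) - G (v s))) \<le> (L * dist u v) * (cl t - 0)"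
    proof (rule integral_bound)
      show "continuous_on {0..cl t} (\<lambda>s. G (u s) - G (v s))" by (intro continuous_intros gc)
      show "norm (G (u s) - G (v s)) \<le> L * dist u v" for s
        using order_trans[OF GL mult_left_mono[OF dist_bounded \<open>L \<ge> 0\<close>]] by (simp add: dist_norm)
    qed (use cl[of t] in auto)
    also have "\<dots> \<le> (L * dist u v) * d" using cl[of t] \<open>L \<ge> 0\<close> by (intro mult_left_mono) auto
    also have "\<dots> = (L * d) * dist u v" by simp
    also have "\<dots> \<le> 1 / 2 * dist u v" using Ld by (intro mult_right_mono) auto
    finally show "dist (Bcontfun (T u) t) (Bcontfun (T v) t) \<le> 1 / 2 * dist u v"
      unfolding Bcontfun_inverse[OF Tb] by (simp add: T_def dist_norm integral_diff gi)
  qed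
  have "\<exists>!u. Bcontfun (T u) = u"
    by (rule banach_fix_type[of "1 / 2"]) (use contr in auto)
  then obtain u where "Bcontfun (T u) = u" by blast
  then have u: "apply_bcontfun u = T u" by (metis Bcontfun_inverse Tb)
  show thesis
  proof
    show "0 < d" by fact
    show "u 0 = z" unfolding u by (simp add: T_def cl_def)
    fix t assume t: "t \<in> {0..d}"
    have ueq: "u s = z + integral {0..s} (\<lambda>s. G (u s))" if "s \<in> {0..d}" for s
    proof -
      have "cl s = s" using that by (simp add: cl_def)
      then show ?thesis using fun_cong[OF u, of s] by (simp add: T_def)
    qed
    have ut: "u t \<in> cball z r" using dT[of u t] Bd unfolding u[symmetric] by (simp add: dist_norm norm_minus_commute)
    then have "G (u t) = F (u t)" unfolding G_def P_def by (simp add: closest_point_self)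
    moreover have "((\<lambda>t. z + integral {0..t} (\<lambda>s. G (u s))) has_vector_derivative G (u t)) (at t within {0..d})"
      using has_vector_derivative_add[OF has_vector_derivative_const
        integral_has_vector_derivative[OF gc[of "{0..d}" u] t]] by simp
    then have "(u has_vector_derivative G (u t)) (at t within {0..d})"
      by (rule has_vector_derivative_transform_within[OF _ zero_less_one t]) (rule ueq[symmetric])
    ultimately show "u t \<in> U \<and> (u has_vector_derivative F (u t)) (at t within {0..d})"
      using ut r(2) by auto
  qed
qed

section \<open>Bounded solutions of linear equations on a half-line\<close>

definition exp_tail :: "real \<Rightarrow> (real \<Rightarrow> real) \<Rightarrow> real \<Rightarrow> real" where
  "exp_tail M f t = - exp (M * t) * integral {t..} (\<lambda>s. exp (- M * s) * f s)"

context
  fixes M B :: real and f :: "real \<Rightarrow> real"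
  assumes M: "0 < M" and f: "continuous_on {0..} f" and B: "\<And>t. 0 \<le> t \<Longrightarrow> \<bar>f t\<bar> \<le> B"
begin

lemma exp_tail_integrable:
  assumes "0 \<le> t" shows "(\<lambda>s. exp (- M * s) * f s) integrable_on {t..}"
proof (rule measurable_bounded_by_integrable_imp_integrable)
  have "continuous_on {t..} f" using f assms by (auto intro: continuous_on_subset)
  then show "(\<lambda>s. exp (- M * s) * f s) \<in> borel_measurable (lebesgue_on {t..})"
    by (intro continuous_imp_measurable_on_sets_lebesgue continuous_intros) auto
  show "(\<lambda>s. B * exp (- M * s)) integrable_on {t..}"
    using integrable_on_cmult_left[OF integrable_on_exp_minus_to_infinity[OF M]] by simp
  show "norm (exp (- M * s) * f s) \<le> B * exp (- M * s)" if "s \<in> {t..}" for s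
    using B[of s] that assms by (simp add: abs_mult mult.commute)
qed auto

lemma exp_tail_bound:
  assumes "0 \<le> t" shows "\<bar>exp_tail M f t\<bar> \<le> B / M"
proof -
  have *: "((\<lambda>s. B * exp (- M * s)) has_integral B * (exp (- M * t) / M)) {t..}"
    by (intro has_integral_mult_right has_integral_exp_minus_to_infinity M)
  have "norm (integral {t..} (\<lambda>s. exp (- M * s) * f s)) \<le> integral {t..} (\<lambda>s. B * exp (- M * s))"
  proof (rule integral_norm_bound_integral)
    show "norm (exp (- M * s) * f s) \<le> B * exp (- M * s)" if "s \<in> {t..}" for s
      using B[of s] that assms by (simp add: abs_mult mult.commute)
  qed (use exp_tail_integrable[OF assms] * in auto)
  also have "\<dots> = B * (exp (- M * t) / M)" using * by (rule integral_unique)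
  finally have "exp (M * t) * \<bar>integral {t..} (\<lambda>s. exp (- M * s) * f s)\<bar> \<le> exp (M * t) * (B * (exp (- M * t) / M))"
    by (intro mult_left_mono) auto
  also have "\<dots> = B / M" by (simp add: exp_minus)
  finally show ?thesis by (simp add: exp_tail_def abs_mult)
qed

text \<open>This is variation of constants started at infinity, which removes the growing mode
  \<open>exp (M * t)\<close>. The tail integral is differentiated as the total integral minus the
  integral over \<open>{0..s}\<close>.\<close>

lemma exp_tail_deriv:
  assumes "0 \<le> t"
  shows "(exp_tail M f has_real_derivative M * exp_tail M f t + f t) (at t within {0..})"
proof -
  let ?g = "\<lambda>s. exp (- M * s) * f s"
  define I where "I = integral {0..} ?g"
  have split: "integral {s..} ?g = I - integral {0..s} ?g" if "0 \<le> s" for s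
  proof -
    have "continuous_on {0..s} f" using f by (auto intro: continuous_on_subset)
    then have "?g integrable_on {0..s}" by (intro integrable_continuous_real continuous_intros)
    then have "(?g has_integral (integral {0..s} ?g + integral {s..} ?g)) ({0..s} \<union> {s..})"
      using exp_tail_integrable[OF that] that
      by (intro has_integral_Un integrable_integral) (auto simp: Int_atLeastAtMost)
    moreover have "{0..s} \<union> {s..} = {0..}" using that by auto
    ultimately show ?thesis unfolding I_def by (simp add: integral_unique)
  qed
  have "continuous_on {0..t + 1} f" using f by (auto intro: continuous_on_subset)
  then have "((\<lambda>s. integral {0..s} ?g) has_real_derivative ?g t) (at t within {0..t + 1})"
    using assms by (intro integral_has_real_derivative continuous_intros) auto
  then have "((\<lambda>s. integral {0..s} ?g) has_real_derivative ?g t) (at t within {0..})"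
    using at_within_atLeast_eq[of t "t + 1"] assms by simp
  then have "((\<lambda>s. - exp (M * s) * (I - integral {0..s} ?g)) has_real_derivative
      M * (- exp (M * t) * (I - integral {0..t} ?g)) + f t) (at t within {0..})"
    by (auto intro!: derivative_eq_intros simp: algebra_simps exp_minus)
  then have "((\<lambda>s. - exp (M * s) * (I - integral {0..s} ?g)) has_real_derivative
      M * exp_tail M f t + f t) (at t within {0..})"
    using split[OF assms] by (simp add: exp_tail_def)
  then show ?thesis
    by (rule has_field_derivative_transform_within[OF _ zero_less_one]) (use split assms in \<open>auto simp: exp_tail_def\<close>)
qed

end

text \<open>Since the equation \<open>u' = M u + f\<close> has exactly one bounded solution on the half-line for
  every bounded \<open>f\<close>, no initial value is prescribed.\<close>

lemma bounded_solution_exists: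
  fixes G :: "(real \<Rightarrow> real) \<Rightarrow> real \<Rightarrow> real"
  assumes "0 < M" "0 \<le> c" "c < M"
    and cont: "\<And>u. continuous_on {0..} u \<Longrightarrow> continuous_on {0..} (G u)"
    and bound: "\<And>u t. continuous_on {0..} u \<Longrightarrow> 0 \<le> t \<Longrightarrow> \<bar>G u t\<bar> \<le> B"
    and lip: "\<And>u v e t. continuous_on {0..} u \<Longrightarrow> continuous_on {0..} v \<Longrightarrow>
       (\<And>s. 0 \<le> s \<Longrightarrow> \<bar>u s - v s\<bar> \<le> e) \<Longrightarrow> 0 \<le> t \<Longrightarrow> \<bar>G u t - G v t\<bar> \<le> c * e"
  obtains u where "continuous_on {0..} u" "\<And>t. 0 \<le> t \<Longrightarrow> \<bar>u t\<bar> \<le> B / M"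
    "\<And>t. 0 \<le> t \<Longrightarrow> (u has_real_derivative M * u t + G u t) (at t within {0..})"
proof -
  \<comment> \<open>Contraction takes place in the bounded continuous functions on the whole line;
    \<open>max 0 t\<close> extends the tail by a constant to negative times, where nothing is
    claimed.\<close>
  define T where "T = (\<lambda>(u :: real \<Rightarrow>\<^sub>C real) t. exp_tail M (G u) (max 0 t))"
  have uc: "continuous_on S (apply_bcontfun u)" for u :: "real \<Rightarrow>\<^sub>C real" and S by auto
  have tail: "(\<lambda>s. exp (- M * s) * G u s) integrable_on {t..}"
    "\<bar>exp_tail M (G u) t\<bar> \<le> B / M"
    "(exp_tail M (G u) has_real_derivative M * exp_tail M (G u) t + G u t) (at t within {0..})"
    if "0 \<le> t" for u :: "real \<Rightarrow>\<^sub>C real" and t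
    using exp_tail_integrable[of M "G u" B t] exp_tail_bound[of M "G u" B t]
      exp_tail_deriv[of M "G u" B t] that \<open>0 < M\<close> cont[OF uc] bound[OF uc] by blast+
  have Tb: "T u \<in> bcontfun" for u
  proof (rule bcontfun_normI)
    have "continuous_on {0..} (exp_tail M (G u))"
      using tail(3)[of _ u] by (auto simp: continuous_on_eq_continuous_within intro!: DERIV_continuous)
    then show "continuous_on UNIV (T u)" unfolding T_def
      by (rule continuous_on_compose2) (auto intro!: continuous_intros)
    show "norm (T u t) \<le> B / M" for t using tail(2)[of "max 0 t" u] by (simp add: T_def)
  qed
  have contr: "dist (Bcontfun (T u)) (Bcontfun (T v)) \<le> c / M * dist u v" for u v
  proof (rule dist_bound)
    fix t :: real
    let ?t = "max 0 t"
    have "exp_tail M (G u) ?t - exp_tail M (G v) ?t = exp_tail M (\<lambda>s. G u s - G v s) ?t"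
    proof -
      have "integral {?t..} (\<lambda>s. exp (- M * s) * G u s - exp (- M * s) * G v s)
        = integral {?t..} (\<lambda>s. exp (- M * s) * G u s) - integral {?t..} (\<lambda>s. exp (- M * s) * G v s)"
        by (intro integral_diff tail(1)) auto
      then show ?thesis unfolding exp_tail_def right_diff_distrib by (simp add: right_diff_distrib)
    qed
    also have "\<bar>\<dots>\<bar> \<le> c * dist u v / M"
    proof (rule exp_tail_bound[OF \<open>0 < M\<close>])
      show "continuous_on {0..} (\<lambda>s. G u s - G v s)" by (intro continuous_intros cont uc)
      show "\<bar>G u s - G v s\<bar> \<le> c * dist u v" if "0 \<le> s" for s
        using that dist_bounded[of u _ v] by (intro lip uc) (auto simp: dist_real_def)
    qed simp
    finally show "dist (Bcontfun (T u) t) (Bcontfun (T v) t) \<le> c / M * dist u v"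
      unfolding Bcontfun_inverse[OF Tb] by (simp add: T_def dist_real_def)
  qed
  have "\<exists>!u. Bcontfun (T u) = u"
    by (rule banach_fix_type[of "c / M"]) (use contr assms(1-3) in auto)
  then obtain u where "Bcontfun (T u) = u" by blast
  then have u: "apply_bcontfun u = T u" by (metis Bcontfun_inverse Tb)
  then have u': "u t = exp_tail M (G u) t" if "0 \<le> t" for t
  proof -
    have "T u t = exp_tail M (G u) t" using that by (simp add: T_def)
    then show ?thesis by (simp add: u[symmetric])
  qed
  show thesis
  proof
    show "continuous_on {0..} u" by (rule uc)
    fix t :: real assume t: "0 \<le> t"
    show "\<bar>u t\<bar> \<le> B / M" using tail(2)[OF t, of u] u'[OF t] by simp
    show "(u has_real_derivative M * u t + G u t) (at t within {0..})"
      unfolding u'[OF t]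
      by (rule has_field_derivative_transform_within[OF tail(3)[OF t] zero_less_one])
        (use t u' in auto)
  qed
qed

section \<open>Restriction, translation, gluing and backward extension of solution curves\<close>

lemma solves_onI:
  assumes "\<And>t. t \<in> I \<Longrightarrow> (x t, Y t) \<in> U"
    and "\<And>t. t \<in> I \<Longrightarrow> (x has_real_derivative fst (F (x t, Y t))) (at t within I)"
    and "\<And>t. t \<in> I \<Longrightarrow> (Y has_real_derivative snd (F (x t, Y t))) (at t within I)"
  shows "solves_on F U I (\<lambda>t. (x t, Y t))"
  unfolding solves_on_def
proof (intro ballI conjI)
  fix t assume t: "t \<in> I"
  then show "(x t, Y t) \<in> U" by (rule assms(1))
  show "((\<lambda>t. (x t, Y t)) has_vector_derivative F (x t, Y t)) (at t within I)"
    using has_vector_derivative_Pair[of x "fst (F (x t, Y t))" t I Y "snd (F (x t, Y t))"] assms(2,3)[OF t]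
    by (simp add: has_real_derivative_iff_has_vector_derivative)
qed

lemma solves_onD:
  assumes "solves_on F U I c" "t \<in> I"
  shows "c t \<in> U" "((\<lambda>t. fst (c t)) has_real_derivative fst (F (c t))) (at t within I)"
    "((\<lambda>t. snd (c t)) has_real_derivative snd (F (c t))) (at t within I)"
  using assms bounded_linear.has_vector_derivative[OF bounded_linear_fst, of c "F (c t)" "at t within I"]
    bounded_linear.has_vector_derivative[OF bounded_linear_snd, of c "F (c t)" "at t within I"]
  by (auto simp: solves_on_def has_real_derivative_iff_has_vector_derivative)

lemma solves_on_subset:
  "solves_on F U I c \<Longrightarrow> J \<subseteq> I \<Longrightarrow> (\<And>t. t \<in> J \<Longrightarrow> c t \<in> V) \<Longrightarrow> solves_on F V J c"
  unfolding solves_on_def by (meson has_vector_derivative_within_subset subsetD)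

lemma solves_on_shift:
  assumes "solves_on F U I c"
  shows "solves_on F U ((\<lambda>t. t - a) ` I) (\<lambda>t. c (t + a))"
  unfolding solves_on_def
proof (intro ballI conjI)
  fix t assume "t \<in> (\<lambda>t. t - a) ` I"
  then have t: "t + a \<in> I" by auto
  then show "c (t + a) \<in> U" using assms by (simp add: solves_on_def)
  have "((c \<circ> (\<lambda>t. t + a)) has_vector_derivative 1 *\<^sub>R F (c (t + a))) (at t within (\<lambda>t. t - a) ` I)"
  proof (rule vector_diff_chain_within)
    show "((\<lambda>t. t + a) has_vector_derivative 1) (at t within (\<lambda>t. t - a) ` I)"
      by (auto intro!: derivative_eq_intros)
    have "(\<lambda>t. t + a) ` (\<lambda>t. t - a) ` I = I" by (auto simp: image_image)
    then show "(c has_vector_derivative F (c (t + a))) (at (t + a) within (\<lambda>t. t + a) ` (\<lambda>t. t - a) ` I)"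
      using assms t by (simp add: solves_on_def)
  qed
  then show "((\<lambda>t. c (t + a)) has_vector_derivative F (c (t + a))) (at t within (\<lambda>t. t - a) ` I)"
    by (simp add: o_def)
qed

text \<open>At the joint both one-sided derivatives equal \<open>F\<close> at the common value, so
  they match automatically.\<close>

lemma solves_on_glue:
  assumes "solves_on F U {a..0} c1" "solves_on F U {0..} c2" "c1 0 = c2 0" "a < (0::real)"
  shows "solves_on F U {a..} (\<lambda>t. if t \<in> {a..0} then c1 t else c2 t)"
  unfolding solves_on_def
proof (intro ballI conjI)
  fix t assume t: "t \<in> {a..}"
  then show "(if t \<in> {a..0} then c1 t else c2 t) \<in> U"
    using assms(1,2) by (auto simp: solves_on_def)
  have "((\<lambda>t. if t \<in> {a..0} then c1 t else c2 t) has_vector_derivative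
      (if t \<in> {a..0} then F (c1 t) else F (c2 t))) (at t within {a..})"
    by (rule has_vector_derivative_If_within_closures[where T = "{0..}"])
      (use t assms in \<open>auto simp: solves_on_def Un_absorb2 insert_absorb\<close>)
  then show "((\<lambda>t. if t \<in> {a..0} then c1 t else c2 t) has_vector_derivative
      F (if t \<in> {a..0} then c1 t else c2 t)) (at t within {a..})"
    by (simp add: if_distrib)
qed

text \<open>Local existence for \<open>- F\<close>, run with reversed time, is glued in front of
  \<open>c\<close>. It turns orbits on \<open>{0..}\<close>, as in the definition of the stable
  manifold, into orbits on a neighbourhood of 0, as required by
  \<open>orbit_through\<close>.\<close>

lemma solves_on_extend_backward:
  fixes F :: "real \<times> real \<Rightarrow> real \<times> real"
  assumes "solves_on F U {0..} c" "open U" "lipschitz_near F (c 0)"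
  obtains a c' where "a < 0" "solves_on F U {a..} c'" "\<And>t. 0 \<le> t \<Longrightarrow> c' t = c t"
proof -
  have "c 0 \<in> U" using assms(1) by (auto simp: solves_on_def)
  moreover have "lipschitz_near (\<lambda>z. - F z) (c 0)"
    using assms(3) unfolding lipschitz_near_def by simp
  ultimately obtain d e where d: "0 < d" "e 0 = c 0"
    "\<And>t. t \<in> {0..d} \<Longrightarrow> e t \<in> U \<and> (e has_vector_derivative - F (e t)) (at t within {0..d})"
    using picard_local_solution[of "\<lambda>z. - F z" "c 0" U] assms(2) by metis
  have "solves_on F U {- d..0} (\<lambda>t. e (- t))"
    unfolding solves_on_def
  proof (intro ballI conjI)
    fix t assume t: "t \<in> {- d..0}"
    then show "e (- t) \<in> U" using d(3)[of "- t"] by auto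
    have "((e \<circ> uminus) has_vector_derivative (- 1) *\<^sub>R (- F (e (- t)))) (at t within {- d..0})"
      by (rule vector_diff_chain_within) (use t d(3)[of "- t"] in \<open>auto intro!: derivative_eq_intros\<close>)
    then show "((\<lambda>t. e (- t)) has_vector_derivative F (e (- t))) (at t within {- d..0})"
      by (simp add: o_def)
  qed
  from solves_on_glue[OF this assms(1)] d
  have "solves_on F U {- d..} (\<lambda>t. if t \<in> {- d..0} then e (- t) else c t)" by simp
  then show thesis by (rule that[rotated]) (use d in auto)
qed

section \<open>The planar system\<close>

locale radial =
  fixes N p s mu q :: real
  assumes p1: "1 < p" and pN: "p < N" and ps: "- p < s" and mu_pos: "0 < mu"
    and mu_less: "mu < ((N - p) / p) powr p"
    and q_lower: "q_S N p s mu < q" and q_upper: "q < p_star N p s - 1"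
begin

abbreviation "g \<equiv> gam p s q"
abbreviation "nu \<equiv> nu_plus N p mu"
abbreviation "h \<equiv> h_fun N p"
abbreviation "k \<equiv> q - p + 1"
abbreviation "F \<equiv> vec_field N p s mu q"

lemma h_deriv:
  assumes "0 < x"
  shows "(h has_real_derivative (p - 1) * x powr (p - 2) * (N - p - p * x)) (at x)"
proof -
  have e: "x powr (p - 1) = x powr (p - 2) * x"
    using assms powr_add[of x "p - 2" 1] by simp
  have "((\<lambda>x. x powr (p - 1) * (N - p - (p - 1) * x)) has_real_derivative
      ((p - 1) * x powr (p - 1 - 1)) * (N - p - (p - 1) * x) + (- (p - 1)) * x powr (p - 1)) (at x)"
    by (intro DERIV_mult has_real_derivative_powr assms) (auto intro!: derivative_eq_intros)
  moreover have "((p - 1) * x powr (p - 1 - 1)) * (N - p - (p - 1) * x) + (- (p - 1)) * x powr (p - 1)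
      = (p - 1) * x powr (p - 2) * (N - p - p * x)"
    by (simp add: e algebra_simps)
  ultimately have "((\<lambda>x. x powr (p - 1) * (N - p - (p - 1) * x)) has_real_derivative
      (p - 1) * x powr (p - 2) * (N - p - p * x)) (at x)" by simp
  then show ?thesis unfolding h_fun_def .
qed

lemma h_strict_antimono:
  assumes "(N - p) / p \<le> x" "x < y" shows "h y < h x"
proof -
  have "0 < (N - p) / p" using p1 pN by simp
  then have "0 < x" using assms(1) by linarith
  from MVT2[OF assms(2) h_deriv] \<open>0 < x\<close> obtain z where z: "x < z" "z < y"
    "h y - h x = (y - x) * ((p - 1) * z powr (p - 2) * (N - p - p * z))" by force
  have "N - p < p * z" using assms(1) z(1) p1 by (simp add: field_simps) (smt (verit) mult_strict_left_mono)
  then have "(p - 1) * z powr (p - 2) * (N - p - p * z) < 0"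
    using p1 z(1) \<open>0 < x\<close> by (intro mult_pos_neg) auto
  then show ?thesis using z(3) assms(2) by (smt (verit) mult_pos_neg)
qed

lemma h_strict_mono:
  assumes "0 < x" "x < y" "y \<le> (N - p) / p" shows "h x < h y"
proof -
  from MVT2[OF assms(2) h_deriv] \<open>0 < x\<close> obtain z where z: "x < z" "z < y"
    "h y - h x = (y - x) * ((p - 1) * z powr (p - 2) * (N - p - p * z))" by force
  have "p * z < N - p" using assms(3) z(2) p1 by (simp add: field_simps) (smt (verit) mult_strict_left_mono)
  then have "0 < (p - 1) * z powr (p - 2) * (N - p - p * z)"
    using p1 z(1) \<open>0 < x\<close> by (intro mult_pos_pos) auto
  then show ?thesis using z(3) assms(2) by (smt (verit) mult_pos_pos)
qed

text \<open>\<open>h\<close> increases up to \<open>(N - p) / p\<close>, where its value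
  \<open>((N - p) / p) powr p\<close> exceeds \<open>mu\<close>, and decreases afterwards, reaching
  0 at \<open>(N - p) / (p - 1)\<close>. So there is exactly one root beyond the peak and at most
  one before it.\<close>

lemma nu_bounds: "(N - p) / p < nu" "nu < (N - p) / (p - 1)"
  and h_nu: "h nu = mu"
proof -
  define c where "c = (N - p) / p"
  define b where "b = (N - p) / (p - 1)"
  have c0: "0 < c" and cb: "c < b" using p1 pN by (auto simp: c_def b_def field_simps)
  have "N - p - (p - 1) * c = c" using p1 by (simp add: c_def field_simps)
  then have "h c = c powr p" using c0 powr_add[of c "p - 1" 1] by (simp add: h_fun_def)
  then have hc: "mu < h c" using mu_less by (simp add: c_def)
  have "(p - 1) * b = N - p" using p1 by (simp add: b_def)
  then have hb: "h b < mu" using mu_pos by (simp add: h_fun_def)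
  have "continuous_on {c..b} h"
    by (intro continuous_at_imp_continuous_on ballI, rule DERIV_isCont, rule h_deriv) (use c0 in auto)
  then obtain x where x: "c \<le> x" "x \<le> b" "h x = mu"
    using IVT2'[of h b mu c] hc hb cb by auto
  then have "c < x" "x < b" using hc hb by (auto simp: less_le)
  define S where "S = {nu. nu > 0 \<and> h nu = mu}"
  have "Max S = x"
  proof (rule Max_eqI)
    have upper: "z = x" if "z \<in> S" "c < z" for z
      using that x \<open>c < x\<close> h_strict_antimono[of z x] h_strict_antimono[of x z]
      by (cases z x rule: linorder_cases) (auto simp: S_def c_def)
    have lower: "z = y" if "z \<in> S" "z \<le> c" "y \<in> S" "y \<le> c" for y z
      using that h_strict_mono[of z y] h_strict_mono[of y z]
      by (cases z y rule: linorder_cases) (auto simp: S_def c_def)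
    \<comment> \<open>Finiteness has to be established before \<open>Max\<close> in the definition
      of \<open>nu_plus\<close> says anything.\<close>
    have "\<exists>y. S \<subseteq> {y, x}"
    proof (cases "\<exists>y\<in>S. y \<le> c")
      case True
      then obtain y where "y \<in> S" "y \<le> c" by blast
      then have "z = y \<or> z = x" if "z \<in> S" for z
        using lower[of z y] upper[of z] that by linarith
      then show ?thesis by blast
    next
      case False
      then have "z = x" if "z \<in> S" for z using upper[of z] that by force
      then show ?thesis by blast
    qed
    then obtain y where "S \<subseteq> {y, x}" by blast
    then show "finite S" using finite_subset by blast
    show "x \<in> S" using x c0 \<open>c < x\<close> by (auto simp: S_def)
    show "y \<le> x" if "y \<in> S" for y using upper[OF that] \<open>c < x\<close> by force
  qed
  then have "nu = x" by (simp add: nu_plus_def S_def)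
  then show "(N - p) / p < nu" "nu < (N - p) / (p - 1)" "h nu = mu"
    using x \<open>c < x\<close> \<open>x < b\<close> by (auto simp: c_def b_def)
qed

lemma nu_pos: "0 < nu"
  using nu_bounds(1) divide_pos_pos[of "N - p" p] p1 pN by linarith

lemma k_pos: "0 < k"
  using q_lower nu_pos ps by (simp add: q_S_def) (smt (verit) divide_pos_pos)

lemma k_g: "k * g = p + s"
  using k_pos by (simp add: gam_def)

lemma g_less_nu: "g < nu"
proof -
  have "(p + s) / nu < k" using q_lower by (simp add: q_S_def)
  then show ?thesis using nu_pos k_pos by (simp add: gam_def field_simps)
qed

text \<open>Here the upper bound on \<open>q\<close> enters; it becomes the positivity of
  \<open>p * g - (N - p)\<close>, the coefficient in \<open>lyap_deriv\<close>.\<close>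

lemma g_gt: "(N - p) / p < g"
proof -
  have "p_star N p s - p = p * (p + s) / (N - p)" using pN by (simp add: p_star_def field_simps)
  then have "k < p * (p + s) / (N - p)" using q_upper by simp
  then have "k * (N - p) < p * (p + s)" using pN by (simp add: pos_less_divide_eq)
  then show ?thesis using k_pos p1 by (simp add: gam_def field_simps)
qed

lemma g_pos: "0 < g"
  using g_gt divide_pos_pos[of "N - p" p] p1 pN by linarith

lemma p_g_gt: "N - p < p * g" and p_nu_gt: "N - p < p * nu"
  using g_gt nu_bounds(1) p1 by (auto simp: field_simps)

lemma h_gt_mu: "g \<le> x \<Longrightarrow> x < nu \<Longrightarrow> mu < h x"
  using h_strict_antimono[of x nu] g_gt h_nu by simp

lemma h_less_mu: "nu < x \<Longrightarrow> h x < mu"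
  using h_strict_antimono[of nu x] nu_bounds(1) h_nu by simp

text \<open>Second coordinate of the interior equilibrium \<open>(g, m)\<close>;
  \<open>A_star\<close> is \<open>m powr (1 / k)\<close>.\<close>

definition m where "m = h g - mu"

lemma m_pos: "0 < m"
  using h_gt_mu[of g] g_less_nu by (simp add: m_def)

text \<open>First component of the field for \<open>x > 0\<close>, with the product
  \<open>x powr (2 - p) * h x\<close> multiplied out: only the term with \<open>mu + Y\<close> keeps
  a non-integral power, which makes differentiation easy.\<close>

definition fX :: "real \<Rightarrow> real \<Rightarrow> real" where
  "fX x Y = (x powr (2 - p) * (mu + Y) - x * (N - p - (p - 1) * x)) / (p - 1)"

definition fX' :: "real \<Rightarrow> real \<Rightarrow> real" where
  "fX' x Y = ((2 - p) * x powr (1 - p) * (mu + Y) - (N - p) + 2 * (p - 1) * x) / (p - 1)"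

lemma fX_eq:
  assumes "0 < x" shows "fX x Y = x powr (2 - p) / (p - 1) * (mu + Y - h x)"
proof -
  have "x powr (2 - p) * x powr (p - 1) = x" using powr_add[of x "2 - p" "p - 1"] assms by simp
  then have "x powr (2 - p) * h x = x * (N - p - (p - 1) * x)"
    unfolding h_fun_def mult.assoc[symmetric] by simp
  then show ?thesis by (simp add: fX_def right_diff_distrib diff_divide_distrib)
qed

lemma F_eq: "0 < x \<Longrightarrow> F (x, Y) = (fX x Y, k * Y * (g - x))"
  by (simp add: vec_field_def fX_eq)

lemma fX_deriv:
  assumes "0 < x" shows "((\<lambda>x. fX x Y) has_real_derivative fX' x Y) (at x)"
proof -
  have "2 - p - 1 = 1 - p" by simp
  then have "((\<lambda>x. x powr (2 - p) * (mu + Y) - x * (N - p - (p - 1) * x)) has_real_derivative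
      (2 - p) * x powr (1 - p) * (mu + Y) - (N - p) + 2 * (p - 1) * x) (at x)"
    by (auto intro!: derivative_eq_intros assms simp: algebra_simps)
  then show ?thesis unfolding fX_def fX'_def by (rule DERIV_cdivide)
qed

lemma fX'_P: "fX' nu 0 = p * nu - (N - p)"
proof -
  have "nu powr (1 - p) * mu = nu powr (1 - p) * h nu" by (simp add: h_nu)
  also have "\<dots> = (nu powr (1 - p) * nu powr (p - 1)) * (N - p - (p - 1) * nu)"
    by (simp add: h_fun_def)
  also have "nu powr (1 - p) * nu powr (p - 1) = 1"
    using nu_pos by (simp flip: powr_add)
  finally have "nu powr (1 - p) * mu = N - p - (p - 1) * nu" by simp
  then have "fX' nu 0 = ((2 - p) * (N - p - (p - 1) * nu) - (N - p) + 2 * (p - 1) * nu) / (p - 1)"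
    by (simp add: fX'_def mult.assoc)
  also have "\<dots> = ((p - 1) * (p * nu - (N - p))) / (p - 1)" by (simp add: algebra_simps)
  also have "\<dots> = p * nu - (N - p)" using p1 by simp
  finally show ?thesis .
qed

definition F' :: "real \<times> real \<Rightarrow> real \<times> real \<Rightarrow> real \<times> real" where
  "F' z w = (fX' (fst z) (snd z) * fst w + fst z powr (2 - p) / (p - 1) * snd w,
     k * (g - fst z) * snd w - k * snd z * fst w)"

lemma open_half_plane: "open half_plane"
proof -
  have eq: "half_plane = fst -` {0<..}" by (auto simp: half_plane_def)
  show ?thesis unfolding eq by (intro open_vimage_fst open_greaterThan)
qed

lemma open_quadrant: "open quadrant"
proof -
  have eq: "quadrant = fst -` {0<..} \<inter> snd -` {0<..}" by (auto simp: quadrant_def)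
  show ?thesis unfolding eq by (intro open_Int open_vimage_fst open_vimage_snd open_greaterThan)
qed

lemma F_deriv:
  assumes "z \<in> half_plane" shows "(F has_derivative F' z) (at z)"
proof -
  have z: "0 < fst z" using assms by (auto simp: half_plane_def)
  have pw: "((\<lambda>x. fst x powr (2 - p)) has_derivative (\<lambda>w. (2 - p) * fst z powr (1 - p) * fst w)) (at z)"
  proof -
    have "((\<lambda>y. y powr (2 - p)) has_real_derivative (2 - p) * fst z powr (1 - p)) (at (fst z))"
      using has_real_derivative_powr[OF z, of "2 - p"] by simp
    from DERIV_compose_FDERIV[where f = "\<lambda>y. y powr (2 - p)" and g = fst, OF this has_derivative_fst[OF has_derivative_ident]]
    have "((\<lambda>x. fst x powr (2 - p)) has_derivative (\<lambda>w. fst w * ((2 - p) * fst z powr (1 - p)))) (at z)"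
      by simp
    then show ?thesis by (simp add: mult.commute)
  qed
  have "((\<lambda>z. fst z powr (2 - p) * (mu + snd z) - fst z * (N - p - (p - 1) * fst z)) has_derivative
      (\<lambda>w. (fst z powr (2 - p) * snd w + (2 - p) * fst z powr (1 - p) * fst w * (mu + snd z))
        - (fst z * (- (p - 1) * fst w) + fst w * (N - p - (p - 1) * fst z)))) (at z)"
    by (intro has_derivative_diff has_derivative_mult pw)
      (auto intro!: derivative_eq_intros simp: algebra_simps fun_eq_iff)
  from bounded_linear.has_derivative[OF bounded_linear_divide this, of "p - 1"]
  have "((\<lambda>z. (fX (fst z) (snd z), k * snd z * (g - fst z))) has_derivative
      (\<lambda>w. (((fst z powr (2 - p) * snd w + (2 - p) * fst z powr (1 - p) * fst w * (mu + snd z))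
        - (fst z * (- (p - 1) * fst w) + fst w * (N - p - (p - 1) * fst z))) / (p - 1),
        k * (g - fst z) * snd w - k * snd z * fst w))) (at z)"
    unfolding fX_def
    by (intro has_derivative_Pair) (auto intro!: derivative_eq_intros simp: algebra_simps)
  also have "(\<lambda>w. (((fst z powr (2 - p) * snd w + (2 - p) * fst z powr (1 - p) * fst w * (mu + snd z))
        - (fst z * (- (p - 1) * fst w) + fst w * (N - p - (p - 1) * fst z))) / (p - 1),
        k * (g - fst z) * snd w - k * snd z * fst w)) = F' z"
    unfolding F'_def fX'_def using p1 by (auto simp: fun_eq_iff divide_simps) (simp add: algebra_simps)
  finally have "((\<lambda>z. (fX (fst z) (snd z), k * snd z * (g - fst z))) has_derivative F' z) (at z)" .
  then show ?thesis
    by (rule has_derivative_transform_within_open[OF _ open_half_plane assms])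
      (auto simp: half_plane_def F_eq)
qed

lemma F_lipschitz_near:
  assumes "z \<in> half_plane" shows "lipschitz_near F z"
proof (rule C1_imp_lipschitz_near[OF open_half_plane assms F_deriv])
  fix w :: "real \<times> real"
  show "continuous_on half_plane (\<lambda>z. F' z w)"
    unfolding F'_def fX'_def using p1
    by (intro continuous_intros) (auto simp: half_plane_def)
qed

text \<open>Since \<open>Y = 0\<close> is invariant, the derivative at \<open>P_plus\<close> is
  triangular. Its eigenvalues are \<open>k * (g - nu) < 0\<close> and
  \<open>p * nu - (N - p) > 0\<close>; the stable eigenvector has second component 1, so it is
  transversal to the axis.\<close>

lemma P_plus_saddle: "hyperbolic_saddle F (P_plus N p mu)"
proof -
  define a where "a = nu powr (2 - p) / (p - 1)"
  define e where "e = k * (g - nu)"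
  define l where "l = p * nu - (N - p)"
  have F'P: "F' (P_plus N p mu) = (\<lambda>w. (l * fst w + a * snd w, e * snd w))"
    by (auto simp: F'_def P_plus_def fX'_P a_def e_def l_def)
  have "e < 0" unfolding e_def using k_pos g_less_nu by (intro mult_pos_neg) auto
  have "0 < l" using p_nu_gt by (simp add: l_def)
  have "F (P_plus N p mu) = 0" by (simp add: P_plus_def vec_field_def h_nu zero_prod_def)
  moreover have "(F has_derivative F' (P_plus N p mu)) (at (P_plus N p mu))"
    using nu_pos by (intro F_deriv) (simp add: half_plane_def P_plus_def)
  moreover have "\<exists>w. w \<noteq> 0 \<and> F' (P_plus N p mu) w = e *\<^sub>R w"
    using \<open>e < 0\<close> \<open>0 < l\<close>
    by (intro exI[of _ "(a / (e - l), 1)"]) (auto simp: F'P field_simps zero_prod_def)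
  moreover have "\<exists>w. w \<noteq> 0 \<and> F' (P_plus N p mu) w = l *\<^sub>R w"
    by (intro exI[of _ "(1, 0)"]) (auto simp: F'P zero_prod_def)
  ultimately show ?thesis unfolding hyperbolic_saddle_def using \<open>e < 0\<close> \<open>0 < l\<close> by blast
qed

end

section \<open>Global positive orbits\<close>

lemma lipschitz_on_of_deriv_bound:
  fixes f :: "real \<Rightarrow> real"
  assumes "\<And>t. T < t \<Longrightarrow> (f has_real_derivative f' t) (at t)" "\<And>t. T < t \<Longrightarrow> \<bar>f' t\<bar> \<le> C" "0 \<le> C"
  shows "C-lipschitz_on {T<..} f"
proof (rule lipschitz_on_leI)
  fix a b assume ab: "a \<in> {T<..}" "b \<in> {T<..}" "a \<le> b"
  have f': "- C \<le> f' t" "f' t \<le> C" if "T < t" for t using assms(2)[OF that] by linarith+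
  have "f a + (- C) * (b - a) \<le> f b"
    by (rule DERIV_ge_imp_growth[where f' = f']) (use assms(1) f' ab in auto)
  moreover have "f b \<le> f a + C * (b - a)"
    by (rule DERIV_le_imp_growth[where f' = f']) (use assms(1) f' ab in auto)
  ultimately show "dist (f a) (f b) \<le> C * dist a b"
    using ab(3) unfolding dist_real_def by (simp add: abs_le_iff algebra_simps)
qed (fact assms(3))

lemma bounded_mono_tendsto:
  fixes f :: "real \<Rightarrow> real"
  assumes "\<And>a b. T < a \<Longrightarrow> a \<le> b \<Longrightarrow> f a \<le> f b" "\<And>t. T < t \<Longrightarrow> f t \<le> C"
  obtains l where "(f \<longlongrightarrow> l) at_top" "\<And>t. T < t \<Longrightarrow> f t \<le> l"
proof
  have bdd: "bdd_above (f ` {T<..})" using assms(2) by (auto intro!: bdd_aboveI)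
  show le: "f t \<le> Sup (f ` {T<..})" if "T < t" for t
    using that bdd by (intro cSUP_upper) auto
  show "(f \<longlongrightarrow> Sup (f ` {T<..})) at_top"
  proof (rule order_tendstoI)
    fix a assume "a < Sup (f ` {T<..})"
    then obtain t where "T < t" "a < f t" using less_cSUP_iff[OF _ bdd, of a] by auto
    then show "eventually (\<lambda>t. a < f t) at_top"
      using assms(1)[of t] unfolding eventually_at_top_linorder by (meson less_le_trans)
  next
    fix a assume "Sup (f ` {T<..}) < a"
    then show "eventually (\<lambda>t. f t < a) at_top"
      using le unfolding eventually_at_top_dense by (meson le_less_trans)
  qed
qed

context radial
begin

text \<open>A positive orbit on an open ray, hence with two-sided derivatives. Being defined for
  every \<open>t > T\<close> is the essential hypothesis, since orbits that reach
  \<open>x >= nu\<close> blow up in finite time.\<close>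

definition pflow :: "real \<Rightarrow> (real \<Rightarrow> real) \<Rightarrow> (real \<Rightarrow> real) \<Rightarrow> bool" where
  "pflow T x Y \<longleftrightarrow> (\<forall>t>T. 0 < x t \<and> 0 < Y t \<and> (x has_real_derivative fX (x t) (Y t)) (at t) \<and>
     (Y has_real_derivative k * Y t * (g - x t)) (at t))"

text \<open>The deficit in Young's inequality for the product of \<open>g\<close> and
  \<open>x powr (p - 1)\<close>; it is therefore nonnegative and vanishes only at
  \<open>x = g\<close>.\<close>

definition excess :: "real \<Rightarrow> real" where
  "excess x = (p - 1) / p * x powr p - g * x powr (p - 1) + g powr p / p"

text \<open>With \<open>w = Y powr (1 / k)\<close>, so that \<open>w' = w (g - x)\<close>, and \<open>b = (x w) powr (p - 1)\<close>, the system has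
  constant divergence, and \<open>lyap\<close> is its Hamiltonian corrected by a multiple of \<open>w powr p\<close>.\<close>

definition lyap :: "real \<Rightarrow> real \<Rightarrow> real" where
  "lyap x Y = Y powr (p / k) * (excess x - m / p + Y / (q + 1))"

lemma q_pos: "0 < q + 1" using k_pos p1 by simp

text \<open>With \<open>a = p / k\<close> the function splits into
  \<open>Y powr a * excess x\<close> and a function \<open>V\<close> of \<open>Y\<close> alone,
  whose derivative is \<open>Y powr (a - 1) / k * (Y - m)\<close>. Each summand is minimal exactly
  at its own coordinate of the equilibrium.\<close>

lemma lyap_min:
  assumes "0 < x" "0 < Y" "(x, Y) \<noteq> (g, m)" shows "lyap g m < lyap x Y"
proof -
  define a where "a = p / k"
  have "a + 1 = (q + 1) / k" using k_pos add_divide_distrib[of p k k] by (simp add: a_def)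
  then have a: "0 < a" "a / p = 1 / k" "(a + 1) / (q + 1) = 1 / k"
    using k_pos p1 q_pos by (auto simp: a_def)
  define V where "V = (\<lambda>Y. Y powr (a + 1) / (q + 1) - m / p * Y powr a)"
  have lyap: "lyap x Y = Y powr a * excess x + V Y" if "0 < Y" for x Y
    using that by (simp add: lyap_def V_def a_def powr_add algebra_simps)
  have "g powr p = g powr (p - 1) * g" using g_pos powr_add[of g "p - 1" 1] by simp
  then have exg: "excess g = 0" using p1 by (simp add: excess_def field_simps)
  have ex: "excess g < excess x" if "x \<noteq> g"
  proof (rule strict_min_of_deriv_sign[OF _ _ g_pos assms(1) that])
    fix x :: real assume x: "0 < x"
    have eq: "x powr (p - 1) = x powr (p - 2) * x" using x powr_add[of x "p - 2" 1] by simp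
    have "(excess has_real_derivative (p - 1) / p * (p * x powr (p - 1)) - g * ((p - 1) * x powr (p - 1 - 1)) + 0) (at x)"
      unfolding excess_def
      by (intro DERIV_add DERIV_diff DERIV_cmult DERIV_const has_real_derivative_powr x)
    also have "(p - 1) / p * (p * x powr (p - 1)) - g * ((p - 1) * x powr (p - 1 - 1)) + 0
        = (p - 1) * x powr (p - 1) - g * (p - 1) * x powr (p - 2)" using p1 by (simp add: diff_diff_eq)
    also have "\<dots> = (p - 1) * x powr (p - 2) * (x - g)" by (simp add: eq algebra_simps)
    finally show "(excess has_real_derivative (p - 1) * x powr (p - 2) * (x - g)) (at x)" .
    assume "x \<noteq> g"
    then have "0 < ((p - 1) * x powr (p - 2)) * (x - g)\<^sup>2" using p1 x by (intro mult_pos_pos) auto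
    then show "0 < (p - 1) * x powr (p - 2) * (x - g) * (x - g)" by (simp only: power2_eq_square mult.assoc)
  qed
  have V: "V m < V Y" if "Y \<noteq> m"
  proof (rule strict_min_of_deriv_sign[OF _ _ m_pos assms(2) that])
    fix x :: real assume x: "0 < x"
    have eq: "x powr a = x powr (a - 1) * x" using x powr_add[of x "a - 1" 1] by simp
    have "(V has_real_derivative ((a + 1) * x powr (a + 1 - 1)) / (q + 1) - m / p * (a * x powr (a - 1))) (at x)"
      unfolding V_def
      by (intro DERIV_diff DERIV_cmult DERIV_cdivide has_real_derivative_powr x)
    also have "((a + 1) * x powr (a + 1 - 1)) / (q + 1) - m / p * (a * x powr (a - 1))
      = (a + 1) / (q + 1) * x powr a - m * (a / p) * x powr (a - 1)" by simp
    also have "\<dots> = x powr (a - 1) / k * (x - m)" unfolding a eq by (simp add: diff_divide_distrib algebra_simps)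
    finally show "(V has_real_derivative x powr (a - 1) / k * (x - m)) (at x)" .
    assume "x \<noteq> m"
    then have "0 < (x powr (a - 1) / k) * (x - m)\<^sup>2" using k_pos x by (intro mult_pos_pos) auto
    then show "0 < x powr (a - 1) / k * (x - m) * (x - m)" by (simp only: power2_eq_square mult.assoc)
  qed
  have "V m \<le> V Y" "excess g \<le> excess x" using V ex by fastforce+
  moreover have "V m < V Y \<or> 0 < Y powr a * excess x"
    using V ex exg assms by (cases "Y = m") auto
  moreover have "0 \<le> Y powr a * excess x" using \<open>excess g \<le> excess x\<close> exg by simp
  ultimately have "V m < Y powr a * excess x + V Y" by linarith
  then show ?thesis using lyap[OF assms(2), of x] lyap[OF m_pos, of g] exg by simp
qed

context
  fixes T :: real and x Y :: "real \<Rightarrow> real"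
  assumes pf: "pflow T x Y"
begin

lemma pflowD: 
  assumes "T < t"
  shows "0 < x t" "0 < Y t" "(x has_real_derivative fX (x t) (Y t)) (at t)"
     "(Y has_real_derivative k * Y t * (g - x t)) (at t)"
  using pf assms by (auto simp: pflow_def)

text \<open>Passing to \<open>x powr (p - 1)\<close> cancels the factor
  \<open>x powr (2 - p) / (p - 1)\<close> of the field; the derivative stays bounded for bounded
  \<open>x\<close> and \<open>Y\<close>, even as \<open>x\<close> approaches 0.\<close>

lemma pflow_X_deriv:
  assumes "T < t"
  shows "((\<lambda>t. x t powr (p - 1)) has_real_derivative mu + Y t - h (x t)) (at t)"
proof -
  have "x t powr (p - 2) * x t powr (2 - p) = 1" using pflowD(1)[OF assms] by (simp flip: powr_add)
  then have "(p - 1) * x t powr (p - 2) * fX (x t) (Y t) = mu + Y t - h (x t)"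
  proof -
    have "(p - 1) * x t powr (p - 2) * fX (x t) (Y t)
      = (x t powr (p - 2) * x t powr (2 - p)) * (mu + Y t - h (x t))"
      using p1 by (simp add: fX_eq[OF pflowD(1)[OF assms]])
    then show ?thesis using \<open>x t powr (p - 2) * x t powr (2 - p) = 1\<close> by simp
  qed
  moreover have "((\<lambda>t. x t powr (p - 1)) has_real_derivative
      (p - 1) * x t powr (p - 1 - of_nat 1) * fX (x t) (Y t)) (at t)"
    by (rule DERIV_fun_powr[OF pflowD(3,1)[OF assms]])
  ultimately show ?thesis by (simp add: diff_diff_eq)
qed

text \<open>Once \<open>x >= nu\<close>, the first component stays there and increases. Slightly
  later \<open>X = x powr (p - 1)\<close> grows at a rate of at least \<open>eta > 0\<close>, so
  \<open>x\<close> becomes large; then \<open>x' >= x^2 / 2\<close>, and \<open>1 / x\<close> would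
  become negative in finite time.\<close>

lemma pflow_x_less_nu:
  assumes "T < t" shows "x t < nu"
proof (rule ccontr)
  assume "\<not> x t < nu"
  then have t: "nu \<le> x t" by simp
  have ge: "nu \<le> x b" if "t \<le> b" for b
  proof (rule DERIV_barrier[where f = x and f' = "\<lambda>t. fX (x t) (Y t)" and a = t])
    fix u assume u: "t \<le> u" "u \<le> b"
    then show "(x has_real_derivative fX (x u) (Y u)) (at u)" using pflowD(3) assms by auto
    assume "x u = nu"
    then show "0 < fX (x u) (Y u)"
      using u assms pflowD(2)[of u] nu_pos p1 by (simp add: fX_eq h_nu)
  qed (use t that in auto)
  have h_le: "h (x b) \<le> mu" if "t \<le> b" for b
    using ge[OF that] h_less_mu[of "x b"] h_nu by (cases "x b = nu") auto
  have pos: "0 < fX (x b) (Y b)" if "t \<le> b" for b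
    using h_le[OF that] pflowD(1,2)[of b] assms that p1 by (simp add: fX_eq)
  have mono: "x a \<le> x b" if "t \<le> a" "a \<le> b" for a b
    using DERIV_ge_imp_growth[of a b x "\<lambda>t. fX (x t) (Y t)" 0] that pflowD(3) assms pos
    by (auto simp: less_imp_le)
  define x2 where "x2 = x (t + 1)"
  have "nu < x2"
  proof -
    obtain z where "t < z" "x (t + 1) - x t = (t + 1 - t) * fX (x z) (Y z)"
      using MVT2[of t "t + 1" x "\<lambda>t. fX (x t) (Y t)"] pflowD(3) assms by auto
    then show ?thesis using pos[of z] t by (simp add: x2_def)
  qed
  define eta where "eta = mu - h x2"
  have "eta > 0" using h_less_mu[OF \<open>nu < x2\<close>] by (simp add: eta_def)
  have X': "eta \<le> mu + Y b - h (x b)" if "t + 1 \<le> b" for b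
  proof -
    have "x2 \<le> x b" using mono[of "t + 1" b] that by (simp add: x2_def)
    then have "h (x b) \<le> h x2"
      using h_strict_antimono[of x2 "x b"] nu_bounds(1) \<open>nu < x2\<close> by (cases "x2 = x b") auto
    then show ?thesis using pflowD(2)[of b] that assms by (simp add: eta_def)
  qed
  \<comment> \<open>Beyond twice the zero \<open>(N - p) / (p - 1)\<close> of \<open>h\<close>, one
    has \<open>x * (x - (N - p) / (p - 1)) >= x^2 / 2\<close>. The time \<open>b\<close> below is
    when \<open>X\<close> has gained \<open>x3 powr (p - 1)\<close>.\<close>
  define x3 where "x3 = 2 * (N - p) / (p - 1)"
  have "x3 > 0" using p1 pN by (simp add: x3_def)
  define b where "b = t + 1 + x3 powr (p - 1) / eta"
  have b: "t + 1 \<le> b" using \<open>eta > 0\<close> by (simp add: b_def)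
  have "x (t + 1) powr (p - 1) + eta * (b - (t + 1)) \<le> x b powr (p - 1)"
    by (rule DERIV_ge_imp_growth[OF b pflow_X_deriv X']) (use assms in auto)
  moreover have "eta * (b - (t + 1)) = x3 powr (p - 1)" using \<open>eta > 0\<close> by (simp add: b_def)
  ultimately have "x3 powr (p - 1) < x b powr (p - 1)" using pflowD(1)[of "t + 1"] assms by (smt (verit) powr_gt_zero)
  then have xb: "x3 < x b" using p1 pflowD(1)[of b] b assms by (smt (verit) powr_mono2)
  define z where "z = (\<lambda>t. inverse (x t))"
  have zd: "(z has_real_derivative - (fX (x u) (Y u) * inverse ((x u)\<^sup>2))) (at u)" if "b \<le> u" for u
    unfolding z_def using DERIV_inverse_fun[OF pflowD(3), of u] pflowD(1)[of u] that b assms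
    by (simp add: numeral_2_eq_2)
  have zle: "- (fX (x u) (Y u) * inverse ((x u)\<^sup>2)) \<le> - 1 / 2" if "b \<le> u" for u
  proof -
    have u: "x3 < x u" "0 < x u" "0 < Y u" using mono[of b u] b that xb pflowD(1,2)[of u] assms by auto
    have "(x u)\<^sup>2 / 2 \<le> x u * (x u - (N - p) / (p - 1))"
    proof -
      have "x3 = 2 * ((N - p) / (p - 1))" by (simp add: x3_def)
      then have "(N - p) / (p - 1) \<le> x u / 2" using u(1) by linarith
      then have "x u * (x u / 2) \<le> x u * (x u - (N - p) / (p - 1))"
        using u(2) by (intro mult_left_mono) auto
      then show ?thesis by (simp add: power2_eq_square)
    qed
    also have "\<dots> = - (x u * (N - p - (p - 1) * x u)) / (p - 1)" using p1 by (simp add: field_simps)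
    also have "\<dots> \<le> fX (x u) (Y u)" unfolding fX_def using p1 u mu_pos
      by (intro divide_right_mono) auto
    finally show ?thesis using u by (simp add: field_simps)
  qed
  \<comment> \<open>With slope at most \<open>- 1 / 2\<close> on an interval of length
    \<open>2 * z b + 2\<close>, the function \<open>z\<close> drops to at most
    \<open>- 1\<close>.\<close>
  define c where "c = b + 2 * z b + 2"
  have "0 < z b" using pflowD(1)[of b] b assms by (simp add: z_def)
  have "z c \<le> z b + (- 1 / 2) * (c - b)"
    by (rule DERIV_le_imp_growth[where f' = "\<lambda>u. - (fX (x u) (Y u) * inverse ((x u)\<^sup>2))"])
      (use zd zle \<open>0 < z b\<close> in \<open>auto simp: c_def\<close>)
  then have "z c < 0" by (simp add: c_def add_divide_distrib)
  moreover have "T < c" using b assms \<open>0 < z b\<close> by (simp add: c_def)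
  ultimately show False using pflowD(1)[of c] by (simp add: z_def)
qed

lemma pflow_X_bounds:
  assumes "T < t" shows "0 < x t powr (p - 1)" "x t powr (p - 1) \<le> nu powr (p - 1)"
  using pflowD(1)[OF assms] pflow_x_less_nu[OF assms] p1 by (auto intro!: powr_mono2)

lemma pflow_h_bound:
  assumes "T < t" shows "\<bar>h (x t)\<bar> \<le> nu powr (p - 1) * (N - p + (p - 1) * nu)"
  unfolding h_fun_def abs_mult
proof (intro mult_mono)
  have "0 < (p - 1) * x t" "(p - 1) * x t < (p - 1) * nu"
    using pflowD(1)[OF assms] pflow_x_less_nu[OF assms] p1 by auto
  then show "\<bar>N - p - (p - 1) * x t\<bar> \<le> N - p + (p - 1) * nu"
    using pN by linarith
qed (use pflow_X_bounds[OF assms] in auto)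

text \<open>Because \<open>x < nu\<close>, \<open>Y\<close> decays at most at the rate
  \<open>c = k * (nu - g)\<close>. A large value of \<open>Y\<close> thus persists for a unit of
  time and would raise \<open>x powr (p - 1)\<close> above its bound
  \<open>nu powr (p - 1)\<close>.\<close>

lemma pflow_Y_bounded: "\<exists>B>0. \<forall>t>T. Y t \<le> B"
proof -
  define c where "c = k * (nu - g)"
  define H where "H = nu powr (p - 1) * (N - p + (p - 1) * nu)"
  have "c > 0" using k_pos g_less_nu by (simp add: c_def)
  have "Y t \<le> exp c * (H + nu powr (p - 1))" if t: "T < t" for t
  proof -
    have low: "Y t * exp (- c) \<le> Y u" if u: "t \<le> u" "u \<le> t + 1" for u
    proof -
      have "Y t * exp (c * t) + 0 * (u - t) \<le> Y u * exp (c * u)"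
      proof (rule DERIV_ge_imp_growth[OF u(1)])
        fix r assume r: "t \<le> r" "r \<le> u"
        show "((\<lambda>t. Y t * exp (c * t)) has_real_derivative (Y r * exp (c * r)) * (k * (nu - x r))) (at r)"
          using t r by (auto intro!: derivative_eq_intros pflowD(4) simp: c_def algebra_simps)
        show "0 \<le> (Y r * exp (c * r)) * (k * (nu - x r))"
          using t r pflowD(2)[of r] pflow_x_less_nu[of r] k_pos by simp
      qed
      then have "Y t * exp (c * t - c * u) \<le> Y u" by (simp add: exp_diff field_simps)
      moreover have "- c \<le> c * t - c * u"
        using u \<open>c > 0\<close> mult_left_mono[of u "t + 1" c] by (simp add: algebra_simps)
      then have "Y t * exp (- c) \<le> Y t * exp (c * t - c * u)" using pflowD(2)[OF t] by simp
      ultimately show ?thesis by linarith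
    qed
    have "x t powr (p - 1) + (Y t * exp (- c) - H) * (t + 1 - t) \<le> x (t + 1) powr (p - 1)"
    proof (rule DERIV_ge_imp_growth[OF _ pflow_X_deriv])
      fix u assume u: "t \<le> u" "u \<le> t + 1"
      show "Y t * exp (- c) - H \<le> mu + Y u - h (x u)"
        using low[OF u] pflow_h_bound[of u] t u mu_pos by (simp add: H_def)
    qed (use t in auto)
    then have "x t powr (p - 1) + (Y t * exp (- c) - H) \<le> x (t + 1) powr (p - 1)" by simp
    moreover have "T < t + 1" using t by simp
    ultimately have "Y t * exp (- c) \<le> H + nu powr (p - 1)"
      using pflow_X_bounds(1)[OF t] pflow_X_bounds(2)[of "t + 1"] by linarith
    then show ?thesis by (simp add: exp_minus field_simps)
  qed
  moreover have "0 < H" using nu_pos p1 pN by (simp add: H_def add_pos_pos)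
  ultimately show ?thesis by (intro exI[of _ "exp c * (H + nu powr (p - 1))"]) (auto intro!: mult_pos_pos add_pos_nonneg)
qed


lemma pflow_Y_powr_deriv:
  assumes t: "T < t"
  shows "((\<lambda>t. Y t powr (p / k)) has_real_derivative p * Y t powr (p / k) * (g - x t)) (at t)"
proof -
  have "Y t powr (p / k - 1) * Y t = Y t powr (p / k)"
    using pflowD(2)[OF t] powr_add[of "Y t" "p / k - 1" 1] by simp
  moreover have "p / k * k = p" using k_pos by simp
  moreover have "p / k * Y t powr (p / k - 1) * (k * Y t * (g - x t))
    = (p / k * k) * (Y t powr (p / k - 1) * Y t) * (g - x t)" by (simp only: mult_ac)
  ultimately have "p / k * Y t powr (p / k - 1) * (k * Y t * (g - x t)) = p * Y t powr (p / k) * (g - x t)"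
    by simp
  then show ?thesis using DERIV_fun_powr[OF pflowD(4,2)[OF t], of "p / k"] by simp
qed

text \<open>The coefficient \<open>p * g - (N - p)\<close> is the constant divergence in the
  variables \<open>w\<close> and \<open>b\<close>. The product of the two differences is nonnegative
  because \<open>x powr (p - 1)\<close> is increasing.\<close>

lemma lyap_deriv:
  assumes t: "T < t"
  shows "((\<lambda>t. lyap (x t) (Y t)) has_real_derivative (p * g - (N - p)) *
    (Y t powr (p / k) * (g - x t) * (g powr (p - 1) - x t powr (p - 1)))) (at t)"
proof -
  note d = pflowD[OF t]
  define X' where "X' = mu + Y t - h (x t)"
  have x1: "x t powr p = x t powr (p - 1) * x t" "g powr p = g powr (p - 1) * g"
    using d(1) g_pos powr_add[of _ "p - 1" 1] by auto
  note dY = pflow_Y_powr_deriv[OF t]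
  have dx: "((\<lambda>t. excess (x t)) has_real_derivative (x t - g) * X') (at t)"
  proof -
    have "x t powr (p - 1) * x t powr (2 - p) = x t" using d(1) by (simp flip: powr_add)
    then have "(p - 1) * x t powr (p - 1) * fX (x t) (Y t) = x t * X'"
      using p1 by (simp add: fX_eq[OF d(1)] X'_def mult.assoc[symmetric])
    moreover have "(p - 1) / p * (p * x t powr (p - of_nat 1) * fX (x t) (Y t)) - g * X' + 0
      = (p - 1) * x t powr (p - 1) * fX (x t) (Y t) - g * X'" using p1 by simp
    ultimately have "(p - 1) / p * (p * x t powr (p - of_nat 1) * fX (x t) (Y t)) - g * X' + 0 = (x t - g) * X'"
      by (simp add: left_diff_distrib)
    moreover have "((\<lambda>t. excess (x t)) has_real_derivative
        (p - 1) / p * (p * x t powr (p - of_nat 1) * fX (x t) (Y t)) - g * X' + 0) (at t)"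
      unfolding excess_def X'_def
      by (intro DERIV_add DERIV_diff DERIV_cmult DERIV_const DERIV_fun_powr[OF d(3,1)] pflow_X_deriv t)
    ultimately show ?thesis by simp
  qed
  have "((\<lambda>t. lyap (x t) (Y t)) has_real_derivative
      (p * Y t powr (p / k) * (g - x t)) * (excess (x t) - m / p + Y t / (q + 1))
      + ((x t - g) * X' - 0 + k * Y t * (g - x t) / (q + 1)) * Y t powr (p / k)) (at t)"
    unfolding lyap_def
    by (intro DERIV_mult DERIV_add DERIV_diff dY dx DERIV_cdivide DERIV_const d(4))
  also have "(p * Y t powr (p / k) * (g - x t)) * (excess (x t) - m / p + Y t / (q + 1))
      + ((x t - g) * X' - 0 + k * Y t * (g - x t) / (q + 1)) * Y t powr (p / k)
      = Y t powr (p / k) * (g - x t) * (p * excess (x t) - m + (p * (Y t / (q + 1)) + k * (Y t / (q + 1))) - X')"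
  proof -
    define W n where "W = Y t / (q + 1)" and "n = m / p"
    have mn: "m = p * n" and eq: "k * Y t * (g - x t) / (q + 1) = k * W * (g - x t)"
      using p1 by (auto simp: W_def n_def)
    show ?thesis unfolding W_def[symmetric] n_def[symmetric] eq by (simp add: mn algebra_simps)
  qed
  also have "p * (Y t / (q + 1)) + k * (Y t / (q + 1)) = Y t"
  proof -
    have "p * (Y t / (q + 1)) + k * (Y t / (q + 1)) = (p + k) * (Y t / (q + 1))"
      by (simp only: distrib_right)
    moreover have "p + k = q + 1" by simp
    ultimately show ?thesis using q_pos by simp
  qed
  \<comment> \<open>The powers of order \<open>p\<close> in \<open>x\<close> cancel against those in
    \<open>h\<close>. The multiple of \<open>w powr p\<close> added to the Hamiltonian is the one
    for which this bracket vanishes at \<open>x = g\<close>, so that the whole derivative has a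
    sign.\<close>
  also have "p * excess (x t) - m + Y t - X' = (p * g - (N - p)) * (g powr (p - 1) - x t powr (p - 1))"
  proof -
    have "p * excess (x t) = p * ((p - 1) / p * x t powr p) - p * (g * x t powr (p - 1)) + p * (g powr p / p)"
      unfolding excess_def by (simp only: right_diff_distrib distrib_left)
    also have "\<dots> = (p - 1) * x t powr p - p * (g * x t powr (p - 1)) + g powr p"
      using p1 by (simp del: right_diff_distrib left_diff_distrib)
    finally have "p * excess (x t) = \<dots>" .
    then show ?thesis unfolding m_def X'_def x1 h_fun_def by (simp add: algebra_simps)
  qed
  finally show ?thesis by (simp add: mult_ac)
qed

lemma lyap_mono: "T < a \<Longrightarrow> a \<le> b \<Longrightarrow> lyap (x a) (Y a) \<le> lyap (x b) (Y b)"
proof -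
  assume ab: "T < a" "a \<le> b"
  have "lyap (x a) (Y a) + 0 * (b - a) \<le> lyap (x b) (Y b)"
  proof (rule DERIV_ge_imp_growth[OF ab(2) lyap_deriv])
    fix t assume t: "a \<le> t" "t \<le> b"
    then have d: "0 < x t" "0 < Y t" using pflowD ab by auto
    have "0 \<le> (g - x t) * (g powr (p - 1) - x t powr (p - 1))"
      using d(1) g_pos p1 powr_mono2[of "p - 1" g "x t"] powr_mono2[of "p - 1" "x t" g]
      by (cases "x t \<le> g") (auto intro: mult_nonpos_nonpos)
    then show "0 \<le> (p * g - (N - p)) * (Y t powr (p / k) * (g - x t) * (g powr (p - 1) - x t powr (p - 1)))"
      using p_g_gt by (simp add: mult.assoc)
  qed (use ab in auto)
  then show ?thesis by simp
qed

text \<open>Barbalat applied to \<open>lyap\<close> gives \<open>D\<close> tending to 0, which only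
  says that \<open>Y\<close> or \<open>x - g\<close> is small. Applied to \<open>Z\<close>, which
  vanishes with \<open>D\<close>, it yields \<open>A\<close> tending to 0, where \<open>A\<close> is
  \<open>Y powr al\<close> times the derivative of \<open>X\<close>. Where \<open>D\<close> and
  \<open>A\<close> both vanish, either \<open>Y = 0\<close> or the point is the equilibrium; the
  latter is kept away by the growth of \<open>lyap\<close>.\<close>

lemma pflow_dichotomy: "(\<forall>t>T. x t = g \<and> Y t = m) \<or> (Y \<longlongrightarrow> 0) at_top"
proof (cases "\<forall>t>T. x t = g \<and> Y t = m")
  case False
  then obtain t1 where t1: "T < t1" "(x t1, Y t1) \<noteq> (g, m)" by auto
  obtain B where B: "0 < B" "\<And>t. T < t \<Longrightarrow> Y t \<le> B" using pflow_Y_bounded by blast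
  define al where "al = p / k"
  define C where "C = p * g - (N - p)"
  have al: "0 < al" and C: "0 < C" using k_pos p1 p_g_gt by (auto simp: al_def C_def)
  \<comment> \<open>The compact set lives in the coordinates \<open>X\<close> and \<open>Y\<close>
    and includes the edges \<open>X = 0\<close> and \<open>Y = 0\<close>: all functions below extend
    continuously to it, as only positive powers occur.\<close>
  define K where "K = {0..nu powr (p - 1)} \<times> {0..B}"
  define X where "X = (\<lambda>t. x t powr (p - 1))"
  define st where "st = (\<lambda>t. (X t, Y t))"
  define xi where "xi = (\<lambda>z :: real \<times> real. fst z powr (1 / (p - 1)))"
  define H where "H = (\<lambda>z. fst z * (N - p - (p - 1) * xi z))"
  define Y\<alpha> where "Y\<alpha> = (\<lambda>z :: real \<times> real. snd z powr al)"
  define Z where "Z = (\<lambda>z. Y\<alpha> z * (fst z - g powr (p - 1)))"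
  define D where "D = (\<lambda>z. C * (Y\<alpha> z * (g - xi z) * (g powr (p - 1) - fst z)))"
  define A where "A = (\<lambda>z. Y\<alpha> z * (mu + snd z - H z))"
  define L where "L = (\<lambda>z. lyap (xi z) (snd z))"
  have K: "compact K" unfolding K_def by (intro compact_Times) auto
  have stK: "st t \<in> K" if "T < t" for t
    using pflow_X_bounds[OF that] pflowD(2)[OF that] B(2)[OF that] by (auto simp: K_def st_def X_def)
  have evK: "eventually (\<lambda>t. st t \<in> K) at_top"
    using eventually_gt_at_top[of T] by eventually_elim (rule stK)
  have xi: "xi (st t) = x t" if "T < t" for t
    using pflowD(1)[OF that] p1 by (simp add: xi_def st_def X_def powr_powr)
  have Hst: "H (st t) = h (x t)" if "T < t" for t
    using xi[OF that] by (simp add: H_def st_def X_def h_fun_def)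
  have xic: "continuous_on K xi" unfolding xi_def K_def using p1
    by (intro continuous_on_powr' continuous_intros) auto
  have Yc: "continuous_on K Y\<alpha>" unfolding Y\<alpha>_def K_def using al
    by (intro continuous_on_powr' continuous_intros) auto
  have xipc: "continuous_on K (\<lambda>z. xi z powr a)" if "0 < a" for a
    by (rule continuous_on_powr'[OF xic continuous_on_const]) (use that in \<open>auto simp: xi_def\<close>)
  have Lc: "continuous_on K L"
    unfolding L_def lyap_def excess_def Y\<alpha>_def[symmetric] al_def[symmetric] fun_cong[OF Y\<alpha>_def, symmetric]
    using p1 q_pos by (intro continuous_intros Yc xipc) auto
  have Zc: "continuous_on K Z" and Dc: "continuous_on K D" and Ac: "continuous_on K A"
    unfolding Z_def D_def A_def H_def by (intro continuous_intros xic Yc)+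
  have lip: "\<exists>c. c-lipschitz_on {T<..} st"
  proof -
    define H0 where "H0 = nu powr (p - 1) * (N - p + (p - 1) * nu)"
    have "(mu + B + H0)-lipschitz_on {T<..} X"
    proof (rule lipschitz_on_of_deriv_bound)
      show "(X has_real_derivative mu + Y t - h (x t)) (at t)" if "T < t" for t
        unfolding X_def by (rule pflow_X_deriv[OF that])
      show "\<bar>mu + Y t - h (x t)\<bar> \<le> mu + B + H0" if "T < t" for t
        using pflow_h_bound[OF that] pflowD(2)[OF that] B(2)[OF that] mu_pos unfolding H0_def by linarith
      show "0 \<le> mu + B + H0" using mu_pos B(1) nu_pos p1 pN by (simp add: H0_def)
    qed
    moreover have "(k * B * (g + nu))-lipschitz_on {T<..} Y"
    proof (rule lipschitz_on_of_deriv_bound)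
      show "(Y has_real_derivative k * Y t * (g - x t)) (at t)" if "T < t" for t
        by (rule pflowD(4)[OF that])
      show "\<bar>k * Y t * (g - x t)\<bar> \<le> k * B * (g + nu)" if "T < t" for t
        unfolding abs_mult using k_pos pflowD(1,2)[OF that] B that pflow_x_less_nu[OF that] g_pos
        by (intro mult_mono) auto
      show "0 \<le> k * B * (g + nu)" using k_pos B(1) g_pos nu_pos by simp
    qed
    ultimately show ?thesis unfolding st_def using lipschitz_on_Pair by blast
  qed
  then obtain c where lip: "c-lipschitz_on {T<..} st" by blast
  note uc = uniformly_continuous_on_lipschitz_path[OF lip _ K]
  have im: "st ` {T<..} \<subseteq> K" using stK by auto
  have Lst: "L (st t) = lyap (x t) (Y t)" if "T < t" for t
    using xi[OF that] by (simp add: L_def st_def)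
  obtain CL where CL: "\<And>z. z \<in> K \<Longrightarrow> L z \<le> CL"
    using compact_imp_bounded[OF compact_continuous_image[OF Lc K]]
    unfolding bounded_iff by (metis abs_le_D1 imageI real_norm_def)
  have "lyap (x t) (Y t) \<le> CL" if "T < t" for t
    using CL[OF stK[OF that]] Lst[OF that] by simp
  then obtain l where l: "((\<lambda>t. lyap (x t) (Y t)) \<longlongrightarrow> l) at_top"
    using bounded_mono_tendsto[of T "\<lambda>t. lyap (x t) (Y t)" CL, OF lyap_mono] by blast
  have Dst: "D (st t) = C * (Y t powr al * (g - x t) * (g powr (p - 1) - X t))" if "T < t" for t
    using xi[OF that] by (simp add: D_def Y\<alpha>_def st_def)
  have Dlim: "((\<lambda>t. D (st t)) \<longlongrightarrow> 0) at_top"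
  proof (rule barbalat[OF _ uc[OF im Dc] l])
    show "((\<lambda>t. lyap (x t) (Y t)) has_real_derivative D (st t)) (at t)" if "T < t" for t
      using lyap_deriv[OF that] Dst[OF that] by (simp add: C_def al_def X_def)
  qed
  have xi_g: "xi z = g \<longleftrightarrow> fst z = g powr (p - 1)" if "z \<in> K" for z
  proof -
    have "xi z powr (p - 1) = fst z" "(g powr (p - 1)) powr (1 / (p - 1)) = g"
      using that g_pos p1 by (auto simp: xi_def K_def powr_powr)
    then show ?thesis unfolding xi_def by metis
  qed
  have Zlim: "((\<lambda>t. Z (st t)) \<longlongrightarrow> 0) at_top"
  proof (rule tendsto_zero_on_compact[OF K Dc Zc _ evK Dlim])
    fix z assume z: "z \<in> K" "D z = 0"
    then have "Y\<alpha> z = 0 \<or> xi z = g \<or> fst z = g powr (p - 1)" using C by (auto simp: D_def)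
    then show "Z z = 0" using xi_g[OF z(1)] by (auto simp: Z_def)
  qed
  \<comment> \<open>The derivative of \<open>Z\<close> along the orbit. Its part coming from
    \<open>Y powr al\<close> is a multiple of \<open>D\<close>, so the limit of \<open>A\<close> can
    be separated from that of \<open>D\<close>.\<close>
  define ZD where "ZD = (\<lambda>z. A z - p / C * D z)"
  have ZDlim: "((\<lambda>t. ZD (st t)) \<longlongrightarrow> 0) at_top"
  proof (rule barbalat[OF _ uc[OF im] Zlim])
    show "continuous_on K ZD" unfolding ZD_def by (intro continuous_intros Ac Dc)
    fix t assume t: "T < t"
    note dY = pflow_Y_powr_deriv[OF t, folded al_def]
    have "((\<lambda>t. Y t powr al * (X t - g powr (p - 1))) has_real_derivative
        (p * Y t powr al * (g - x t)) * (X t - g powr (p - 1)) + (mu + Y t - h (x t) - 0) * Y t powr al) (at t)"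
      unfolding X_def by (intro DERIV_mult DERIV_diff dY pflow_X_deriv t DERIV_const)
    moreover have "(p * Y t powr al * (g - x t)) * (X t - g powr (p - 1)) + (mu + Y t - h (x t) - 0) * Y t powr al
      = ZD (st t)"
    proof -
      have "p / C * D (st t) = p * (Y t powr al * (g - x t) * (g powr (p - 1) - X t))"
        using C by (simp add: Dst[OF t])
      then show ?thesis using Hst[OF t] by (simp add: ZD_def A_def Y\<alpha>_def st_def algebra_simps)
    qed
    ultimately show "((\<lambda>t. Z (st t)) has_real_derivative ZD (st t)) (at t)"
      by (simp add: Z_def Y\<alpha>_def st_def)
  qed
  have Alim: "((\<lambda>t. A (st t)) \<longlongrightarrow> 0) at_top"
    using tendsto_add[OF ZDlim tendsto_mult_right[OF Dlim, of "p / C"]] by (simp add: ZD_def)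
  \<comment> \<open>\<open>W\<close> vanishes on both alternatives, \<open>Y = 0\<close> and the
    equilibrium. From \<open>t1\<close> on its second factor is at least \<open>e > 0\<close>, so
    \<open>W\<close> tending to 0 forces \<open>Y\<close> to do so.\<close>
  define W where "W = (\<lambda>z. snd z * (L z - lyap g m))"
  have "((\<lambda>t. W (st t)) \<longlongrightarrow> 0) at_top"
  proof (rule tendsto_zero_on_compact[OF K, where D = "\<lambda>z. \<bar>D z\<bar> + \<bar>A z\<bar>"])
    show "((\<lambda>t. \<bar>D (st t)\<bar> + \<bar>A (st t)\<bar>) \<longlongrightarrow> 0) at_top"
      using tendsto_add[OF tendsto_rabs[OF Dlim] tendsto_rabs[OF Alim]] by simp
    show "continuous_on K (\<lambda>z. \<bar>D z\<bar> + \<bar>A z\<bar>)" "continuous_on K W"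
      unfolding W_def by (intro continuous_intros Dc Ac Lc)+
    fix z assume z: "z \<in> K" "\<bar>D z\<bar> + \<bar>A z\<bar> = 0"
    then have DA: "D z = 0" "A z = 0" by linarith+
    show "W z = 0"
    proof (cases "snd z = 0")
      case False
      then have "Y\<alpha> z \<noteq> 0" by (simp add: Y\<alpha>_def)
      then have *: "xi z = g" "fst z = g powr (p - 1)" and "mu + snd z - H z = 0"
        using DA C xi_g[OF z(1)] by (auto simp: D_def A_def)
      then have "snd z = m" by (simp add: H_def m_def h_fun_def)
      then show ?thesis using * by (simp add: W_def L_def)
    qed (simp add: W_def)
  qed (fact evK)
  define e where "e = lyap (x t1) (Y t1) - lyap g m"
  have "0 < e" using lyap_min[OF _ _ t1(2)] pflowD(1,2)[OF t1(1)] by (simp add: e_def)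
  have W: "((\<lambda>t. W (st t) / e) \<longlongrightarrow> 0) at_top"
    using tendsto_divide[OF \<open>((\<lambda>t. W (st t)) \<longlongrightarrow> 0) at_top\<close> tendsto_const, of e] \<open>0 < e\<close> by simp
  have "(Y \<longlongrightarrow> 0) at_top"
  proof (rule tendsto_sandwich[OF _ _ tendsto_const W])
    show "eventually (\<lambda>t. 0 \<le> Y t) at_top"
      using eventually_gt_at_top[of T] by eventually_elim (simp add: pflowD(2) less_imp_le)
    show "eventually (\<lambda>t. Y t \<le> W (st t) / e) at_top"
      using eventually_ge_at_top[of t1]
    proof eventually_elim
      case (elim t)
      then have "T < t" using t1 by simp
      have "e \<le> lyap (x t) (Y t) - lyap g m" using lyap_mono[OF t1(1) elim] by (simp add: e_def)
      then have "Y t * e \<le> W (st t)"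
        using pflowD(2)[OF \<open>T < t\<close>] Lst[OF \<open>T < t\<close>] by (simp add: W_def st_def)
      then show ?case using \<open>0 < e\<close> by (simp add: pos_le_divide_eq)
    qed
  qed
  then show ?thesis ..
qed blast


section \<open>Orbits with \<open>Y\<close> tending to 0\<close>

context
  assumes Y0: "(Y \<longlongrightarrow> 0) at_top"
begin

lemma pflow_Y_small: "0 < e \<Longrightarrow> \<exists>S>T. \<forall>t\<ge>S. Y t < e"
proof -
  assume "0 < e"
  then have "eventually (\<lambda>t. Y t < e \<and> T < t) at_top"
    using Y0 by (intro eventually_conj order_tendstoD eventually_gt_at_top) auto
  then obtain S where "\<And>t. S \<le> t \<Longrightarrow> Y t < e \<and> T < t" by (auto simp: eventually_at_top_linorder)
  then show ?thesis by (intro exI[of _ S]) auto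
qed

text \<open>Below \<open>nu\<close> the first component would be driven to \<open>x \<le> g\<close>, where the second one increases.\<close>

lemma pflow_x_barrier:
  assumes "T < S" "g \<le> a" "a < nu" "\<And>t. S \<le> t \<Longrightarrow> Y t < h a - mu" "S \<le> t" "x t \<le> a" "t \<le> b"
  shows "x b \<le> a"
proof -
  have "- a \<le> - x b"
  proof (rule DERIV_barrier[where f = "\<lambda>t. - x t" and a = t and f' = "\<lambda>t. - fX (x t) (Y t)"])
    fix u assume u: "t \<le> u" "u \<le> b"
    then show "((\<lambda>t. - x t) has_real_derivative - fX (x u) (Y u)) (at u)"
      using assms by (intro DERIV_minus pflowD(3)) auto
    assume "- x u = - a"
    then show "0 < - fX (x u) (Y u)"
      using assms(4)[of u] assms(2,5) u g_pos p1 by (simp add: fX_eq zero_less_divide_iff mult_less_0_iff divide_less_0_iff)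
  qed (use assms in auto)
  then show ?thesis by simp
qed

lemma pflow_x_gt_g: "\<exists>S>T. \<forall>t\<ge>S. g < x t"
proof -
  obtain S where S: "T < S" "\<And>t. S \<le> t \<Longrightarrow> Y t < h g - mu"
    using pflow_Y_small[of "h g - mu"] m_pos by (auto simp: m_def)
  have "g < x t" if t: "S \<le> t" for t
  proof (rule ccontr)
    assume "\<not> g < x t"
    then have x: "x b \<le> g" if "t \<le> b" for b
      using pflow_x_barrier[OF S(1) order_refl g_less_nu S(2) t _ that] by simp
    have "Y t + 0 * (b - t) \<le> Y b" if "t \<le> b" for b
    proof (rule DERIV_ge_imp_growth[OF that pflowD(4)])
      fix u assume u: "t \<le> u" "u \<le> b"
      then show "0 \<le> k * Y u * (g - x u)" using x[OF u(1)] pflowD(2)[of u] S(1) t k_pos by simp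
    qed (use S(1) t in auto)
    then have "eventually (\<lambda>b. Y t \<le> Y b) at_top"
      by (intro eventually_mono[OF eventually_ge_at_top[of t]]) simp
    then have "Y t \<le> 0" using tendsto_lowerbound[OF Y0] by simp
    then show False using pflowD(2)[of t] S(1) t by simp
  qed
  then show ?thesis using S(1) by blast
qed

text \<open>If \<open>x <= a < nu\<close> at a late time, this persists; as \<open>g < x\<close> as
  well, \<open>h x >= h a\<close>, and with \<open>Y < e\<close> the derivative of
  \<open>x powr (p - 1)\<close> is at most \<open>- e\<close>. This positive quantity would reach 0
  after a finite time.\<close>

lemma pflow_x_limit: "(x \<longlongrightarrow> nu) at_top"
proof (rule order_tendstoI)
  fix a assume "nu < a"
  then show "eventually (\<lambda>t. x t < a) at_top"
    by (intro eventually_mono[OF eventually_gt_at_top[of T]]) (auto dest: pflow_x_less_nu)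
next
  fix a' assume "a' < nu"
  define a where "a = max g a'"
  have a: "g \<le> a" "a' \<le> a" "a < nu" using g_less_nu \<open>a' < nu\<close> by (auto simp: a_def)
  define e where "e = (h a - mu) / 2"
  have e: "0 < e" "e < h a - mu" using h_gt_mu[OF a(1,3)] by (auto simp: e_def)
  obtain S1 where S1: "T < S1" "\<And>t. S1 \<le> t \<Longrightarrow> Y t < e" using pflow_Y_small[OF e(1)] by blast
  obtain S2 where S2: "T < S2" "\<And>t. S2 \<le> t \<Longrightarrow> g < x t" using pflow_x_gt_g by blast
  define S where "S = max S1 S2"
  have S: "T < S" "\<And>t. S \<le> t \<Longrightarrow> Y t < e" "\<And>t. S \<le> t \<Longrightarrow> g < x t"
    using S1 S2 by (auto simp: S_def)
  have "a < x t" if t: "S \<le> t" for t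
  proof (rule ccontr)
    assume "\<not> a < x t"
    then have x: "x b \<le> a" if "t \<le> b" for b
      using S(2) e(2) by (intro pflow_x_barrier[OF S(1) a(1,3) _ t _ that]) (auto intro: less_trans)
    define b where "b = t + x t powr (p - 1) / e"
    have tb: "t \<le> b" using e(1) by (simp add: b_def)
    have "x b powr (p - 1) \<le> x t powr (p - 1) + (- e) * (b - t)"
    proof (rule DERIV_le_imp_growth[OF tb pflow_X_deriv])
      fix u assume u: "t \<le> u" "u \<le> b"
      have "h a \<le> h (x u)"
        using h_strict_antimono[of "x u" a] x[OF u(1)] S(3)[of u] u t g_gt by (cases "x u = a") auto
      then show "mu + Y u - h (x u) \<le> - e" using S(2)[of u] u t by (simp add: e_def field_simps)
    qed (use S(1) t in auto)
    also have "\<dots> = 0" using e(1) by (simp add: b_def)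
    finally show False using pflow_X_bounds(1)[of b] S(1) t tb by simp
  qed
  then show "eventually (\<lambda>t. a' < x t) at_top"
    using a(2) unfolding eventually_at_top_linorder by (meson le_less_trans)
qed

text \<open>\<open>c\<close> is half of \<open>- h' nu\<close>, so near \<open>nu\<close> the gap
  satisfies \<open>c * (nu - x) < h x - mu\<close>, and the right side equals \<open>Y - X'\<close>.
  Moreover \<open>Y <= - Y' / d\<close>, since \<open>x > (g + nu) / 2\<close> makes
  \<open>Y\<close> decay at rate \<open>d\<close>. The gap is thus dominated by an exact derivative:
  \<open>Psi\<close> is nonincreasing and bounds the nondecreasing \<open>Phi\<close>.\<close>

lemma pflow_integrable_gap:
  assumes Phi: "\<And>t. T < t \<Longrightarrow> (Phi has_real_derivative nu - x t) (at t)"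
  shows "\<exists>l. (Phi \<longlongrightarrow> l) at_top"
proof -
  define c where "c = - ((p - 1) * nu powr (p - 2) * (N - p - p * nu)) / 2"
  have "0 < c" unfolding c_def using p1 nu_pos p_nu_gt
    by (auto intro!: divide_pos_pos mult_pos_neg simp: zero_less_mult_iff)
  define d where "d = k * (nu - g) / 2"
  have "0 < d" using k_pos g_less_nu by (simp add: d_def)
  have quot: "((\<lambda>y. (h y - h nu) / (y - nu)) \<longlongrightarrow> - (2 * c)) (at nu)"
    using h_deriv[OF nu_pos] unfolding has_field_derivative_iff c_def by simp
  have "filterlim x (at nu) at_top"
    unfolding filterlim_at
    by (intro conjI pflow_x_limit eventually_mono[OF eventually_gt_at_top[of T]])
      (auto dest: pflow_x_less_nu)
  from filterlim_compose[OF quot this]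
  have "eventually (\<lambda>t. (h (x t) - h nu) / (x t - nu) < - c) at_top"
    using \<open>0 < c\<close> by (intro order_tendstoD) auto
  moreover have "eventually (\<lambda>t. (g + nu) / 2 < x t) at_top"
    using pflow_x_limit g_less_nu by (intro order_tendstoD) auto
  ultimately have "eventually (\<lambda>t. (h (x t) - h nu) / (x t - nu) < - c \<and> (g + nu) / 2 < x t \<and> T < t) at_top"
    by (intro eventually_conj eventually_gt_at_top)
  then obtain S where S: "\<And>t. S \<le> t \<Longrightarrow> (h (x t) - h nu) / (x t - nu) < - c \<and> (g + nu) / 2 < x t \<and> T < t"
    by (auto simp: eventually_at_top_linorder)
  then have "T < S" by blast
  define Psi where "Psi = (\<lambda>t. Phi t + x t powr (p - 1) / c + Y t / (c * d))"
  have Psi: "Psi t \<le> Psi S" if t: "S \<le> t" for t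
  proof -
    have "Psi t \<le> Psi S + 0 * (t - S)"
    proof (rule DERIV_le_imp_growth[OF t])
      fix u assume u: "S \<le> u" "u \<le> t"
      then have "T < u" using S by blast
      note D = pflowD[OF this] pflow_X_deriv[OF this] pflow_x_less_nu[OF this]
      show "(Psi has_real_derivative (nu - x u) + (mu + Y u - h (x u)) / c + k * Y u * (g - x u) / (c * d)) (at u)"
        unfolding Psi_def by (intro DERIV_add DERIV_cdivide Phi \<open>T < u\<close> D)
      have "c * (nu - x u) < h (x u) - mu"
        using S[OF u(1)] D(6) h_nu by (simp add: neg_divide_less_eq algebra_simps)
      moreover have "k * Y u * (g - x u) / d \<le> - Y u"
      proof -
        have "g - x u \<le> - ((nu - g) / 2)" using S[OF u(1)] by (simp add: field_simps)
        then have "k * (g - x u) \<le> k * (- ((nu - g) / 2))" using k_pos by (intro mult_left_mono) auto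
        then have "k * (g - x u) \<le> - d" by (simp add: d_def)
        then have "Y u * (k * (g - x u)) \<le> Y u * (- d)" using D(2) by (intro mult_left_mono) auto
        then show ?thesis using \<open>0 < d\<close> by (simp add: pos_divide_le_eq mult_ac)
      qed
      ultimately have "c * (nu - x u) + (mu + Y u - h (x u)) + k * Y u * (g - x u) / d \<le> 0" by linarith
      then have "(c * (nu - x u) + (mu + Y u - h (x u)) + k * Y u * (g - x u) / d) / c \<le> 0"
        using \<open>0 < c\<close> by (simp add: divide_le_0_iff)
      then show "(nu - x u) + (mu + Y u - h (x u)) / c + k * Y u * (g - x u) / (c * d) \<le> 0"
        using \<open>0 < c\<close> by (simp add: add_divide_distrib mult.commute)
    qed
    then show ?thesis by simp
  qed
  have mono: "Phi a \<le> Phi b" if "S < a" "a \<le> b" for a b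
  proof -
    have "Phi a + 0 * (b - a) \<le> Phi b"
      by (rule DERIV_ge_imp_growth[OF that(2) Phi])
        (use that \<open>T < S\<close> pflow_x_less_nu in \<open>auto simp: less_imp_le\<close>)
    then show ?thesis by simp
  qed
  have "Phi t \<le> Psi S" if t: "S < t" for t
  proof -
    have "0 \<le> x t powr (p - 1) / c + Y t / (c * d)"
      using pflowD(2)[of t] t \<open>T < S\<close> \<open>0 < c\<close> \<open>0 < d\<close> by simp
    then show ?thesis using Psi[of t] t by (simp add: Psi_def)
  qed
  with mono show ?thesis using bounded_mono_tendsto[of S Phi "Psi S"] by metis
qed

end

end

end

section \<open>Solutions of the radial equation\<close>

lemma filterlim_powr_at_top:
  assumes "0 < (a :: real)" shows "filterlim (\<lambda>r. r powr a) at_top at_top"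
proof -
  have "filterlim (\<lambda>r. exp (a * ln r)) at_top at_top"
    by (intro filterlim_compose[OF exp_at_top] filterlim_tendsto_pos_mult_at_top[OF tendsto_const]
        ln_at_top assms)
  moreover have "eventually (\<lambda>r. exp (a * ln r) = r powr a) at_top"
    using eventually_gt_at_top[of 0] by eventually_elim (simp add: powr_def)
  ultimately show ?thesis by (simp cong: filterlim_cong)
qed

lemma is_solutionI:
  assumes pos: "\<And>r. R0 < r \<Longrightarrow> 0 < v r"
    and v: "\<And>r. R0 < r \<Longrightarrow> (v has_real_derivative v' r) (at r)" and cont: "continuous_on {R0<..} v'"
    and fl: "\<And>r. R0 < r \<Longrightarrow> ((\<lambda>r. r powr (N - 1) * \<bar>v' r\<bar> powr (p - 2) * v' r) has_real_derivative
       - (mu * r powr (N - 1 - p) * v r powr (p - 1) + r powr (N - 1 + s) * v r powr q)) (at r)"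
    and "0 \<le> R0"
  shows "is_solution N p s mu q R0 v"
proof -
  define f where "f = (\<lambda>r. - (mu * r powr (N - 1 - p) * v r powr (p - 1) + r powr (N - 1 + s) * v r powr q))"
  have dv: "deriv v r = v' r" if "R0 < r" for r using v[OF that] by (rule DERIV_imp_deriv)
  have fl': "(flux N p v has_real_derivative f r) (at r)" if "R0 < r" for r
    unfolding f_def
    by (rule has_field_derivative_transform_within_open[OF fl[OF that] open_greaterThan[of R0]])
      (use that dv in \<open>auto simp: flux_def\<close>)
  have dfl: "deriv (flux N p v) r = f r" if "R0 < r" for r using fl'[OF that] by (rule DERIV_imp_deriv)
  have "continuous_on {R0<..} v"
    using v by (intro continuous_at_imp_continuous_on) (auto intro: DERIV_isCont)
  then have "continuous_on {R0<..} f"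
    unfolding f_def by (intro continuous_intros) (use \<open>0 \<le> R0\<close> pos in force)+
  then have "continuous_on {R0<..} (deriv (flux N p v))" using dfl by (auto intro: continuous_on_eq)
  moreover have "continuous_on {R0<..} (deriv v)" using cont dv by (auto intro: continuous_on_eq)
  ultimately show ?thesis
    using pos v fl' dfl unfolding is_solution_def field_differentiable_def
    by (auto simp: f_def)
qed

lemma is_solutionD:
  assumes "is_solution N p s mu q R0 v" "R0 < r"
  shows "0 < v r" "(v has_real_derivative deriv v r) (at r)"
    "(flux N p v has_real_derivative
       - (mu * r powr (N - 1 - p) * v r powr (p - 1) + r powr (N - 1 + s) * v r powr q)) (at r)"
proof -
  from assms have eq: "- deriv (flux N p v) r
        = mu * r powr (N - 1 - p) * v r powr (p - 1) + r powr (N - 1 + s) * v r powr q"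
    and d: "flux N p v field_differentiable at r" "v field_differentiable at r"
    and "0 < v r"
    by (auto simp: is_solution_def)
  then show "0 < v r" "(v has_real_derivative deriv v r) (at r)"
    using field_differentiable_derivI by blast+
  show "(flux N p v has_real_derivative
       - (mu * r powr (N - 1 - p) * v r powr (p - 1) + r powr (N - 1 + s) * v r powr q)) (at r)"
    using field_differentiable_derivI[OF d(1)] eq by (metis minus_minus)
qed

lemma flux_neg_iff: "0 < r \<Longrightarrow> flux N p v r < 0 \<longleftrightarrow> deriv v r < 0"
  by (auto simp: flux_def mult_less_0_iff zero_less_mult_iff)

lemma is_solution_continuous:
  assumes "is_solution N p s mu q R0 v"
  shows "continuous_on {R0<..} v" "continuous_on {R0<..} (deriv v)"
  using assms is_solutionD(2)[OF assms]
  by (auto simp: is_solution_def intro!: continuous_at_imp_continuous_on DERIV_isCont)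

section \<open>Passage between solutions and orbits\<close>

context radial
begin

context
  fixes R0 v assumes R0: "0 < R0" and sol: "is_solution N p s mu q R0 v"
begin

lemma flux_decreasing: "R0 < a \<Longrightarrow> a < b \<Longrightarrow> flux N p v b < flux N p v a"
proof -
  assume ab: "R0 < a" "a < b"
  show ?thesis
  proof (rule DERIV_neg_imp_decreasing[OF ab(2)])
    fix r assume "a \<le> r" "r \<le> b"
    then have r: "R0 < r" "0 < r" using ab R0 by auto
    have "0 < mu * r powr (N - 1 - p) * v r powr (p - 1)"
      using is_solutionD(1)[OF sol r(1)] r(2) mu_pos by (intro mult_pos_pos) auto
    moreover have "0 \<le> r powr (N - 1 + s) * v r powr q" by simp
    ultimately have "- (mu * r powr (N - 1 - p) * v r powr (p - 1) + r powr (N - 1 + s) * v r powr q) < 0"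
      by linarith
    then show "\<exists>y. (flux N p v has_real_derivative y) (at r) \<and> y < 0"
      using is_solutionD(3)[OF sol r(1)] by blast
  qed
qed

lemma deriv_neg_persists:
  assumes "R0 < a" "deriv v a < 0" "a \<le> b" shows "deriv v b < 0"
  using flux_decreasing[of a b] flux_neg_iff[of a N p v] flux_neg_iff[of b N p v] assms R0
  by (cases "a = b") auto

text \<open>Otherwise \<open>v' >= 0\<close> throughout, by persistence of the negative sign, so
  \<open>v\<close> is bounded below by \<open>v a\<close>. The equation then makes the flux decrease
  at least like \<open>- c * r powr (N - p) / (N - p)\<close>, which is unbounded as
  \<open>N > p\<close>, although the flux is nonnegative.\<close>

lemma deriv_neg_eventually: "\<exists>R1\<ge>R0. \<forall>r>R1. deriv v r < 0"
proof (rule ccontr)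
  assume "\<not> ?thesis"
  then have "\<not> (\<forall>r>R0. deriv v r < 0)" and neg: "\<And>R1. R0 \<le> R1 \<Longrightarrow> \<exists>r>R1. \<not> deriv v r < 0" by auto
  have nonneg: "0 \<le> deriv v r" if "R0 < r" for r
    using neg[of r] deriv_neg_persists[of r] that by (meson less_imp_le not_less)
  define a where "a = R0 + 1"
  have a: "R0 < a" "0 < a" using R0 by (auto simp: a_def)
  define c where "c = mu * v a powr (p - 1)"
  have "0 < c" using mu_pos is_solutionD(1)[OF sol a(1)] by (simp add: c_def)
  have va: "v a \<le> v r" if "a \<le> r" for r
    using DERIV_ge_imp_growth[of a r v "deriv v" 0] that a nonneg is_solutionD(2)[OF sol] by auto
  define P where "P = (\<lambda>r. flux N p v r + c * r powr (N - p) / (N - p))"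
  have P: "P r \<le> P a" if r: "a \<le> r" for r
  proof -
    have "P r \<le> P a + 0 * (r - a)"
    proof (rule DERIV_le_imp_growth[OF r])
      fix u assume u: "a \<le> u" "u \<le> r"
      then have u0: "R0 < u" "0 < u" using a by auto
      have "(P has_real_derivative
        - (mu * u powr (N - 1 - p) * v u powr (p - 1) + u powr (N - 1 + s) * v u powr q)
        + c * ((N - p) * u powr (N - p - 1)) / (N - p)) (at u)"
        unfolding P_def
        by (intro DERIV_add is_solutionD(3)[OF sol u0(1)] DERIV_cdivide DERIV_cmult has_real_derivative_powr u0(2))
      then show "(P has_real_derivative
        - (mu * u powr (N - 1 - p) * v u powr (p - 1) + u powr (N - 1 + s) * v u powr q)
        + c * u powr (N - 1 - p)) (at u)"
      proof -
        have e: "N - p - 1 = N - 1 - p" by simp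
        have "c * ((N - p) * u powr (N - p - 1)) / (N - p) = c * u powr (N - 1 - p)" unfolding e using pN by simp
        then show ?thesis using \<open>(P has_real_derivative _) (at u)\<close> by simp
      qed
      have "v a powr (p - 1) \<le> v u powr (p - 1)"
        using va[OF u(1)] is_solutionD(1)[OF sol a(1)] p1 by (intro powr_mono2) auto
      then have "c * u powr (N - 1 - p) \<le> mu * u powr (N - 1 - p) * v u powr (p - 1)"
        using mult_left_mono[of "v a powr (p - 1)" "v u powr (p - 1)" "mu * u powr (N - 1 - p)"] mu_pos
        by (simp add: c_def mult_ac)
      moreover have "0 \<le> u powr (N - 1 + s) * v u powr q" by simp
      ultimately show "- (mu * u powr (N - 1 - p) * v u powr (p - 1) + u powr (N - 1 + s) * v u powr q)
        + c * u powr (N - 1 - p) \<le> 0" by linarith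
    qed
    then show ?thesis by simp
  qed
  have "filterlim (\<lambda>r. c / (N - p) * r powr (N - p)) at_top at_top"
    using \<open>0 < c\<close> pN by (intro filterlim_tendsto_pos_mult_at_top[OF tendsto_const] filterlim_powr_at_top) auto
  then have "eventually (\<lambda>r. P a < c / (N - p) * r powr (N - p) \<and> a < r) at_top"
    by (intro eventually_conj eventually_gt_at_top) (simp add: filterlim_at_top_dense)
  then obtain r where "P a < c / (N - p) * r powr (N - p)" "a < r"
    using eventually_happens trivial_limit_at_top_linorder by blast
  moreover have "0 \<le> flux N p v r" using nonneg[of r] a \<open>a < r\<close> by (simp add: flux_def)
  ultimately show False using P[of r] by (simp add: P_def)
qed

text \<open>\<open>v'\<close> is not given as differentiable, only the flux is. So
  \<open>x powr (p - 1)\<close> is first written through the flux as \<open>X\<close>,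
  differentiated with the help of the equation, and \<open>x\<close> is recovered as a power of the
  positive function \<open>X\<close>.\<close>

lemma sol_pflow:
  assumes T: "ln R0 \<le> T" and neg: "\<And>r. exp T < r \<Longrightarrow> deriv v r < 0"
  shows "pflow T (\<lambda>t. fst (orbit_of p s q v t)) (\<lambda>t. snd (orbit_of p s q v t))"
  unfolding pflow_def
proof (intro allI impI)
  fix t assume t: "T < t"
  define x where "x = (\<lambda>t. fst (orbit_of p s q v t))"
  define Y where "Y = (\<lambda>t. snd (orbit_of p s q v t))"
  define w where "w = (\<lambda>t. v (exp t))"
  define w' where "w' = (\<lambda>t. deriv v (exp t))"
  define X where "X = (\<lambda>t. exp ((p - N) * t) * (- flux N p v (exp t)) * w t powr (1 - p))"
  have R: "R0 < exp u" if "T < u" for u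
    using that T R0 by (metis exp_less_cancel_iff exp_ln le_less_trans)
  note S = is_solutionD[OF sol R]
  have w0: "0 < w u" "w' u < 0" if "T < u" for u
    using S(1)[OF that] neg[of "exp u"] that by (auto simp: w_def w'_def)
  have x: "x u = - (exp u * w' u / w u)" and Y: "Y u = exp ((p + s) * u) * w u powr k" for u
    by (auto simp: x_def Y_def orbit_of_def w_def w'_def powr_def)
  have x0: "0 < x u" if "T < u" for u
    using w0[OF that] by (simp add: x divide_less_0_iff mult_less_0_iff)
  have X: "X u = x u powr (p - 1)" if "T < u" for u
  proof -
    have "- flux N p v (exp u) = exp ((N - 1) * u) * (- w' u) powr (p - 1)"
    proof -
      have "(- w' u) powr (p - 1) = (- w' u) powr (p - 2) * (- w' u)"
        using w0(2)[OF that] powr_add[of "- w' u" "p - 2" 1] by simp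
      moreover have "\<bar>deriv v (exp u)\<bar> = - w' u" "deriv v (exp u) = w' u"
        using w0(2)[OF that] by (auto simp: w'_def)
      moreover have "exp u powr (N - 1) = exp ((N - 1) * u)" by (simp add: powr_def)
      ultimately show ?thesis by (simp add: flux_def)
    qed
    moreover have "x u powr (p - 1) = exp ((p - 1) * u) * (- w' u) powr (p - 1) * w u powr (1 - p)"
    proof -
      have "x u = exp u * (- w' u) / w u" by (simp add: x)
      moreover have "exp u powr (p - 1) = exp ((p - 1) * u)" by (simp add: powr_def)
      moreover have "(exp u * (- w' u) / w u) powr (p - 1)
        = exp u powr (p - 1) * (- w' u) powr (p - 1) / w u powr (p - 1)"
        by (simp only: powr_divide powr_mult)
      ultimately show ?thesis
        using powr_minus_divide[of "w u" "p - 1"] by simp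
    qed
    moreover have "exp ((p - 1) * u) = exp ((p - N) * u) * exp ((N - 1) * u)"
      by (simp add: algebra_simps flip: exp_add)
    ultimately show ?thesis unfolding X_def by (simp only: mult.assoc)
  qed
  have wd: "(w has_real_derivative - (x t * w t)) (at t)"
    unfolding w_def using DERIV_chain'[OF DERIV_exp S(2)[OF t]] w0(1)[OF t]
    by (simp add: x w_def w'_def mult.commute)
  define f where "f = mu * exp t powr (N - 1 - p) * w t powr (p - 1) + exp t powr (N - 1 + s) * w t powr q"
  have fd: "((\<lambda>t. flux N p v (exp t)) has_real_derivative - f * exp t) (at t)"
    using DERIV_chain'[OF DERIV_exp S(3)[OF t]] by (simp add: f_def w_def mult.commute)
  have f: "exp ((p - N) * t) * (f * exp t) * w t powr (1 - p) = mu + Y t"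
  proof -
    have "w t powr (p - 1) * w t powr (1 - p) = 1" "w t powr q * w t powr (1 - p) = w t powr k"
      using w0(1)[OF t] by (auto simp add: algebra_simps simp flip: powr_add)
    moreover have "exp ((p - N) * t) * (exp t powr (N - 1 - p) * exp t) = 1"
      "exp ((p - N) * t) * (exp t powr (N - 1 + s) * exp t) = exp ((p + s) * t)"
      by (auto simp: powr_def algebra_simps simp flip: exp_add)
    moreover have "exp ((p - N) * t) * (f * exp t) * w t powr (1 - p)
      = mu * (exp ((p - N) * t) * (exp t powr (N - 1 - p) * exp t)) * (w t powr (p - 1) * w t powr (1 - p))
      + (exp ((p - N) * t) * (exp t powr (N - 1 + s) * exp t)) * (w t powr q * w t powr (1 - p))"
      unfolding f_def by (simp add: algebra_simps)
    ultimately show ?thesis by (simp add: Y)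
  qed
  have d1: "(X has_real_derivative
      ((exp ((p - N) * t) * (p - N)) * (- flux N p v (exp t)) + (- (- f * exp t)) * exp ((p - N) * t)) * w t powr (1 - p)
      + ((1 - p) * w t powr (1 - p - of_nat 1) * (- (x t * w t))) * (exp ((p - N) * t) * (- flux N p v (exp t)))) (at t)"
    unfolding X_def
    by (intro DERIV_mult DERIV_minus fd DERIV_fun_powr wd w0(1) t) (auto intro!: derivative_eq_intros)
  have e1: "((exp ((p - N) * t) * (p - N)) * (- flux N p v (exp t)) + (- (- f * exp t)) * exp ((p - N) * t)) * w t powr (1 - p)
      + ((1 - p) * w t powr (1 - p - of_nat 1) * (- (x t * w t))) * (exp ((p - N) * t) * (- flux N p v (exp t)))
    = (p - N) * X t + exp ((p - N) * t) * (f * exp t) * w t powr (1 - p) + (p - 1) * x t * X t"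
  proof -
    define a where "a = w t powr (1 - p - of_nat 1)"
    have "a * w t = w t powr (1 - p)"
      using w0(1)[OF t] powr_add[of "w t" "1 - p - 1" 1] by (simp add: a_def)
    moreover have "(1 - p) * a * (- (x t * w t)) = (p - 1) * x t * (a * w t)" by (simp add: algebra_simps)
    ultimately have e: "(1 - p) * a * (- (x t * w t)) = (p - 1) * x t * w t powr (1 - p)" by simp
    show ?thesis unfolding X_def a_def[symmetric] e by (simp add: algebra_simps)
  qed
  have Xd: "(X has_real_derivative mu + Y t - h (x t)) (at t)"
    by (rule DERIV_cong[OF DERIV_cong[OF d1 e1]]) (unfold f X[OF t] h_fun_def, simp add: algebra_simps)
  have "((\<lambda>t. X t powr (1 / (p - 1))) has_real_derivative
      1 / (p - 1) * X t powr (1 / (p - 1) - of_nat 1) * (mu + Y t - h (x t))) (at t)"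
    by (rule DERIV_fun_powr[OF Xd]) (use X[OF t] x0[OF t] in auto)
  moreover have "1 / (p - 1) * X t powr (1 / (p - 1) - of_nat 1) * (mu + Y t - h (x t)) = fX (x t) (Y t)"
  proof -
    have "(p - 1) * (1 / (p - 1) - 1) = 2 - p" using p1 by (simp add: field_simps)
    then have "X t powr (1 / (p - 1) - 1) = x t powr (2 - p)" by (simp add: X[OF t] powr_powr)
    then show ?thesis by (simp add: fX_eq[OF x0[OF t]])
  qed
  ultimately have xd: "((\<lambda>t. X t powr (1 / (p - 1))) has_real_derivative fX (x t) (Y t)) (at t)" by simp
  have "(x has_real_derivative fX (x t) (Y t)) (at t)"
    by (rule has_field_derivative_transform_within_open[OF xd open_greaterThan[of T]])
      (use t x0 X p1 in \<open>auto simp: powr_powr less_imp_le\<close>)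
  moreover have "(Y has_real_derivative k * Y t * (g - x t)) (at t)"
  proof -
    define a where "a = w t powr (k - of_nat 1)"
    have d: "((\<lambda>u. exp ((p + s) * u) * w u powr k) has_real_derivative
      (exp ((p + s) * t) * (p + s)) * w t powr k + (k * a * (- (x t * w t))) * exp ((p + s) * t)) (at t)"
      unfolding a_def
      by (intro DERIV_mult DERIV_fun_powr wd w0(1) t) (auto intro!: derivative_eq_intros)
    have "a * w t = w t powr k"
      using w0(1)[OF t] powr_add[of "w t" "k - 1" 1] by (simp add: a_def)
    moreover have "(k * a * (- (x t * w t))) * exp ((p + s) * t) = - (k * x t * (exp ((p + s) * t) * (a * w t)))"
      by simp
    ultimately have "(exp ((p + s) * t) * (p + s)) * w t powr k + (k * a * (- (x t * w t))) * exp ((p + s) * t)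
      = (p + s) * Y t - k * x t * Y t" by (simp add: Y)
    also have "\<dots> = k * Y t * (g - x t)" unfolding k_g[symmetric] by (simp only: algebra_simps)
    finally have "((\<lambda>u. exp ((p + s) * u) * w u powr k) has_real_derivative k * Y t * (g - x t)) (at t)"
      using d by (simp only:)
    moreover have "(\<lambda>u. exp ((p + s) * u) * w u powr k) = Y" by (rule ext) (simp add: Y)
    ultimately show ?thesis by (simp only:)
  qed
  moreover have "0 < Y t" using w0(1)[OF t] by (simp add: Y)
  ultimately show "0 < fst (orbit_of p s q v t) \<and> 0 < snd (orbit_of p s q v t) \<and>
     ((\<lambda>t. fst (orbit_of p s q v t)) has_real_derivative fX (fst (orbit_of p s q v t)) (snd (orbit_of p s q v t))) (at t) \<and>
     ((\<lambda>t. snd (orbit_of p s q v t)) has_real_derivative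
        k * snd (orbit_of p s q v t) * (g - fst (orbit_of p s q v t))) (at t)"
    using x0[OF t] by (simp add: x_def Y_def)
qed

end

text \<open>The formula for \<open>v\<close> inverts \<open>Y = r powr (p + s) * v powr k\<close>,
  because \<open>k * g = p + s\<close>.\<close>

lemma pflow_sol:
  assumes pf: "pflow T x Y"
  defines "v \<equiv> \<lambda>r. Y (ln r) powr (1 / k) * r powr (- g)"
  shows "is_solution N p s mu q (exp T) v"
    and "\<And>t. T < t \<Longrightarrow> deriv v (exp t) < 0"
    and "\<And>t. T < t \<Longrightarrow> orbit_of p s q v t = (x t, Y t)"
proof -
  define v' where "v' = (\<lambda>r. - (x (ln r) * v r / r))"
  note D = pflowD[OF pf]
  have ln: "0 < r" "T < ln r" if "exp T < r" for r
  proof -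
    show "0 < r" using that exp_gt_zero[of T] by linarith
    then show "T < ln r" using that by (metis exp_less_cancel_iff exp_ln)
  qed
  have v0: "0 < v r" if "exp T < r" for r
    using D(2)[OF ln(2)[OF that]] ln(1)[OF that] by (simp add: v_def)
  have dln: "((\<lambda>r. f (ln r)) has_real_derivative f' / r) (at r)"
    if "(f has_real_derivative f') (at (ln r))" "exp T < r" for f :: "real \<Rightarrow> real" and f' r
    using DERIV_chain'[OF DERIV_ln[OF ln(1)[OF that(2)]] that(1)] by (simp add: divide_inverse)
  have vd: "(v has_real_derivative v' r) (at r)" if r: "exp T < r" for r
  proof -
    note l = ln[OF r]
    define a where "a = Y (ln r) powr (1 / k - of_nat 1)"
    have d: "(v has_real_derivative
      (1 / k * a * (k * Y (ln r) * (g - x (ln r)) / r)) * r powr (- g)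
      + (- g * r powr (- g - 1)) * Y (ln r) powr (1 / k)) (at r)"
      unfolding v_def a_def
      by (intro DERIV_mult DERIV_fun_powr dln D l r has_real_derivative_powr)
    have "a * Y (ln r) = Y (ln r) powr (1 / k)"
      using D(2)[OF l(2)] powr_add[of "Y (ln r)" "1 / k - 1" 1] by (simp add: a_def)
    moreover have "1 / k * a * (k * Y (ln r) * (g - x (ln r)) / r) = (a * Y (ln r)) * (g - x (ln r)) / r"
      using k_pos by simp
    ultimately have e: "1 / k * a * (k * Y (ln r) * (g - x (ln r)) / r) = Y (ln r) powr (1 / k) * (g - x (ln r)) / r"
      by simp
    have e2: "r powr (- g - 1) = r powr (- g) / r" using l(1) by (simp add: powr_diff)
    show ?thesis
      by (rule DERIV_cong[OF d])
        (unfold e e2 v'_def v_def, simp add: diff_divide_distrib algebra_simps)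
  qed
  have v'0: "v' r < 0" if "exp T < r" for r
    using v0[OF that] ln[OF that] D(1)[OF ln(2)[OF that]] by (simp add: v'_def)
  have dv: "deriv v r = v' r" if "exp T < r" for r using vd[OF that] by (rule DERIV_imp_deriv)
  have Yv: "r powr (p + s) * v r powr k = Y (ln r)" if r: "exp T < r" for r
  proof -
    have "v r powr k = Y (ln r) * r powr (- (g * k))"
      using D(2)[OF ln(2)[OF r]] ln(1)[OF r] k_pos by (simp add: v_def powr_mult powr_powr)
    moreover have "p + s + - (g * k) = 0" using k_g by (simp add: mult.commute)
    then have "r powr (p + s) * r powr (- (g * k)) = 1"
      using ln(1)[OF r] by (simp only: powr_add[symmetric]) simp
    ultimately show ?thesis by (metis mult.left_commute mult.right_neutral)
  qed
  have lnT: "exp T < exp t" if "T < t" for t using that by simp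
  show neg: "deriv v (exp t) < 0" if "T < t" for t
    using v'0[OF lnT[OF that]] dv[OF lnT[OF that]] by simp
  show "orbit_of p s q v t = (x t, Y t)" if "T < t" for t
    using dv[OF lnT[OF that]] Yv[OF lnT[OF that]] v0[OF lnT[OF that]]
    by (simp add: orbit_of_def v'_def)
  show "is_solution N p s mu q (exp T) v"
  proof (rule is_solutionI[where v' = v', OF v0 vd])
    show "continuous_on {exp T<..} v'"
    proof (rule continuous_at_imp_continuous_on, rule ballI)
      fix r assume "r \<in> {exp T<..}"
      then have r: "exp T < r" by simp
      have "((\<lambda>r. x (ln r)) has_real_derivative fX (x (ln r)) (Y (ln r)) / r) (at r)"
        by (rule dln[OF D(3)[OF ln(2)[OF r]] r])
      then have "isCont (\<lambda>r. x (ln r)) r" by (rule DERIV_isCont)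
      then show "isCont v' r" unfolding v'_def
        using DERIV_isCont[OF vd[OF r]] ln(1)[OF r] by (intro continuous_intros) auto
    qed
    fix r assume r: "exp T < r"
    note l = ln[OF r]
    define X where "X = (\<lambda>t. x t powr (p - 1))"
    \<comment> \<open>The flux of \<open>v\<close> written through \<open>X\<close>, whose
      derivative is known; the power of \<open>v'\<close> itself never has to be
      differentiated.\<close>
    define G where "G = (\<lambda>r. - (r powr (N - p) * (X (ln r) * v r powr (p - 1))))"
    have eq: "G u = u powr (N - 1) * \<bar>v' u\<bar> powr (p - 2) * v' u" if u: "exp T < u" for u
    proof -
      have "\<bar>v' u\<bar> = x (ln u) * v u / u" using v'0[OF u] unfolding v'_def by linarith
      then have "\<bar>v' u\<bar> powr (p - 1) = X (ln u) * v u powr (p - 1) / u powr (p - 1)"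
        by (simp add: powr_divide powr_mult X_def)
      moreover have "\<bar>v' u\<bar> powr (p - 2) * v' u = - (\<bar>v' u\<bar> powr (p - 1))"
        using v'0[OF u] powr_add[of "\<bar>v' u\<bar>" "p - 2" 1] by simp
      ultimately have "u powr (N - 1) * \<bar>v' u\<bar> powr (p - 2) * v' u
        = - (u powr (N - 1) / u powr (p - 1) * (X (ln u) * v u powr (p - 1)))" by (simp add: mult.assoc)
      also have "u powr (N - 1) / u powr (p - 1) = u powr (N - p)"
        using powr_diff[of u "N - 1" "p - 1"] by simp
      finally show ?thesis by (simp add: G_def)
    qed
    have Xd: "(X has_real_derivative mu + Y (ln r) - h (x (ln r))) (at (ln r))"
      unfolding X_def by (rule pflow_X_deriv[OF pf l(2)])
    have dG: "(G has_real_derivative - (((N - p) * r powr (N - p - 1)) * (X (ln r) * v r powr (p - 1))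
       + (((mu + Y (ln r) - h (x (ln r))) / r) * v r powr (p - 1)
          + ((p - 1) * v r powr (p - 1 - of_nat 1) * v' r) * X (ln r)) * r powr (N - p))) (at r)"
      unfolding G_def
      by (intro DERIV_minus DERIV_mult has_real_derivative_powr l(1) DERIV_fun_powr vd v0 r dln Xd)
    have eG: "((N - p) * r powr (N - p - 1)) * (X (ln r) * v r powr (p - 1))
       + (((mu + Y (ln r) - h (x (ln r))) / r) * v r powr (p - 1)
          + ((p - 1) * v r powr (p - 1 - of_nat 1) * v' r) * X (ln r)) * r powr (N - p)
      = mu * r powr (N - 1 - p) * v r powr (p - 1) + r powr (N - 1 + s) * v r powr q" (is "?L = ?R")
    proof -
      define W where "W = v r powr (p - 1)"
      define R where "R = r powr (N - 1 - p)"
      have R: "r powr (N - p - 1) = R" "r powr (N - p) = R * r"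
        using l(1) powr_add[of r "N - 1 - p" 1] by (auto simp: R_def algebra_simps)
      have "v r powr (p - 1 - of_nat 1) * v r = W"
        using v0[OF r] powr_add[of "v r" "p - 1 - 1" 1] by (simp add: W_def)
      then have W: "v r powr (p - 1 - of_nat 1) * v' r = - (W * x (ln r) / r)"
        by (simp add: v'_def mult.assoc mult.commute[of "x (ln r)"])
      have h: "h (x (ln r)) = X (ln r) * (N - p - (p - 1) * x (ln r))"
        by (simp add: h_fun_def X_def)
      have "r powr (N - 1 + s) * v r powr q = R * W * (r powr (p + s) * v r powr k)"
      proof -
        have "v r powr q = W * v r powr k" using v0[OF r] by (simp add: W_def flip: powr_add)
        moreover have e: "N - 1 + s = (N - 1 - p) + (p + s)" by simp
        have "r powr (N - 1 + s) = R * r powr (p + s)" unfolding e powr_add R_def by (rule refl)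
        ultimately show ?thesis by simp
      qed
      then have e: "r powr (N - 1 + s) * v r powr q = R * W * Y (ln r)" unfolding Yv[OF r] .
      have RR: "?R = R * W * (mu + Y (ln r))"
        unfolding e R_def[symmetric] W_def[symmetric] by (simp add: algebra_simps)
      have "?L = (N - p) * R * (X (ln r) * W)
         + ((mu + Y (ln r) - h (x (ln r))) / r * W + (p - 1) * (- (W * x (ln r) / r)) * X (ln r)) * (R * r)"
        unfolding R W_def[symmetric] mult.assoc[of "p - 1"] W by simp
      also have "\<dots> = R * W * (mu + Y (ln r))"
        unfolding h using l(1) by (simp add: field_simps)
      finally show ?thesis using RR by simp
    qed
    have "(G has_real_derivative - ?R) (at r)" using dG unfolding eG .
    then show "((\<lambda>r. r powr (N - 1) * \<bar>v' r\<bar> powr (p - 2) * v' r) has_real_derivative - ?R) (at r)"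
      by (rule has_field_derivative_transform_within_open[OF _ open_greaterThan[of "exp T"]])
        (use r eq in auto)
  qed simp_all
qed

context
  fixes R0 v assumes R0: "0 < R0" and sol: "is_solution N p s mu q R0 v"
begin

lemma sol_pflow_eventually:
  obtains T where "ln R0 \<le> T" "\<And>r. exp T < r \<Longrightarrow> deriv v r < 0"
    "pflow T (\<lambda>t. fst (orbit_of p s q v t)) (\<lambda>t. snd (orbit_of p s q v t))"
proof -
  obtain R1 where R1: "R0 \<le> R1" "\<And>r. R1 < r \<Longrightarrow> deriv v r < 0"
    using deriv_neg_eventually[OF R0 sol] by blast
  have "ln R0 \<le> ln R1" "exp (ln R1) = R1" using R0 R1(1) by auto
  then show thesis using R1(2) that[of "ln R1"] sol_pflow[OF R0 sol] by metis
qed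

text \<open>\<open>Phi\<close> is the logarithm of \<open>r powr nu * v r\<close> in the variable
  \<open>t\<close>, with derivative \<open>nu - x\<close>. Its finite limit, given by integrability
  of the gap, yields a constant \<open>C = exp l\<close> that is automatically positive.\<close>

lemma type_III_of_decay:
  assumes "((\<lambda>t. snd (orbit_of p s q v t)) \<longlongrightarrow> 0) at_top"
  shows "type_III N p mu v"
proof -
  obtain T where T: "ln R0 \<le> T" "\<And>r. exp T < r \<Longrightarrow> deriv v r < 0"
    and pf: "pflow T (\<lambda>t. fst (orbit_of p s q v t)) (\<lambda>t. snd (orbit_of p s q v t))"
    using sol_pflow_eventually by blast
  have xlim: "((\<lambda>t. fst (orbit_of p s q v t)) \<longlongrightarrow> nu) at_top"
    by (rule pflow_x_limit[OF pf assms])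
  have R: "R0 < exp u" if "T < u" for u
    using that T R0 by (metis exp_less_cancel_iff exp_ln le_less_trans)
  define Phi where "Phi = (\<lambda>t. nu * t + ln (v (exp t)))"
  have "(Phi has_real_derivative nu - fst (orbit_of p s q v t)) (at t)" if t: "T < t" for t
  proof -
    have "((\<lambda>t. v (exp t)) has_real_derivative deriv v (exp t) * exp t) (at t)"
      using DERIV_chain'[OF DERIV_exp is_solutionD(2)[OF sol R[OF t]]] by (simp add: mult.commute)
    then have "(Phi has_real_derivative nu + deriv v (exp t) * exp t / v (exp t)) (at t)"
      unfolding Phi_def using is_solutionD(1)[OF sol R[OF t]] by (auto intro!: derivative_eq_intros)
    then show ?thesis by (simp add: orbit_of_def mult.commute)
  qed
  then obtain l where l: "(Phi \<longlongrightarrow> l) at_top"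
    using pflow_integrable_gap[OF pf assms, of Phi] by blast
  have "((\<lambda>r. exp (Phi (ln r))) \<longlongrightarrow> exp l) at_top"
    by (intro tendsto_exp filterlim_compose[OF l] ln_at_top)
  moreover have "eventually (\<lambda>r. exp (Phi (ln r)) = r powr nu * v r) at_top"
    using eventually_gt_at_top[of R0]
  proof eventually_elim
    case (elim r)
    then show ?case using R0 is_solutionD(1)[OF sol elim] by (simp add: Phi_def exp_add powr_def)
  qed
  ultimately have "((\<lambda>r. r powr nu * v r) \<longlongrightarrow> exp l) at_top"
    by (rule Lim_transform_eventually)
  moreover have "((\<lambda>r. r * deriv v r / v r) \<longlongrightarrow> - nu) at_top"
  proof (rule Lim_transform_eventually)
    show "((\<lambda>r. - fst (orbit_of p s q v (ln r))) \<longlongrightarrow> - nu) at_top"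
      by (intro tendsto_minus filterlim_compose[OF xlim] ln_at_top)
    show "eventually (\<lambda>r. - fst (orbit_of p s q v (ln r)) = r * deriv v r / v r) at_top"
      using eventually_gt_at_top[of 0] by eventually_elim (simp add: orbit_of_def)
  qed
  ultimately show ?thesis unfolding type_III_def by (metis exp_gt_zero)
qed

text \<open>\<open>Y\<close> is a power of \<open>r powr nu * v r\<close> times
  \<open>r powr (p + s - nu * k)\<close>, and this exponent equals
  \<open>k * (g - nu) < 0\<close>.\<close>

lemma decay_of_type_III:
  assumes "type_III N p mu v"
  shows "((\<lambda>t. orbit_of p s q v t) \<longlongrightarrow> P_plus N p mu) at_top"
proof -
  from assms obtain C where C: "0 < C" "((\<lambda>r. r powr nu * v r) \<longlongrightarrow> C) at_top"
    and x: "((\<lambda>r. r * deriv v r / v r) \<longlongrightarrow> - nu) at_top"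
    unfolding type_III_def by blast
  have "((\<lambda>t. - (exp t * deriv v (exp t) / v (exp t))) \<longlongrightarrow> - (- nu)) at_top"
    by (intro tendsto_minus filterlim_compose[OF x] exp_at_top)
  moreover have "((\<lambda>t. exp t powr (p + s) * v (exp t) powr k) \<longlongrightarrow> 0) at_top"
  proof -
    have "p + s - nu * k < 0" using k_g g_less_nu k_pos by (simp add: k_g[symmetric] mult.commute)
    then have "((\<lambda>r :: real. r powr (p + s - nu * k)) \<longlongrightarrow> 0) at_top"
      by (intro tendsto_neg_powr filterlim_ident) auto
    moreover have "((\<lambda>r. (r powr nu * v r) powr k) \<longlongrightarrow> C powr k) at_top"
      using C by (intro tendsto_powr tendsto_const) auto
    ultimately have "((\<lambda>r. r powr (p + s - nu * k) * (r powr nu * v r) powr k) \<longlongrightarrow> 0) at_top"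
      using tendsto_mult by fastforce
    moreover have "eventually (\<lambda>r. r powr (p + s - nu * k) * (r powr nu * v r) powr k
        = r powr (p + s) * v r powr k) at_top"
      using eventually_gt_at_top[of R0]
    proof eventually_elim
      case (elim r)
      have "(r powr nu * v r) powr k = r powr (nu * k) * v r powr k"
        using R0 elim is_solutionD(1)[OF sol elim] by (simp add: powr_mult powr_powr)
      then show ?case using R0 elim by (simp add: powr_add[symmetric] mult.assoc[symmetric])
    qed
    ultimately have "((\<lambda>r. r powr (p + s) * v r powr k) \<longlongrightarrow> 0) at_top"
      by (rule Lim_transform_eventually)
    then show ?thesis by (rule filterlim_compose[OF _ exp_at_top])
  qed
  ultimately show ?thesis unfolding orbit_of_def P_plus_def by (intro tendsto_Pair) simp_all
qed

lemma type_I_of_equilibrium: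
  assumes eq: "\<And>t. ln R0 < t \<Longrightarrow> orbit_of p s q v t = (g, m)"
  shows "type_I N p s mu q R0 v"
  unfolding type_I_def
proof (intro allI impI)
  fix r assume r: "R0 < r"
  have v: "0 < v r" "0 < r" using is_solutionD(1)[OF sol r] r R0 by auto
  have "ln R0 < ln r" using r R0 by simp
  from eq[OF this] have "r powr (p + s) * v r powr k = m" using v by (simp add: orbit_of_def)
  then have "(r powr (p + s) * v r powr k) powr (1 / k) = m powr (1 / k)" by simp
  moreover have "(r powr (p + s) * v r powr k) powr (1 / k) = r powr g * v r"
    using v k_pos by (simp add: powr_mult powr_powr gam_def)
  ultimately show "v r = A_star N p s mu q * r powr (- g)"
    using v by (simp add: A_star_def m_def powr_minus field_simps)
qed

text \<open>The orbit exists only where \<open>v' < 0\<close>; \<open>b\<close> is the left end of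
  the maximal ray with this property. For an orbit resting at the equilibrium it remains to show
  \<open>b = R0\<close>, since type (I) is a claim about the whole of
  \<open>(R0, infinity)\<close>.\<close>

lemma type_dichotomy: "type_I N p s mu q R0 v \<or> type_III N p mu v"
proof -
  define A where "A = {a. R0 \<le> a \<and> (\<forall>r>a. deriv v r < 0)}"
  have "A \<noteq> {}" using deriv_neg_eventually[OF R0 sol] by (auto simp: A_def)
  have bdd: "bdd_below A" by (auto simp: A_def intro: bdd_belowI)
  define b where "b = Inf A"
  have bA: "b \<in> A"
  proof -
    have "R0 \<le> b" unfolding b_def using \<open>A \<noteq> {}\<close> by (intro cInf_greatest) (auto simp: A_def)
    moreover have "deriv v r < 0" if br: "b < r" for r
    proof -
      obtain a where "a \<in> A" "a < r" using cInf_lessD[OF \<open>A \<noteq> {}\<close>, of r] br[unfolded b_def] by blast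
      then show ?thesis by (auto simp: A_def)
    qed
    ultimately show ?thesis by (auto simp: A_def)
  qed
  then have b: "R0 \<le> b" "\<And>r. b < r \<Longrightarrow> deriv v r < 0" by (auto simp: A_def)
  have b0: "0 < b" using R0 b by simp
  have "ln R0 \<le> ln b" using R0 b b0 by simp
  have eb: "exp (ln b) = b" using b0 by simp
  have pf: "pflow (ln b) (\<lambda>t. fst (orbit_of p s q v t)) (\<lambda>t. snd (orbit_of p s q v t))"
    by (rule sol_pflow[OF R0 sol \<open>ln R0 \<le> ln b\<close>]) (simp add: b(2) eb)
  from pflow_dichotomy[OF pf] show ?thesis
  proof
    assume "((\<lambda>t. snd (orbit_of p s q v t)) \<longlongrightarrow> 0) at_top"
    then show ?thesis using type_III_of_decay by blast
  next
    assume eq: "\<forall>t>ln b. fst (orbit_of p s q v t) = g \<and> snd (orbit_of p s q v t) = m"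
    have "b = R0"
    proof (rule ccontr)
      assume "b \<noteq> R0"
      then have "R0 < b" using b by simp
      \<comment> \<open>\<open>f = 0\<close> expresses \<open>x = g\<close> without division. It
        extends to \<open>b\<close> by continuity and gives \<open>v' < 0\<close> there, hence also
        slightly to the left of \<open>b\<close>, against the minimality of
        \<open>b\<close>.\<close>
      define f where "f = (\<lambda>r. r * deriv v r + g * v r)"
      have "continuous_on {R0<..} f"
        unfolding f_def by (intro continuous_intros is_solution_continuous[OF sol])
      then have c: "isCont f b" and cd: "isCont (deriv v) b"
        using \<open>R0 < b\<close> is_solution_continuous(2)[OF sol]
        by (auto simp: continuous_on_eq_continuous_at)
      have fz: "f r = 0" if "b < r" for r
      proof -
        have "ln b < ln r" "0 < r" using that b0 by auto
        then have "- (r * deriv v r / v r) = g" using eq by (auto simp: orbit_of_def)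
        then show ?thesis using is_solutionD(1)[OF sol, of r] that b by (simp add: f_def field_simps)
      qed
      have "(f \<longlongrightarrow> f b) (at_right b)" using c by (auto simp: isCont_def intro: tendsto_within_subset)
      moreover have "(f \<longlongrightarrow> 0) (at_right b)"
        by (rule tendsto_eventually) (auto simp: eventually_at_right_field fz intro: exI[of _ "b + 1"])
      ultimately have "f b = 0" using tendsto_unique trivial_limit_at_right_real by blast
      moreover have "0 < g * v b" using g_pos is_solutionD(1)[OF sol \<open>R0 < b\<close>] by simp
      ultimately have "b * deriv v b < 0" by (simp add: f_def)
      then have "deriv v b < 0" using b0 by (simp add: mult_less_0_iff)
      then have "eventually (\<lambda>r. deriv v r < 0) (at b)"
        using cd by (auto simp: isCont_def intro: order_tendstoD)
      then obtain d where d: "0 < d" "\<And>r. r \<noteq> b \<Longrightarrow> dist r b < d \<Longrightarrow> deriv v r < 0"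
        unfolding eventually_at by blast
      define a where "a = max R0 (b - d)"
      have "deriv v r < 0" if "a < r" for r
        using that d(2)[of r] b(2)[of r] \<open>deriv v b < 0\<close>
        by (cases r b rule: linorder_cases) (auto simp: a_def dist_real_def)
      then have "a \<in> A" by (simp add: A_def a_def)
      then have "b \<le> a" unfolding b_def using bdd by (intro cInf_lower)
      then show False using \<open>R0 < b\<close> d(1) by (simp add: a_def)
    qed
    then have "type_I N p s mu q R0 v"
      using eq by (intro type_I_of_equilibrium) (auto simp: prod_eq_iff)
    then show ?thesis ..
  qed
qed

lemma type_I_limit:
  assumes "type_I N p s mu q R0 v"
  shows "((\<lambda>r. r * deriv v r / v r) \<longlongrightarrow> - g) at_top"
proof (rule tendsto_eventually, rule eventually_mono[OF eventually_gt_at_top[of R0]])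
  fix r assume r: "R0 < r"
  then have "0 < r" using R0 by simp
  have eq: "v r = A_star N p s mu q * r powr (- g)" if "R0 < r" for r
    using assms that by (simp add: type_I_def)
  have "((\<lambda>r. A_star N p s mu q * r powr (- g)) has_real_derivative
      A_star N p s mu q * (- g * r powr (- g - 1))) (at r)"
    by (intro DERIV_cmult has_real_derivative_powr \<open>0 < r\<close>)
  then have "(v has_real_derivative A_star N p s mu q * (- g * r powr (- g - 1))) (at r)"
    by (rule has_field_derivative_transform_within_open[OF _ open_greaterThan[of R0]]) (use r eq in auto)
  then have "deriv v r = A_star N p s mu q * (- g * r powr (- g - 1))" by (rule DERIV_imp_deriv)
  moreover have "r * r powr (- g - 1) = r powr (- g)" using \<open>0 < r\<close> by (simp add: powr_diff)
  ultimately have "r * deriv v r = - g * v r" using eq[OF r] by (simp add: mult.left_commute)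
  then show "r * deriv v r / v r = - g" using is_solutionD(1)[OF sol r] by simp
qed

lemma types_exclusive: "\<not> (type_I N p s mu q R0 v \<and> type_III N p mu v)"
proof
  assume "type_I N p s mu q R0 v \<and> type_III N p mu v"
  then have "((\<lambda>r. r * deriv v r / v r) \<longlongrightarrow> - g) at_top" "((\<lambda>r. r * deriv v r / v r) \<longlongrightarrow> - nu) at_top"
    using type_I_limit by (auto simp: type_III_def)
  then have "- g = - nu" by (intro tendsto_unique) auto
  then show False using g_less_nu by simp
qed

end

lemma type_I_exists:
  assumes "0 < R0"
  shows "\<exists>v. is_solution N p s mu q R0 v \<and> type_I N p s mu q R0 v"
proof -
  have "fX g m = 0" using g_pos by (simp add: fX_eq m_def)
  then have pf: "pflow (ln R0) (\<lambda>_. g) (\<lambda>_. m)"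
    using g_pos m_pos by (auto simp: pflow_def)
  have "exp (ln R0) = R0" using assms by simp
  with pflow_sol(1,3)[OF pf] show ?thesis using type_I_of_equilibrium[OF assms] by metis
qed

end

section \<open>The stable manifold of the saddle\<close>

text \<open>The factor is positive, so the sign of a solution never changes: this is the invariance
  of \<open>Y > 0\<close> and of \<open>Y = 0\<close>.\<close>

lemma linear_ode_exp:
  fixes Y a :: "real \<Rightarrow> real"
  assumes "0 \<le> T" and a: "continuous_on {0..T} a"
    and Y: "\<And>t. t \<in> {0..T} \<Longrightarrow> (Y has_real_derivative a t * Y t) (at t within {0..T})"
  obtains b where "Y T = Y 0 * exp b"
proof -
  obtain A where A: "\<And>t. t \<in> {0..T} \<Longrightarrow> (A has_real_derivative a t) (at t within {0..T})"
    using antiderivative_continuous[OF a] by (metis has_real_derivative_iff_has_vector_derivative)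
  have "((\<lambda>t. Y t * exp (- A t)) has_real_derivative 0) (at t within {0..T})" if "t \<in> {0..T}" for t
    by (rule derivative_eq_intros Y A that refl)+ (simp add: algebra_simps)
  then have "\<exists>c. \<forall>t\<in>{0..T}. Y t * exp (- A t) = c"
    by (intro has_field_derivative_zero_constant) auto
  then have "Y T * exp (- A T) = Y 0 * exp (- A 0)" using assms(1) by force
  then have "Y T = Y 0 * exp (A T - A 0)" by (simp add: exp_diff exp_minus field_simps)
  then show thesis by (rule that)
qed

lemma abs_exp_diff_le:
  fixes a b c :: real
  assumes "a \<le> c" "b \<le> c" shows "\<bar>exp a - exp b\<bar> \<le> exp c * \<bar>a - b\<bar>"
proof -
  have *: "exp b - exp a \<le> exp c * (b - a)" if "a \<le> b" "b \<le> c" for a b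
  proof -
    have "1 + (a - b) \<le> exp (a - b)" by (rule exp_ge_add_one_self)
    then have "exp b * (1 + (a - b)) \<le> exp a"
      using mult_left_mono[of _ _ "exp b"] by (fastforce simp: exp_diff)
    then have "exp b - exp a \<le> exp b * (b - a)" by (simp add: algebra_simps)
    also have "\<dots> \<le> exp c * (b - a)" using that by (intro mult_right_mono) auto
    finally show ?thesis .
  qed
  show ?thesis
    using *[of a b] *[of b a] assms by (cases "a \<le> b") (auto simp: abs_if)
qed

section \<open>Hyperbolicity estimates near the saddle\<close>

context radial
begin

text \<open>Hyperbolicity in quantitative form on a box of size \<open>e\<close>: difference
  quotients in \<open>x\<close> lie between \<open>l\<close> and \<open>u\<close>, which is uniform
  expansion, and \<open>K\<close> bounds the coupling to \<open>Y\<close>. The condition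
  \<open>e <= (nu - g) / 2\<close> keeps \<open>x - g\<close> above a positive constant, which is
  uniform contraction of \<open>Y\<close>.\<close>

definition saddle_box :: "real \<Rightarrow> real \<Rightarrow> real \<Rightarrow> real \<Rightarrow> bool" where
  "saddle_box e l u K \<longleftrightarrow> 0 < e \<and> e < nu \<and> e \<le> (nu - g) / 2 \<and> 0 < l \<and> l < u \<and> 0 < K \<and>
     (\<forall>x1 x2 Y. \<bar>x1 - nu\<bar> \<le> e \<longrightarrow> \<bar>x2 - nu\<bar> \<le> e \<longrightarrow> \<bar>Y\<bar> \<le> e \<longrightarrow>
       (\<exists>c. l \<le> c \<and> c \<le> u \<and> fX x1 Y - fX x2 Y = c * (x1 - x2))) \<and>
     (\<forall>x Y1 Y2. \<bar>x - nu\<bar> \<le> e \<longrightarrow> \<bar>fX x Y1 - fX x Y2\<bar> \<le> K * \<bar>Y1 - Y2\<bar>)"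

lemma saddle_box_exists: "\<exists>e l u K. saddle_box e l u K"
proof -
  define L where "L = p * nu - (N - p)"
  have "0 < L" using p_nu_gt by (simp add: L_def)
  define D where "D = (\<lambda>z. fX' (fst z) (snd z))"
  have "continuous_on half_plane D"
    unfolding D_def fX'_def using p1 by (intro continuous_intros) (auto simp: half_plane_def)
  moreover have "(nu, 0) \<in> half_plane" using nu_pos by (simp add: half_plane_def)
  ultimately have "isCont D (nu, 0)"
    using open_half_plane by (simp add: continuous_on_eq_continuous_at)
  moreover have "D (nu, 0) = L" by (simp add: D_def L_def fX'_P)
  ultimately obtain d where d: "0 < d" "\<And>z. dist z (nu, 0) < d \<Longrightarrow> dist (D z) L < L / 2"
    unfolding continuous_at_eps_delta using \<open>0 < L\<close> by (metis half_gt_zero)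
  define e where "e = min (d / 3) (min (nu / 2) ((nu - g) / 2))"
  have e: "0 < e" "e < nu" "e \<le> (nu - g) / 2" "2 * e < d"
    using d(1) nu_pos g_less_nu by (auto simp: e_def min_def)
  have D: "L / 2 \<le> fX' x Y \<and> fX' x Y \<le> 2 * L" if "\<bar>x - nu\<bar> \<le> e" "\<bar>Y\<bar> \<le> e" for x Y
  proof -
    have "dist (x, Y) (nu, 0) \<le> \<bar>x - nu\<bar> + \<bar>Y\<bar>"
      unfolding dist_Pair_Pair dist_real_def using sqrt_sum_squares_le_sum_abs[of "x - nu" Y] by simp
    then have "dist (D (x, Y)) L < L / 2" using that e by (intro d(2)) linarith
    then have "\<bar>fX' x Y - L\<bar> < L / 2" by (simp add: D_def dist_real_def)
    then show ?thesis using \<open>0 < L\<close> by (intro conjI; linarith)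
  qed
  define w where "w = (\<lambda>x. x powr (2 - p) / (p - 1))"
  have "continuous_on {nu - e..nu + e} w"
    unfolding w_def using p1 e by (intro continuous_intros) auto
  then have "bounded (w ` {nu - e..nu + e})"
    by (intro compact_imp_bounded compact_continuous_image) auto
  then obtain K where K: "0 < K" "\<And>x. x \<in> {nu - e..nu + e} \<Longrightarrow> \<bar>w x\<bar> \<le> K"
    unfolding bounded_pos by (metis imageI real_norm_def)
  have "saddle_box e (L / 2) (2 * L) K"
    unfolding saddle_box_def
  proof (intro conjI allI impI)
    show "0 < e" "e < nu" "e \<le> (nu - g) / 2" "0 < K" by fact+
    show "0 < L / 2" "L / 2 < 2 * L" using \<open>0 < L\<close> by auto
  next
    fix x Y1 Y2 assume x: "\<bar>x - nu\<bar> \<le> e"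
    have "fX x Y1 - fX x Y2 = w x * (Y1 - Y2)"
      by (simp add: fX_def w_def diff_divide_distrib[symmetric]) (simp add: algebra_simps)
    then show "\<bar>fX x Y1 - fX x Y2\<bar> \<le> K * \<bar>Y1 - Y2\<bar>"
      using K(2)[of x] x by (auto simp: abs_mult abs_le_iff intro!: mult_right_mono)
  next
    have *: "\<exists>c. L / 2 \<le> c \<and> c \<le> 2 * L \<and> fX x1 Y - fX x2 Y = c * (x1 - x2)"
      if "x2 < x1" "\<bar>x1 - nu\<bar> \<le> e" "\<bar>x2 - nu\<bar> \<le> e" "\<bar>Y\<bar> \<le> e" for x1 x2 Y
    proof -
      have "0 < x2" using that(3) e by (simp add: abs_le_iff)
      then have "\<exists>z>x2. z < x1 \<and> fX x1 Y - fX x2 Y = (x1 - x2) * fX' z Y"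
        using that(1) by (intro MVT2 fX_deriv) auto
      then obtain z where z: "x2 < z" "z < x1" "fX x1 Y - fX x2 Y = (x1 - x2) * fX' z Y" by blast
      have "\<bar>z - nu\<bar> \<le> e" using z that by linarith
      then show ?thesis using D[of z Y] z(3) that(4) by (intro exI[of _ "fX' z Y"]) (auto simp: mult.commute)
    qed
    fix x1 x2 Y assume x: "\<bar>x1 - nu\<bar> \<le> e" "\<bar>x2 - nu\<bar> \<le> e" "\<bar>Y\<bar> \<le> e"
    consider "x1 < x2" | "x2 < x1" | "x1 = x2" by linarith
    then show "\<exists>c. L / 2 \<le> c \<and> c \<le> 2 * L \<and> fX x1 Y - fX x2 Y = c * (x1 - x2)"
    proof cases
      case 1
      then obtain c where "L / 2 \<le> c" "c \<le> 2 * L" "fX x2 Y - fX x1 Y = c * (x2 - x1)"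
        using *[of x1 x2 Y] x by blast
      then show ?thesis by (intro exI[of _ c]) (auto simp: algebra_simps)
    next
      case 3
      then show ?thesis using \<open>0 < L\<close> by (intro exI[of _ L]) auto
    qed (use * x in auto)
  qed
  then show ?thesis by blast
qed

text \<open>The cone \<open>b \<bar>Y1 - Y2\<bar> \<le> \<bar>x1 - x2\<bar>\<close> is forward invariant near the saddle, and inside it
  the differences of the first components cannot decay.\<close>

definition near_saddle :: "real \<Rightarrow> real \<Rightarrow> (real \<Rightarrow> real) \<Rightarrow> (real \<Rightarrow> real) \<Rightarrow> bool" where
  "near_saddle e T x Y \<longleftrightarrow> (\<forall>t\<ge>T. (x has_real_derivative fX (x t) (Y t)) (at t) \<and>
     (Y has_real_derivative k * Y t * (g - x t)) (at t) \<and> \<bar>x t - nu\<bar> < e \<and> \<bar>Y t\<bar> < e)"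

text \<open>If \<open>Y1\<close> and \<open>Y2\<close> agree at the initial time but
  \<open>x1\<close> and \<open>x2\<close> do not, then \<open>Q > 0\<close> there. As
  \<open>Q\<close> increases wherever it is positive, \<open>(d t)^2\<close> stays above
  \<open>Q t0\<close>, contradicting the common limit \<open>nu\<close>. No sign of \<open>Y\<close>
  is prescribed, so the axis \<open>Y = 0\<close> is covered.\<close>

lemma stable_fibre_unique:
  "\<exists>e>0. \<forall>x1 Y1 x2 Y2 T. near_saddle e T x1 Y1 \<longrightarrow> near_saddle e T x2 Y2 \<longrightarrow>
     (x1 \<longlongrightarrow> nu) at_top \<longrightarrow> (x2 \<longlongrightarrow> nu) at_top \<longrightarrow> Y1 T = Y2 T \<longrightarrow> x1 T = x2 T"
proof -
  obtain e0 l u K where box: "saddle_box e0 l u K" using saddle_box_exists by blast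
  then have c: "0 < e0" "e0 < nu" "e0 \<le> (nu - g) / 2" "0 < l" "l < u" "0 < K"
    and slope: "\<And>x1 x2 Y. \<bar>x1 - nu\<bar> \<le> e0 \<Longrightarrow> \<bar>x2 - nu\<bar> \<le> e0 \<Longrightarrow> \<bar>Y\<bar> \<le> e0 \<Longrightarrow>
       \<exists>c. l \<le> c \<and> c \<le> u \<and> fX x1 Y - fX x2 Y = c * (x1 - x2)"
    and K: "\<And>x Y1 Y2. \<bar>x - nu\<bar> \<le> e0 \<Longrightarrow> \<bar>fX x Y1 - fX x Y2\<bar> \<le> K * \<bar>Y1 - Y2\<bar>"
    unfolding saddle_box_def by blast+
  \<comment> \<open>In the cone this opening bounds the coupling \<open>K * abs (y t)\<close> by a
    quarter of the expansion, \<open>l / 4 * abs (d t)\<close>.\<close>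
  define b where "b = 4 * K / l"
  have "0 < b" using c by (simp add: b_def)
  \<comment> \<open>The second term makes the feedback of \<open>d\<close> on \<open>y\<close>,
    weighted with \<open>b^2\<close>, at most \<open>l / 4 * (d t)^2\<close>. Half the derivative of
    \<open>Q\<close> is then at least \<open>l / 2 * (d t)^2\<close>.\<close>
  define e where "e = min e0 (l / (4 * b * k))"
  have e: "0 < e" "e \<le> e0" "e * (4 * b * k) \<le> l"
  proof -
    define bk where "bk = 4 * b * k"
    have bk: "0 < bk" using \<open>0 < b\<close> k_pos by (simp add: bk_def)
    then show "0 < e" "e \<le> e0" using c by (auto simp: e_def bk_def[symmetric])
    have "e \<le> l / bk" by (simp add: e_def bk_def)
    then show "e * (4 * b * k) \<le> l" using bk unfolding bk_def[symmetric] by (simp add: pos_le_divide_eq)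
  qed
  show ?thesis
  proof (intro exI[of _ e] conjI allI impI)
    show "0 < e" by fact
    fix x1 Y1 x2 Y2 and t0 :: real
    assume n: "near_saddle e t0 x1 Y1" "near_saddle e t0 x2 Y2"
      and lim: "(x1 \<longlongrightarrow> nu) at_top" "(x2 \<longlongrightarrow> nu) at_top" and Y0: "Y1 t0 = Y2 t0"
    note f1 = n(1)[unfolded near_saddle_def, rule_format] and f2 = n(2)[unfolded near_saddle_def, rule_format]
    define d where "d = (\<lambda>t. x1 t - x2 t)"
    define y where "y = (\<lambda>t. Y1 t - Y2 t)"
    define d' where "d' = (\<lambda>t. fX (x1 t) (Y1 t) - fX (x2 t) (Y2 t))"
    define y' where "y' = (\<lambda>t. k * Y1 t * (g - x1 t) - k * Y2 t * (g - x2 t))"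
    define Q where "Q = (\<lambda>t. (d t)\<^sup>2 - (b * y t)\<^sup>2)"
    have Qd: "(Q has_real_derivative 2 * (d t * d' t) - 2 * (b\<^sup>2 * (y t * y' t))) (at t)" if "t0 \<le> t" for t
    proof -
      have "(d has_real_derivative d' t) (at t)" "(y has_real_derivative y' t) (at t)"
        unfolding d_def y_def d'_def y'_def using f1[OF that] f2[OF that] by (auto intro!: DERIV_diff)
      then show ?thesis unfolding Q_def
        by (auto intro!: derivative_eq_intros simp: power2_eq_square algebra_simps)
    qed
    have pos: "0 < 2 * (d t * d' t) - 2 * (b\<^sup>2 * (y t * y' t))" if t: "t0 \<le> t" and Q: "0 < Q t" for t
    proof -
      note b1 = f1[OF t] note b2 = f2[OF t]
      have cone: "b * \<bar>y t\<bar> \<le> \<bar>d t\<bar>"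
      proof (rule abs_le_square_iff[THEN iffD2, of "b * \<bar>y t\<bar>" "\<bar>d t\<bar>", simplified abs_idempotent, THEN order_trans[OF abs_ge_self]])
        show "(b * \<bar>y t\<bar>)\<^sup>2 \<le> \<bar>d t\<bar>\<^sup>2" using Q by (simp add: Q_def power_mult_distrib)
      qed
      have "d t \<noteq> 0" using Q by (auto simp: Q_def)
      then have d2: "0 < (d t)\<^sup>2" by simp
      obtain s where s: "l \<le> s" "fX (x1 t) (Y1 t) - fX (x2 t) (Y1 t) = s * d t"
        using slope[of "x1 t" "x2 t" "Y1 t"] b1 b2 e(2) unfolding d_def by fastforce
      define r where "r = fX (x2 t) (Y1 t) - fX (x2 t) (Y2 t)"
      have "\<bar>r\<bar> \<le> K * \<bar>y t\<bar>" unfolding r_def y_def using b2 e(2) by (intro K) auto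
      also have "\<dots> = l / 4 * (b * \<bar>y t\<bar>)" using c by (simp add: b_def)
      also have "\<dots> \<le> l / 4 * \<bar>d t\<bar>" using cone c by (intro mult_left_mono) auto
      finally have "\<bar>d t\<bar> * \<bar>r\<bar> \<le> \<bar>d t\<bar> * (l / 4 * \<bar>d t\<bar>)" by (intro mult_left_mono) auto
      then have "\<bar>d t * r\<bar> \<le> \<bar>d t\<bar> * (l / 4 * \<bar>d t\<bar>)" by (simp only: abs_mult)
      also have "\<dots> = l / 4 * (d t)\<^sup>2" by (simp add: power2_eq_square)
      finally have "\<bar>d t * r\<bar> \<le> l / 4 * (d t)\<^sup>2" .
      then have "- (l / 4 * (d t)\<^sup>2) \<le> d t * r" by linarith
      moreover have "d' t = s * d t + r" using s(2) by (simp add: d'_def r_def)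
      then have "d t * d' t = s * (d t)\<^sup>2 + d t * r" by (simp add: power2_eq_square algebra_simps)
      moreover have "l * (d t)\<^sup>2 \<le> s * (d t)\<^sup>2" using s(1) by (intro mult_right_mono) auto
      ultimately have dd: "l * (d t)\<^sup>2 - l / 4 * (d t)\<^sup>2 \<le> d t * d' t" by linarith
      have yy: "y' t = k * (g - x1 t) * y t - k * Y2 t * d t"
        by (simp add: y'_def y_def d_def algebra_simps)
      have "y t * y' t = k * (g - x1 t) * (y t)\<^sup>2 - k * Y2 t * d t * y t"
        unfolding yy by (simp add: power2_eq_square algebra_simps)
      moreover have "k * (g - x1 t) * (y t)\<^sup>2 \<le> 0"
        using b1 e(2) c(3) k_pos by (intro mult_nonpos_nonneg mult_nonneg_nonpos) auto
      moreover have "- (k * Y2 t * d t * y t) \<le> k * e * \<bar>d t\<bar> * \<bar>y t\<bar>"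
      proof -
        have "\<bar>k * Y2 t * d t * y t\<bar> \<le> k * e * \<bar>d t\<bar> * \<bar>y t\<bar>"
          unfolding abs_mult using b2 k_pos by (intro mult_right_mono mult_mono) auto
        then show ?thesis by linarith
      qed
      ultimately have "y t * y' t \<le> k * e * \<bar>d t\<bar> * \<bar>y t\<bar>" by linarith
      then have "b\<^sup>2 * (y t * y' t) \<le> b\<^sup>2 * (k * e * \<bar>d t\<bar> * \<bar>y t\<bar>)" by (intro mult_left_mono) auto
      also have "\<dots> = (b * k * e * \<bar>d t\<bar>) * (b * \<bar>y t\<bar>)" by (simp add: power2_eq_square)
      also have "\<dots> \<le> (b * k * e * \<bar>d t\<bar>) * \<bar>d t\<bar>"
        using \<open>0 < b\<close> k_pos e(1) by (intro mult_left_mono cone) auto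
      also have "\<dots> = (e * (4 * b * k)) * ((d t)\<^sup>2 / 4)" by (simp add: power2_eq_square)
      also have "\<dots> \<le> l * ((d t)\<^sup>2 / 4)" using e(3) by (intro mult_right_mono) auto
      finally have "b\<^sup>2 * (y t * y' t) \<le> l / 4 * (d t)\<^sup>2" by simp
      moreover have "0 < l * (d t)\<^sup>2" using d2 c by simp
      ultimately show ?thesis using dd by linarith
    qed
    show "x1 t0 = x2 t0"
    proof (rule ccontr)
      assume "x1 t0 \<noteq> x2 t0"
      then have Q0: "0 < Q t0" using Y0 by (simp add: Q_def d_def y_def)
      have "Q t0 \<le> (d t)\<^sup>2" if "t0 \<le> t" for t
      proof -
        have "Q t0 \<le> Q t" by (rule DERIV_barrier[OF Qd order_refl _ that]) (use pos Q0 in auto)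
        also have "\<dots> \<le> (d t)\<^sup>2" by (simp add: Q_def)
        finally show ?thesis .
      qed
      then have "eventually (\<lambda>t. Q t0 \<le> (d t)\<^sup>2) at_top"
        by (rule eventually_mono[OF eventually_ge_at_top[of t0]])
      moreover have "((\<lambda>t. (d t)\<^sup>2) \<longlongrightarrow> (nu - nu)\<^sup>2) at_top"
        unfolding d_def by (intro tendsto_intros lim)
      ultimately have "Q t0 \<le> (nu - nu)\<^sup>2" by (intro tendsto_lowerbound) auto
      then show False using Q0 by simp
    qed
  qed
qed

text \<open>The unknown is \<open>u = x - nu\<close>. Given \<open>u\<close>, the equation for
  \<open>Y\<close> is linear and solved by an exponential, so the system becomes one equation
  \<open>u' = M * u + G u\<close> with a nonlocal \<open>G\<close>, whose bounded solution is
  sought. Subtracting the largest slope \<open>M\<close> leaves slopes in \<open>[l - M, 0]\<close>,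
  so \<open>G\<close> has a Lipschitz constant below \<open>M\<close>.\<close>

lemma stable_orbit_exists: "\<exists>c. solves_on F quadrant {0..} c \<and> (c \<longlongrightarrow> P_plus N p mu) at_top"
proof -
  obtain e l M K where box: "saddle_box e l M K" using saddle_box_exists by blast
  then have c: "0 < e" "e < nu" "e \<le> (nu - g) / 2" "0 < l" "l < M" "0 < K"
    and slope: "\<And>x1 x2 Y. \<bar>x1 - nu\<bar> \<le> e \<Longrightarrow> \<bar>x2 - nu\<bar> \<le> e \<Longrightarrow> \<bar>Y\<bar> \<le> e \<Longrightarrow>
       \<exists>c. l \<le> c \<and> c \<le> M \<and> fX x1 Y - fX x2 Y = c * (x1 - x2)"
    and K: "\<And>x Y1 Y2. \<bar>x - nu\<bar> \<le> e \<Longrightarrow> \<bar>fX x Y1 - fX x Y2\<bar> \<le> K * \<bar>Y1 - Y2\<bar>"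
    unfolding saddle_box_def by blast+
  define w where "w = (nu - g) / 2"
  have "0 < w" using g_less_nu by (simp add: w_def)
  \<comment> \<open>The three bounds keep \<open>Y\<close> in the box, give
    \<open>abs (G u t) <= M * e\<close>, and make the contribution \<open>K * Y0 / w\<close> of
    \<open>Y\<close> to the Lipschitz constant smaller than \<open>l\<close>.\<close>
  define Y0 where "Y0 = min e (min (l * e / K) (l * w / (2 * K)))"
  have Y0: "0 < Y0" "Y0 \<le> e" "K * Y0 \<le> l * e" "K * Y0 / w < l"
  proof -
    show "0 < Y0" "Y0 \<le> e" using c \<open>0 < w\<close> by (auto simp: Y0_def)
    have "Y0 \<le> l * e / K" "Y0 \<le> l * w / (2 * K)" by (auto simp: Y0_def)
    then have "K * Y0 \<le> l * e" "K * Y0 \<le> l * w / 2" using c by (simp_all add: field_simps)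
    moreover have "l * w / 2 < l * w" using c \<open>0 < w\<close> by simp
    ultimately show "K * Y0 \<le> l * e" "K * Y0 / w < l" using \<open>0 < w\<close> by (auto simp: pos_divide_less_eq)
  qed
  \<comment> \<open>Truncation makes \<open>G\<close> meaningful for all continuous
    \<open>u\<close>. The bound \<open>M * e / M = e\<close> on the solution shows afterwards that
    the truncation is inactive.\<close>
  define cl where "cl = (\<lambda>a::real. max (- e) (min e a))"
  have cl: "\<bar>cl a\<bar> \<le> e" "\<bar>cl a - cl b\<bar> \<le> \<bar>a - b\<bar>" for a b using c(1) by (auto simp: cl_def)
  have clc: "continuous_on {0..} (\<lambda>s. cl (u s))" if "continuous_on {0..} u" for u :: "real \<Rightarrow> real"
    unfolding cl_def using that by (intro continuous_intros)
  define I where "I = (\<lambda>(u :: real \<Rightarrow> real) (t :: real). integral {0..t} (\<lambda>s. g - nu - cl (u s)))"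
  define Y where "Y = (\<lambda>u t. Y0 * exp (k * I u t))"
  define G where "G = (\<lambda>u t. fX (nu + cl (u t)) (Y u t) - M * cl (u t))"
  have ic: "continuous_on {0..t} (\<lambda>s. g - nu - cl (u s))" if "continuous_on {0..} u" for u :: "real \<Rightarrow> real" and t
    using continuous_on_subset[OF clc[OF that], of "{0..t}"] by (intro continuous_intros) auto
  have Yd: "(Y u has_real_derivative k * Y u t * (g - (nu + cl (u t)))) (at t within {0..})"
    if u: "continuous_on {0..} u" and t: "0 \<le> t" for u t
  proof -
    have "((\<lambda>t. I u t) has_real_derivative g - nu - cl (u t)) (at t within {0..t + 1})"
      unfolding I_def using t by (intro integral_has_real_derivative ic u) auto
    then have "((\<lambda>t. I u t) has_real_derivative g - nu - cl (u t)) (at t within {0..})"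
      using at_within_atLeast_eq[of t "t + 1"] t by simp
    then show ?thesis unfolding Y_def by (auto intro!: derivative_eq_intros simp: algebra_simps)
  qed
  have Yc: "continuous_on {0..} (Y u)" if "continuous_on {0..} u" for u
    using Yd[OF that] by (auto simp: continuous_on_eq_continuous_within intro!: DERIV_continuous)
  have Ib: "I u t \<le> - w * t" if u: "continuous_on {0..} u" and t: "0 \<le> t" for u t
  proof -
    have "I u t \<le> integral {0..t} (\<lambda>s. - w)"
      unfolding I_def
    proof (rule integral_le)
      fix s show "g - nu - cl (u s) \<le> - w" using cl(1)[of "u s"] c(3) by (simp add: w_def abs_le_iff field_simps)
    qed (use ic[OF u] in \<open>auto intro: integrable_continuous_real\<close>)
    then show ?thesis using t by (simp add: mult.commute)
  qed
  have Yb: "0 < Y u t" "Y u t \<le> Y0" if u: "continuous_on {0..} u" and t: "0 \<le> t" for u t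
  proof -
    show "0 < Y u t" using Y0 by (simp add: Y_def)
    have "I u t \<le> 0" using Ib[OF u t] \<open>0 < w\<close> t by (meson mult_nonpos_nonneg neg_le_0_iff_le less_imp_le order_trans)
    then have "k * I u t \<le> 0" using k_pos by (simp add: mult_le_0_iff)
    then show "Y u t \<le> Y0" using Y0(1) by (simp add: Y_def)
  qed
  have base: "\<bar>fX (nu + cl a) y - M * cl a - (fX (nu + cl b) y - M * cl b)\<bar> \<le> (M - l) * \<bar>cl a - cl b\<bar>"
    if ye: "\<bar>y\<bar> \<le> e" for a b y
  proof -
    obtain s where s: "l \<le> s" "s \<le> M" "fX (nu + cl a) y - fX (nu + cl b) y = s * (cl a - cl b)"
      using slope[of "nu + cl a" "nu + cl b" y] cl(1) ye by auto
    then have "fX (nu + cl a) y - M * cl a - (fX (nu + cl b) y - M * cl b) = (s - M) * (cl a - cl b)"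
      by (simp add: algebra_simps)
    then show ?thesis using s by (simp add: abs_mult mult_right_mono)
  qed
  have fX0: "fX nu 0 = 0" using nu_pos by (simp add: fX_eq h_nu)
  have cl0: "cl 0 = 0" using c(1) by (simp add: cl_def)
  obtain u where u: "continuous_on {0..} u" "\<And>t. 0 \<le> t \<Longrightarrow> \<bar>u t\<bar> \<le> M * e / M"
    "\<And>t. 0 \<le> t \<Longrightarrow> (u has_real_derivative M * u t + G u t) (at t within {0..})"
  proof (rule bounded_solution_exists[of M "M - l + K * Y0 / w" G "M * e"])
    show "0 < M" "0 \<le> M - l + K * Y0 / w" "M - l + K * Y0 / w < M"
      using c Y0 \<open>0 < w\<close> by (auto intro!: add_nonneg_nonneg)
    fix u :: "real \<Rightarrow> real" assume u: "continuous_on {0..} u"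
    show "continuous_on {0..} (G u)"
    proof -
      have "nu + cl (u s) \<noteq> 0" for s using cl(1)[of "u s"] c(2) by (auto simp: abs_le_iff)
      then show ?thesis unfolding G_def fX_def using p1 by (intro continuous_intros clc Yc u) auto
    qed
    show "\<bar>G u t\<bar> \<le> M * e" if t: "0 \<le> t" for t
    proof -
      have y: "\<bar>Y u t\<bar> \<le> e" using Yb[OF u t] Y0 by simp
      have "\<bar>G u t - (fX nu (Y u t))\<bar> \<le> (M - l) * \<bar>cl (u t)\<bar>"
        using base[OF y, of "u t" 0] by (simp add: G_def cl0)
      also have "\<dots> \<le> (M - l) * e" using cl(1) c by (intro mult_left_mono) auto
      finally have "\<bar>G u t - (fX nu (Y u t))\<bar> \<le> (M - l) * e" .
      moreover have "\<bar>fX nu (Y u t)\<bar> \<le> K * Y0"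
      proof -
        have "\<bar>fX nu (Y u t)\<bar> \<le> K * \<bar>Y u t\<bar>" using K[of nu "Y u t" 0] c(1) fX0 by simp
        also have "\<dots> \<le> K * Y0" using Yb[OF u t] c by (intro mult_left_mono) auto
        finally show ?thesis .
      qed
      moreover have "(M - l) * e = M * e - l * e" by (rule left_diff_distrib)
      ultimately show ?thesis using Y0(3) by linarith
    qed
    fix v :: "real \<Rightarrow> real" and r t :: real
    assume v: "continuous_on {0..} v" and r: "\<And>s. 0 \<le> s \<Longrightarrow> \<bar>u s - v s\<bar> \<le> r" and t: "0 \<le> t"
    have "0 \<le> r" using r[of 0] by (auto intro: order_trans[OF abs_ge_zero])
    have y: "\<bar>Y u t\<bar> \<le> e" using Yb[OF u t] Y0 by simp
    have "\<bar>I u t - I v t\<bar> \<le> r * t"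
    proof -
      have "I u t - I v t = integral {0..t} (\<lambda>s. cl (v s) - cl (u s))"
        unfolding I_def by (subst integral_diff[symmetric]) (auto intro!: integrable_continuous_real ic u v)
      moreover have "norm (integral {0..t} (\<lambda>s. cl (v s) - cl (u s))) \<le> r * (t - 0)"
      proof (rule integral_bound[OF t])
        show "continuous_on {0..t} (\<lambda>s. cl (v s) - cl (u s))"
          by (intro continuous_intros continuous_on_subset[OF clc[OF u]] continuous_on_subset[OF clc[OF v]]) auto
        show "norm (cl (v s) - cl (u s)) \<le> r" if "s \<in> {0..t}" for s
          using cl(2)[of "v s" "u s"] r[of s] that by (simp add: abs_minus_commute)
      qed
      ultimately show ?thesis by simp
    qed
    then have "k * \<bar>I u t - I v t\<bar> \<le> k * (r * t)" using k_pos by (intro mult_left_mono) auto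
    then have Id: "\<bar>k * I u t - k * I v t\<bar> \<le> k * (r * t)"
      using k_pos by (simp add: abs_mult flip: right_diff_distrib)
    define z where "z = k * w * t"
    have z: "0 \<le> z" using k_pos \<open>0 < w\<close> t by (simp add: z_def)
    have kI: "k * I u t \<le> - z" "k * I v t \<le> - z"
      using mult_left_mono[OF Ib[OF u t], of k] mult_left_mono[OF Ib[OF v t], of k] k_pos
      by (auto simp: z_def mult_ac)
    have "\<bar>exp (k * I u t) - exp (k * I v t)\<bar> \<le> exp (- z) * (k * (r * t))"
      by (rule order_trans[OF abs_exp_diff_le[OF kI] mult_left_mono[OF Id]]) simp
    \<comment> \<open>The exponents differ by at most \<open>k * r * t\<close>, which grows with
      \<open>t\<close>, but both are at most \<open>- z\<close>. Since
      \<open>z * exp (- z) <= 1\<close>, the product is bounded uniformly in time by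
      \<open>r / w\<close>.\<close>
    also have "\<dots> = (z * exp (- z)) * (r / w)" using \<open>0 < w\<close> by (simp add: z_def)
    also have "\<dots> \<le> 1 * (r / w)"
    proof (rule mult_right_mono)
      have "z \<le> exp z" using exp_ge_add_one_self[of z] by linarith
      then show "z * exp (- z) \<le> 1" by (simp add: exp_minus field_simps)
    qed (use \<open>0 \<le> r\<close> \<open>0 < w\<close> in simp)
    finally have "Y0 * \<bar>exp (k * I u t) - exp (k * I v t)\<bar> \<le> Y0 * (r / w)"
      using Y0(1) by (intro mult_left_mono) auto
    then have "\<bar>Y u t - Y v t\<bar> \<le> Y0 * (r / w)"
      using Y0(1) unfolding Y_def right_diff_distrib[symmetric] abs_mult by simp
    then have "K * \<bar>Y u t - Y v t\<bar> \<le> K * (Y0 * (r / w))" using c by (intro mult_left_mono) auto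
    moreover have "\<bar>fX (nu + cl (v t)) (Y u t) - fX (nu + cl (v t)) (Y v t)\<bar> \<le> K * \<bar>Y u t - Y v t\<bar>"
      using cl(1)[of "v t"] by (intro K) simp
    moreover have "\<bar>fX (nu + cl (u t)) (Y u t) - M * cl (u t) - (fX (nu + cl (v t)) (Y u t) - M * cl (v t))\<bar> \<le> (M - l) * r"
    proof (rule order_trans[OF base[OF y] mult_left_mono])
      show "\<bar>cl (u t) - cl (v t)\<bar> \<le> r" using cl(2)[of "u t" "v t"] r[OF t] by linarith
    qed (use c in simp)
    ultimately have "\<bar>G u t - G v t\<bar> \<le> (M - l) * r + K * (Y0 * (r / w))"
      unfolding G_def by linarith
    then show "\<bar>G u t - G v t\<bar> \<le> (M - l + K * Y0 / w) * r" by (simp add: algebra_simps)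
  qed blast
  define x where "x = (\<lambda>t. nu + u t)"
  have ub: "\<bar>u t\<bar> \<le> e" if "0 \<le> t" for t using u(2)[OF that] c by simp
  then have clu: "cl (u t) = u t" if "0 \<le> t" for t using that by (fastforce simp: cl_def abs_le_iff)
  have x0: "g < x t" if "0 \<le> t" for t
    using ub[OF that] c(3) g_less_nu by (simp add: x_def abs_le_iff field_simps)
  have xd: "(x has_real_derivative fX (x t) (Y u t)) (at t within {0..})" if "0 \<le> t" for t
    using u(3)[OF that] clu[OF that] unfolding x_def G_def by (auto intro!: derivative_eq_intros)
  have Yd': "(Y u has_real_derivative k * Y u t * (g - x t)) (at t within {0..})" if "0 \<le> t" for t
    using Yd[OF u(1) that] clu[OF that] by (simp add: x_def)
  have q: "(x t, Y u t) \<in> quadrant" if "0 \<le> t" for t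
    using x0[OF that] g_pos Yb[OF u(1) that] by (simp add: quadrant_def)
  have "solves_on F quadrant {0..} (\<lambda>t. (x t, Y u t))"
  proof (rule solves_onI)
    fix t :: real assume "t \<in> {0..}"
    then have t: "0 \<le> t" by simp
    have "0 < x t" using x0[OF t] g_pos by linarith
    then show "(x has_real_derivative fst (F (x t, Y u t))) (at t within {0..})"
      "(Y u has_real_derivative snd (F (x t, Y u t))) (at t within {0..})"
      using xd[OF t] Yd'[OF t] by (simp_all only: F_eq fst_conv snd_conv)
  qed (use q in auto)
  moreover have pf: "pflow 0 x (Y u)"
    unfolding pflow_def
  proof (intro allI impI conjI)
    fix t :: real assume t: "0 < t"
    have "at t within {0..} = at t" using t by (intro at_within_interior) simp
    then show "(x has_real_derivative fX (x t) (Y u t)) (at t)" "(Y u has_real_derivative k * Y u t * (g - x t)) (at t)"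
      using xd[of t] Yd'[of t] t by simp_all
  qed (use q in \<open>auto simp: quadrant_def\<close>)
  \<comment> \<open>Since \<open>x > g\<close> at time 1, the orbit does not rest at the
    equilibrium, and the dichotomy supplies convergence without any further estimate.\<close>
  have lim: "(Y u \<longlongrightarrow> 0) at_top"
    using pflow_dichotomy[OF pf] x0[of 1] by fastforce
  have "((\<lambda>t. (x t, Y u t)) \<longlongrightarrow> P_plus N p mu) at_top"
    unfolding P_plus_def by (intro tendsto_Pair pflow_x_limit[OF pf] lim)
  ultimately show ?thesis by blast
qed

end

section \<open>Orbits in the half plane and in the quadrant\<close>

lemma solves_on_restrict: "solves_on F U I c \<Longrightarrow> J \<subseteq> I \<Longrightarrow> solves_on F U J c"
  by (rule solves_on_subset) (auto simp: solves_on_def)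

lemma solves_on_mem: "solves_on F U I c \<Longrightarrow> t \<in> I \<Longrightarrow> c t \<in> U"
  by (simp add: solves_on_def)

lemma solves_on_shift_atLeast:
  assumes "solves_on F U {a..} c" shows "solves_on F U {a - b..} (\<lambda>t. c (t + b))"
proof -
  have "t \<in> (\<lambda>t. t - b) ` {a..}" if "a - b \<le> t" for t
    by (rule image_eqI[of _ _ "t + b"]) (use that in auto)
  then have "(\<lambda>t. t - b) ` {a..} = {a - b..}" by auto
  then show ?thesis using solves_on_shift[OF assms, of b] by simp
qed

lemma quadrantD: "z \<in> quadrant \<Longrightarrow> 0 < fst z" "z \<in> quadrant \<Longrightarrow> 0 < snd z"
  by (auto simp: quadrant_def)

context radial
begin

lemma half_planeD:
  assumes "solves_on F half_plane {a..} c" "a < t"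
  shows "0 < fst (c t)" "((\<lambda>t. fst (c t)) has_real_derivative fX (fst (c t)) (snd (c t))) (at t)"
    "((\<lambda>t. snd (c t)) has_real_derivative k * snd (c t) * (g - fst (c t))) (at t)"
proof -
  have t: "t \<in> {a..}" "at t within {a..} = at t"
    using assms(2) by (auto intro: at_within_interior)
  note D = solves_onD[OF assms(1) t(1), unfolded t(2)]
  show x: "0 < fst (c t)" using D(1) by (auto simp: half_plane_def)
  have "F (c t) = (fX (fst (c t)) (snd (c t)), k * snd (c t) * (g - fst (c t)))"
    using F_eq[OF x, of "snd (c t)"] by simp
  then show "((\<lambda>t. fst (c t)) has_real_derivative fX (fst (c t)) (snd (c t))) (at t)"
    "((\<lambda>t. snd (c t)) has_real_derivative k * snd (c t) * (g - fst (c t))) (at t)"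
    using D(2,3) by simp_all
qed

lemma quadrant_subset: "quadrant \<subseteq> half_plane"
  by (auto simp: quadrant_def half_plane_def)

lemma solves_on_half_plane: "solves_on F quadrant I c \<Longrightarrow> solves_on F half_plane I c"
  using quadrant_subset unfolding solves_on_def by blast

lemma solves_on_pflow:
  assumes "solves_on F quadrant {a..} c"
  shows "pflow a (\<lambda>t. fst (c t)) (\<lambda>t. snd (c t))"
  unfolding pflow_def
proof (intro allI impI conjI)
  fix t assume t: "a < t"
  then have "c t \<in> quadrant" using assms by (auto simp: solves_on_def)
  then show "0 < fst (c t)" "0 < snd (c t)" by (auto simp: quadrant_def)
qed (use half_planeD[OF solves_on_half_plane[OF assms]] in auto)

lemma pflow_solves_on:
  assumes pf: "pflow T x Y" and I: "I \<subseteq> {T<..}"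
  shows "solves_on F quadrant I (\<lambda>t. (x t, Y t))"
proof (rule solves_onI)
  fix t assume t: "t \<in> I"
  then have "T < t" using I by auto
  note D = pflowD[OF pf this]
  show "(x t, Y t) \<in> quadrant" using D by (simp add: quadrant_def)
  show "(x has_real_derivative fst (F (x t, Y t))) (at t within I)"
    "(Y has_real_derivative snd (F (x t, Y t))) (at t within I)"
    unfolding F_eq[OF D(1)] fst_conv snd_conv using D(3,4) by (auto intro: has_field_derivative_at_within)
qed

lemma solves_on_unique:
  assumes "solves_on F half_plane I c1" "solves_on F half_plane I c2" "is_interval I"
    "u \<in> I" "c1 u = c2 u" "t \<in> I"
  shows "c1 t = c2 t"
  by (rule ode_unique[where U = half_plane and I = I and F = F and ?t0.0 = u])
    (use assms F_lipschitz_near in \<open>auto simp: solves_on_def\<close>)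

lemma solves_on_shift_right:
  assumes "solves_on F U {a..} c" "0 \<le> b"
  shows "solves_on F U {a..} (\<lambda>t. c (t + b))"
  by (rule solves_on_restrict[OF solves_on_shift_atLeast[OF assms(1)]]) (use assms(2) in auto)

lemma half_plane_snd_exp:
  assumes c: "solves_on F half_plane {0..} c" and "0 \<le> t"
  obtains b where "snd (c t) = snd (c 0) * exp b"
proof (rule linear_ode_exp[OF assms(2)])
  have sub: "{0..t} \<subseteq> {0..}" by auto
  have c': "solves_on F half_plane {0..t} c"
    by (rule solves_on_subset[OF c sub]) (use c in \<open>auto simp: solves_on_def\<close>)
  have "continuous_on {0..t} c"
    using c' by (auto simp: solves_on_def continuous_on_eq_continuous_within
        intro: has_vector_derivative_continuous)
  then show "continuous_on {0..t} (\<lambda>t. k * (g - fst (c t)))" by (intro continuous_intros)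
  fix u assume u: "u \<in> {0..t}"
  have "0 < fst (c u)" using solves_onD(1)[OF c' u] by (auto simp: half_plane_def)
  then have "snd (F (c u)) = k * (g - fst (c u)) * snd (c u)"
    using F_eq[of "fst (c u)" "snd (c u)"] by simp
  then show "((\<lambda>t. snd (c t)) has_real_derivative k * (g - fst (c u)) * snd (c u)) (at u within {0..t})"
    using solves_onD(3)[OF c' u] by simp
qed

lemma half_plane_quadrant:
  assumes c: "solves_on F half_plane {0..} c" and "0 < snd (c 0)"
  shows "solves_on F quadrant {0..} c"
proof (rule solves_on_subset[OF c order_refl])
  fix t :: real assume t: "t \<in> {0..}"
  obtain b where "snd (c t) = snd (c 0) * exp b" using half_plane_snd_exp[OF c] t by auto
  then have "0 < snd (c t)" using assms(2) by simp
  moreover have "c t \<in> half_plane" using c t by (simp add: solves_on_def)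
  ultimately show "c t \<in> quadrant" by (auto simp: quadrant_def half_plane_def)
qed

section \<open>The upper branch of the stable manifold as a single orbit\<close>

abbreviation "UB \<equiv> upper_branch N p s mu q"

lemma upper_branchE:
  assumes "z \<in> UB"
  obtains c where "solves_on F quadrant {0..} c" "c 0 = z" "(c \<longlongrightarrow> P_plus N p mu) at_top"
proof -
  obtain c where c: "solves_on F half_plane {0..} c" "c 0 = z" "(c \<longlongrightarrow> P_plus N p mu) at_top"
    and "0 < snd z"
    using assms unfolding upper_branch_def W_s_def stable_manifold_def by auto
  then have "solves_on F quadrant {0..} c" by (intro half_plane_quadrant) auto
  with c(2,3) show thesis by (rule that[rotated])
qed

lemma filterlim_add_const_at_top: "filterlim (\<lambda>t. t + b) at_top (at_top :: real filter)"
  by (rule filterlim_tendsto_add_at_top[OF tendsto_const filterlim_ident, THEN filterlim_cong[THEN iffD1, rotated -1]])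
    (auto simp: add.commute)

lemma upper_branchI:
  assumes c: "solves_on F quadrant {0..} c" "(c \<longlongrightarrow> P_plus N p mu) at_top" and t: "0 \<le> t"
  shows "c t \<in> UB"
proof -
  have "solves_on F half_plane {0..} (\<lambda>u. c (u + t))"
    by (rule solves_on_shift_right[OF solves_on_half_plane[OF c(1)] t])
  moreover have "((\<lambda>u. c (u + t)) \<longlongrightarrow> P_plus N p mu) at_top"
    by (rule filterlim_compose[OF c(2) filterlim_add_const_at_top])
  ultimately have "c t \<in> W_s N p s mu q"
    unfolding W_s_def stable_manifold_def by (intro CollectI exI[of _ "\<lambda>u. c (u + t)"]) simp
  moreover have "0 < snd (c t)" using quadrantD(2)[OF solves_on_mem[OF c(1)]] t by simp
  ultimately show ?thesis by (auto simp: upper_branch_def)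
qed

lemma upper_branch_quadrant: "UB \<subseteq> quadrant"
proof
  fix z assume "z \<in> UB"
  then obtain c where "solves_on F quadrant {0..} c" "c 0 = z" using upper_branchE by blast
  then show "z \<in> quadrant" by (auto simp: solves_on_def)
qed

lemma upper_branch_nonempty: "UB \<noteq> {}"
  using stable_orbit_exists upper_branchI[of _ 0] by blast

lemma tendsto_P_plus:
  assumes "(c \<longlongrightarrow> P_plus N p mu) at_top"
  shows "((\<lambda>t. fst (c t)) \<longlongrightarrow> nu) at_top" "((\<lambda>t. snd (c t)) \<longlongrightarrow> 0) at_top"
  using tendsto_fst[OF assms] tendsto_snd[OF assms] by (auto simp: P_plus_def)

text \<open>The condition \<open>0 < T\<close> provides two-sided derivatives at \<open>T\<close>,
  as \<open>near_saddle\<close> demands; at 0 an orbit on \<open>{0..}\<close> has only one-sided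
  ones.\<close>

definition stable_near :: "real \<Rightarrow> real \<Rightarrow> (real \<Rightarrow> real \<times> real) \<Rightarrow> bool" where
  "stable_near e T c \<longleftrightarrow> 0 < T \<and> solves_on F half_plane {0..} c \<and> (c \<longlongrightarrow> P_plus N p mu) at_top \<and>
     (\<forall>t\<ge>T. \<bar>fst (c t) - nu\<bar> < e \<and> \<bar>snd (c t)\<bar> < e)"

text \<open>The system is autonomous, so translating both orbits to initial time 0 reduces different
  times \<open>t1\<close> and \<open>t2\<close> to \<open>stable_fibre_unique\<close>.\<close>

lemma stable_orbits_meet:
  "\<exists>e>0. \<forall>c1 c2 t1 t2. stable_near e t1 c1 \<longrightarrow> stable_near e t2 c2 \<longrightarrow>
     snd (c1 t1) = snd (c2 t2) \<longrightarrow> c1 t1 = c2 t2"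
proof -
  obtain e where e: "0 < e" and uniq: "\<And>x1 Y1 x2 Y2 T. near_saddle e T x1 Y1 \<Longrightarrow> near_saddle e T x2 Y2 \<Longrightarrow>
     (x1 \<longlongrightarrow> nu) at_top \<Longrightarrow> (x2 \<longlongrightarrow> nu) at_top \<Longrightarrow> Y1 T = Y2 T \<Longrightarrow> x1 T = x2 T"
    using stable_fibre_unique by blast
  have near: "near_saddle e 0 (\<lambda>t. fst (c (t + b))) (\<lambda>t. snd (c (t + b)))"
      "((\<lambda>t. fst (c (t + b))) \<longlongrightarrow> nu) at_top" if c: "stable_near e b c" for b c
  proof -
    have "((\<lambda>t. fst (c (t + b))) has_real_derivative fX (fst (c (t + b))) (snd (c (t + b)))) (at t) \<and>
       ((\<lambda>t. snd (c (t + b))) has_real_derivative k * snd (c (t + b)) * (g - fst (c (t + b)))) (at t)"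
      if "0 \<le> t" for t
      using half_planeD(2,3)[of 0 c "t + b"] c that by (simp add: DERIV_shift stable_near_def)
    then show "near_saddle e 0 (\<lambda>t. fst (c (t + b))) (\<lambda>t. snd (c (t + b)))"
      using c by (simp add: near_saddle_def stable_near_def)
    show "((\<lambda>t. fst (c (t + b))) \<longlongrightarrow> nu) at_top"
      using c by (intro filterlim_compose[OF tendsto_P_plus(1) filterlim_add_const_at_top]) (simp add: stable_near_def)
  qed
  have "c1 t1 = c2 t2" if "stable_near e t1 c1" "stable_near e t2 c2" "snd (c1 t1) = snd (c2 t2)" for c1 c2 t1 t2
    using uniq[OF near(1)[OF that(1)] near(1)[OF that(2)] near(2)[OF that(1)] near(2)[OF that(2)]] that(3)
    by (simp add: prod_eq_iff)
  then show ?thesis using e by blast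
qed

lemma stable_nearI:
  assumes "solves_on F half_plane {0..} c" "(c \<longlongrightarrow> P_plus N p mu) at_top" "0 < e"
  obtains T where "stable_near e T c"
proof -
  have "eventually (\<lambda>t. dist (fst (c t)) nu < e \<and> dist (snd (c t)) 0 < e \<and> 0 < t) at_top"
    using tendstoD[OF tendsto_P_plus(1)[OF assms(2)] assms(3)] tendstoD[OF tendsto_P_plus(2)[OF assms(2)] assms(3)]
      eventually_gt_at_top[of "0 :: real"] by eventually_elim blast
  then obtain T where "\<And>t. T \<le> t \<Longrightarrow> dist (fst (c t)) nu < e \<and> dist (snd (c t)) 0 < e \<and> 0 < t"
    by (auto simp: eventually_at_top_linorder)
  then show thesis using assms by (intro that[of T]) (auto simp: dist_real_def stable_near_def)
qed

lemma stable_near_mono: "stable_near e T c \<Longrightarrow> T \<le> S \<Longrightarrow> stable_near e S c"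
  by (auto simp: stable_near_def)

text \<open>Along both orbits \<open>Y\<close> is positive and tends to 0, so each attains the
  smaller of the two values of \<open>Y\<close> at entry into the neighbourhood of the saddle; equal
  \<open>Y\<close> there means equal points.\<close>

lemma upper_orbits_meet:
  assumes c: "solves_on F quadrant {0..} c1" "solves_on F quadrant {0..} c2"
      "(c1 \<longlongrightarrow> P_plus N p mu) at_top" "(c2 \<longlongrightarrow> P_plus N p mu) at_top"
  obtains t1 t2 where "0 < t1" "0 < t2" "c1 t1 = c2 t2"
proof -
  obtain e where e: "0 < e" and meet: "\<And>c1 c2 t1 t2. stable_near e t1 c1 \<Longrightarrow> stable_near e t2 c2 \<Longrightarrow>
     snd (c1 t1) = snd (c2 t2) \<Longrightarrow> c1 t1 = c2 t2"
    using stable_orbits_meet by blast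
  obtain S1 S2 where S: "stable_near e S1 c1" "stable_near e S2 c2"
    using stable_nearI[OF solves_on_half_plane[OF c(1)] c(3) e] stable_nearI[OF solves_on_half_plane[OF c(2)] c(4) e]
    by metis
  then have T1: "0 < S1" and T2: "0 < S2" by (auto simp: stable_near_def)
  define y where "y = min (snd (c1 S1)) (snd (c2 S2))"
  have "0 < y" using quadrantD(2)[OF solves_on_mem[OF c(1)]] quadrantD(2)[OF solves_on_mem[OF c(2)]] T1 T2
    by (simp add: y_def)
  have hit: "\<exists>t\<ge>T. snd (d t) = y"
    if d: "solves_on F quadrant {0..} d" "(d \<longlongrightarrow> P_plus N p mu) at_top" and T: "0 < T" "y \<le> snd (d T)"
    for d :: "real \<Rightarrow> real \<times> real" and T
  proof -
    have "eventually (\<lambda>t. snd (d t) < y \<and> T \<le> t) at_top"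
      using tendsto_P_plus(2)[OF d(2)] \<open>0 < y\<close> by (intro eventually_conj order_tendstoD eventually_ge_at_top) auto
    then obtain S where S: "snd (d S) < y" "T \<le> S"
      using eventually_happens trivial_limit_at_top_linorder by blast
    have "continuous_on {T..S} (\<lambda>t. snd (d t))"
      using T(1)
      by (intro continuous_at_imp_continuous_on ballI DERIV_isCont[OF half_planeD(3)[OF solves_on_half_plane[OF d(1)]]]) auto
    then show ?thesis using IVT2'[of "\<lambda>t. snd (d t)" S y T] S T(2) by auto
  qed
  obtain t1 where t1: "S1 \<le> t1" "snd (c1 t1) = y" using hit[OF c(1,3) T1] by (auto simp: y_def)
  obtain t2 where t2: "S2 \<le> t2" "snd (c2 t2) = y" using hit[OF c(2,4) T2] by (auto simp: y_def)
  have "c1 t1 = c2 t2"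
    by (rule meet) (use stable_near_mono[OF S(1)] stable_near_mono[OF S(2)] t1 t2 in auto)
  then show thesis using that T1 T2 t1 t2 by (meson less_le_trans)
qed

text \<open>An orbit in the axis is compared with the constant orbit at the saddle: both have
  \<open>Y = 0\<close>, so they meet near the saddle, and uniqueness carries the equality back to
  time 0. Hence, apart from the saddle, the stable manifold avoids the axis.\<close>

lemma W_s_axis:
  assumes "z \<in> W_s N p s mu q" "snd z = 0"
  shows "z = P_plus N p mu"
proof -
  obtain c where c: "solves_on F half_plane {0..} c" "c 0 = z" "(c \<longlongrightarrow> P_plus N p mu) at_top"
    using assms(1) unfolding W_s_def stable_manifold_def by auto
  have FP: "F (P_plus N p mu) = 0" by (simp add: P_plus_def vec_field_def h_nu zero_prod_def)
  have const: "solves_on F half_plane {0..} (\<lambda>_. P_plus N p mu)"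
    unfolding solves_on_def FP using nu_pos by (auto simp: half_plane_def P_plus_def)
  obtain e where e: "0 < e" and meet: "\<And>c1 c2 t1 t2. stable_near e t1 c1 \<Longrightarrow> stable_near e t2 c2 \<Longrightarrow>
     snd (c1 t1) = snd (c2 t2) \<Longrightarrow> c1 t1 = c2 t2"
    using stable_orbits_meet by blast
  obtain T where S: "stable_near e T c" using stable_nearI[OF c(1,3) e] .
  then have T: "0 < T" by (simp add: stable_near_def)
  have S': "stable_near e T (\<lambda>_. P_plus N p mu)"
    using const e T by (simp add: stable_near_def P_plus_def)
  obtain b where "snd (c T) = snd (c 0) * exp b" using half_plane_snd_exp[OF c(1)] T by (meson less_imp_le)
  then have "snd (c T) = 0" using assms(2) c(2) by simp
  then have "c T = P_plus N p mu"
    using meet[OF S S'] by (simp add: P_plus_def)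
  with T have "c 0 = P_plus N p mu"
    using solves_on_unique[OF c(1) const is_interval_ci, of T 0] by simp
  then show ?thesis using c(2) by simp
qed

lemma upper_branch_extend:
  assumes "z \<in> UB"
  obtains a c where "a < 0" "solves_on F quadrant {a..} c" "c 0 = z" "(c \<longlongrightarrow> P_plus N p mu) at_top"
proof -
  obtain c where c: "solves_on F quadrant {0..} c" "c 0 = z" "(c \<longlongrightarrow> P_plus N p mu) at_top"
    using upper_branchE[OF assms] by blast
  have "lipschitz_near F (c 0)"
    using assms c(2) upper_branch_quadrant quadrant_subset by (intro F_lipschitz_near) blast
  then obtain a c' where c': "a < 0" "solves_on F quadrant {a..} c'" "\<And>t. 0 \<le> t \<Longrightarrow> c' t = c t"
    using solves_on_extend_backward[OF c(1) open_quadrant] by metis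
  have "eventually (\<lambda>t. c t = c' t) at_top"
    using c'(3) by (intro eventually_mono[OF eventually_ge_at_top[of 0]]) simp
  then have "(c' \<longlongrightarrow> P_plus N p mu) at_top" using c(3) by (rule Lim_transform_eventually[rotated])
  then show thesis using that c'(1,2) c'(3)[of 0] c(2) by simp
qed

text \<open>The orbits of \<open>z\<close> and \<open>w\<close> meet after times \<open>t1\<close>
  and \<open>t2\<close>. By uniqueness backwards in time the point that needs longer lies before the
  other on one orbit, which gives the two cases.\<close>

lemma upper_branch_subset_orbit:
  assumes z: "z \<in> UB" and w: "w \<in> UB"
  shows "w \<in> orbit_through F quadrant z"
proof -
  obtain a1 c1 where c1: "a1 < 0" "solves_on F quadrant {a1..} c1" "c1 0 = z" "(c1 \<longlongrightarrow> P_plus N p mu) at_top"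
    using upper_branch_extend[OF z] by blast
  obtain a2 c2 where c2: "a2 < 0" "solves_on F quadrant {a2..} c2" "c2 0 = w" "(c2 \<longlongrightarrow> P_plus N p mu) at_top"
    using upper_branch_extend[OF w] by blast
  have c0: "solves_on F quadrant {0..} c1" "solves_on F quadrant {0..} c2"
    using c1(1) c2(1) by (auto intro!: solves_on_restrict[OF c1(2)] solves_on_restrict[OF c2(2)])
  obtain t1 t2 where t: "0 < t1" "0 < t2" "c1 t1 = c2 t2"
    using upper_orbits_meet[OF c0 c1(4) c2(4)] by blast
  have later: "d2 0 = d1 (s1 - s2)"
    if d: "solves_on F quadrant {0..} d1" "solves_on F quadrant {0..} d2" and s: "s2 \<le> s1" "0 < s2" "d1 s1 = d2 s2"
    for d1 d2 :: "real \<Rightarrow> real \<times> real" and s1 s2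
  proof -
    have "solves_on F quadrant {0..} (\<lambda>t. d1 (t + (s1 - s2)))"
      using solves_on_shift_right[OF d(1)] s(1) by simp
    from solves_on_unique[OF solves_on_half_plane[OF this] solves_on_half_plane[OF d(2)] is_interval_ci, of s2 0]
    show ?thesis using s by simp
  qed
  show ?thesis
  proof (cases "t2 \<le> t1")
    case True
    have "w = c1 (t1 - t2)" using later[OF c0 True t(2,3)] c2(3) by simp
    moreover have "solves_on F quadrant {a1<..<t1 + 1} c1"
      by (rule solves_on_restrict[OF c1(2)]) auto
    ultimately show ?thesis
      unfolding orbit_through_def using c1(1,3) t True
      by (intro CollectI exI[of _ a1] exI[of _ "t1 + 1"] exI[of _ c1]) auto
  next
    case False
    define b where "b = t2 - t1"
    have b: "0 < b" using False by (simp add: b_def)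
    have zb: "z = c2 b" using later[OF c0(2,1), of t1 t2] t False c1(3) by (simp add: b_def)
    have "solves_on F quadrant {a2 - b..} (\<lambda>t. c2 (t + b))"
      by (rule solves_on_shift_atLeast[OF c2(2)])
    then have "solves_on F quadrant {a2 - b<..<1} (\<lambda>t. c2 (t + b))"
      by (rule solves_on_restrict) auto
    moreover have "w = (\<lambda>t. c2 (t + b)) (- b)" using c2(3) by simp
    then have "w \<in> (\<lambda>t. c2 (t + b)) ` {a2 - b<..<1}"
      by (rule image_eqI) (use c2(1) b in auto)
    ultimately show ?thesis
      unfolding orbit_through_def using c2(1) b zb
      by (intro CollectI exI[of _ "a2 - b"] exI[of _ 1] exI[of _ "\<lambda>t. c2 (t + b)"]) auto
  qed
qed

text \<open>For negative \<open>t\<close> the piece of the orbit from \<open>t\<close> to 0 is glued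
  to the half-orbit of \<open>z\<close> converging to the saddle.\<close>

lemma orbit_subset_upper_branch:
  assumes z: "z \<in> UB" and c: "solves_on F quadrant {a<..<b} c" "a < 0" "0 < b" "c 0 = z" and t: "t \<in> {a<..<b}"
  shows "c t \<in> UB"
proof -
  obtain d where d: "solves_on F quadrant {0..} d" "d 0 = z" "(d \<longlongrightarrow> P_plus N p mu) at_top"
    using upper_branchE[OF z] by blast
  show ?thesis
  proof (cases "0 \<le> t")
    case True
    have "solves_on F quadrant {0..t} c" "solves_on F quadrant {0..t} d"
      using c(2) t by (auto intro!: solves_on_restrict[OF c(1)] solves_on_restrict[OF d(1)])
    from solves_on_unique[OF this[THEN solves_on_half_plane] is_interval_cc, of 0 t]
    have "c t = d t" using True c(4) d(2) by simp
    then show ?thesis using upper_branchI[OF d(1,3) True] by simp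
  next
    case False
    have "solves_on F quadrant {t..0} c"
      using c(3) t by (auto intro!: solves_on_restrict[OF c(1)])
    from solves_on_glue[OF this d(1)] c(4) d(2) False
    have glued: "solves_on F quadrant {t..} (\<lambda>u. if u \<in> {t..0} then c u else d u)" (is "solves_on _ _ _ ?e") by simp
    have "solves_on F quadrant {0..} (\<lambda>u. ?e (u + t))"
      using solves_on_shift_atLeast[OF glued, of t] by simp
    moreover have "((\<lambda>u. ?e (u + t)) \<longlongrightarrow> P_plus N p mu) at_top"
    proof (rule filterlim_compose[OF _ filterlim_add_const_at_top])
      have "eventually (\<lambda>u. d u = ?e u) at_top"
        by (intro eventually_mono[OF eventually_gt_at_top[of 0]]) auto
      then show "(?e \<longlongrightarrow> P_plus N p mu) at_top" using d(3) by (rule Lim_transform_eventually[rotated])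
    qed
    ultimately have "?e (0 + t) \<in> UB" by (rule upper_branchI) simp
    then show ?thesis using False by simp
  qed
qed

lemma upper_branch_eq_orbit:
  assumes "z \<in> UB" shows "UB = orbit_through F quadrant z"
  using upper_branch_subset_orbit[OF assms] orbit_subset_upper_branch[OF assms]
  by (auto simp: orbit_through_def)

lemma connected_upper_branch: "connected UB"
proof -
  obtain z where z: "z \<in> UB" using upper_branch_nonempty by blast
  have "connected_component UB z w" if w: "w \<in> UB" for w
  proof -
    from upper_branch_subset_orbit[OF z w] obtain a b c where c: "a < 0" "0 < b"
      "solves_on F quadrant {a<..<b} c" "c 0 = z" "w \<in> c ` {a<..<b}"
      unfolding orbit_through_def by blast
    have "continuous_on {a<..<b} c"
      using c(3) by (auto simp: solves_on_def continuous_on_eq_continuous_within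
        intro: has_vector_derivative_continuous)
    then have "connected (c ` {a<..<b})" by (intro connected_continuous_image) auto
    moreover have "c ` {a<..<b} \<subseteq> UB" using orbit_subset_upper_branch[OF z c(3,1,2,4)] by blast
    moreover have "z \<in> c ` {a<..<b}" using c by force
    ultimately show ?thesis unfolding connected_component_def using c(5) by blast
  qed
  then show ?thesis
    unfolding connected_iff_connected_component by (meson connected_component_sym connected_component_trans)
qed

text \<open>A larger connected subset has an interval as its projection to the \<open>Y\<close>
  axis. This interval contains positive values and omits 0 by \<open>W_s_axis\<close>, so it is
  positive and the subset lies in the upper branch.\<close>

lemma upper_branch_component: "UB \<in> components (W_s N p s mu q - {P_plus N p mu})"
  unfolding in_components_maximal
proof (intro conjI allI impI)
  show "UB \<noteq> {}" by (rule upper_branch_nonempty)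
  show "UB \<subseteq> W_s N p s mu q - {P_plus N p mu}" by (auto simp: upper_branch_def P_plus_def)
  show "connected UB" by (rule connected_upper_branch)
  fix d assume d: "d \<noteq> {} \<and> UB \<subseteq> d \<and> d \<subseteq> W_s N p s mu q - {P_plus N p mu} \<and> connected d"
  have "connected (snd ` d)" using d by (intro connected_continuous_image continuous_intros) auto
  then have ivl: "is_interval (snd ` d)" by (simp add: is_interval_connected_1)
  obtain z where z: "z \<in> UB" using upper_branch_nonempty by blast
  then have "0 < snd z" "snd z \<in> snd ` d" using d by (auto simp: upper_branch_def)
  moreover have "0 \<notin> snd ` d" using d W_s_axis by force
  ultimately have "0 < y" if "y \<in> snd ` d" for y
    using ivl that unfolding is_interval_1 by (metis less_imp_le not_less)
  then have "d \<subseteq> UB" using d by (force simp: upper_branch_def)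
  then show "d = UB" using d by blast
qed

end

section \<open>Backward uniqueness\<close>

lemma is_solution_mono:
  assumes "is_solution N p s mu q R0 v" "R0 \<le> R1"
  shows "is_solution N p s mu q R1 v"
proof -
  have "{R1<..} \<subseteq> {R0<..}" using assms(2) by auto
  then show ?thesis
    using assms unfolding is_solution_def by (auto intro: continuous_on_subset)
qed

text \<open>The mean value theorem on the scale \<open>S\<close>: for arguments comparable to
  \<open>S\<close> the power has Lipschitz constant of order \<open>S powr (th - 1)\<close>. The sum
  of the two constants covers both signs of \<open>th - 1\<close>.\<close>

lemma powr_diff_bound:
  fixes a b c1 c2 S th :: real
  assumes "0 < S" "0 < c1" "c1 * S \<le> a" "a \<le> c2 * S" "c1 * S \<le> b" "b \<le> c2 * S" "0 < th"
  shows "\<bar>a powr th - b powr th\<bar> \<le> th * (c1 powr (th - 1) + c2 powr (th - 1)) * S powr (th - 1) * \<bar>a - b\<bar>"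
proof -
  have pos: "0 < c1 * S" using assms by simp
  have *: "\<bar>b powr th - a powr th\<bar> \<le> th * (c1 powr (th - 1) + c2 powr (th - 1)) * S powr (th - 1) * (b - a)"
    if ab: "a < b" "c1 * S \<le> a" "b \<le> c2 * S" for a b
  proof -
    have "\<exists>z>a. z < b \<and> b powr th - a powr th = (b - a) * (th * z powr (th - 1))"
      using ab pos by (intro MVT2 has_real_derivative_powr) auto
    then obtain z where z: "a < z" "z < b" "b powr th - a powr th = (b - a) * (th * z powr (th - 1))" by blast
    have zS: "c1 \<le> z / S" "z / S \<le> c2" using z ab assms(1) by (auto simp: field_simps)
    have "(z / S) powr (th - 1) \<le> c1 powr (th - 1) + c2 powr (th - 1)"
    proof (cases "1 \<le> th")
      case True
      then have "(z / S) powr (th - 1) \<le> c2 powr (th - 1)" using zS assms(2) by (intro powr_mono2) auto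
      then show ?thesis by (simp add: add_increasing)
    next
      case False
      then have "(z / S) powr (th - 1) \<le> c1 powr (th - 1)" using zS assms(2) by (intro powr_mono2') auto
      then show ?thesis by (simp add: add_increasing2)
    qed
    then have "(z / S) powr (th - 1) * S powr (th - 1) \<le> (c1 powr (th - 1) + c2 powr (th - 1)) * S powr (th - 1)"
      by (intro mult_right_mono) auto
    moreover have "(z / S) powr (th - 1) * S powr (th - 1) = z powr (th - 1)"
      using assms(1) by (simp add: powr_divide)
    ultimately have "(b - a) * (th * z powr (th - 1)) \<le>
        (b - a) * (th * ((c1 powr (th - 1) + c2 powr (th - 1)) * S powr (th - 1)))"
      using ab assms(7) by (intro mult_left_mono) auto
    moreover have "0 \<le> b powr th - a powr th" unfolding z(3) using ab assms(7) by simp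
    ultimately show ?thesis using z(3) by (simp add: mult_ac)
  qed
  consider "a < b" | "b < a" | "a = b" by linarith
  then show ?thesis
    using *[of a b] *[of b a] assms by cases (auto simp: abs_minus_commute)
qed

text \<open>Inversion of the flux; \<open>\<eta>\<close> is its common sign with
  \<open>v'\<close>.\<close>

lemma deriv_from_flux:
  assumes "1 < p" "0 < r" "\<eta> = 1 \<or> \<eta> = - 1" "0 < \<eta> * flux N p v r"
  shows "deriv v r = \<eta> * ((\<eta> * flux N p v r) powr (1 / (p - 1)) * r powr ((1 - N) / (p - 1)))"
proof -
  define D where "D = deriv v r"
  have "0 < \<eta> * D"
    using assms(2-4) by (auto simp: flux_def D_def zero_less_mult_iff mult_less_0_iff)
  then have aD: "\<bar>D\<bar> = \<eta> * D" using assms(3) by auto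
  have "\<eta> * flux N p v r = r powr (N - 1) * (\<bar>D\<bar> powr (p - 2) * \<bar>D\<bar>)"
    unfolding flux_def D_def[symmetric] aD by simp
  also have "\<bar>D\<bar> powr (p - 2) * \<bar>D\<bar> = \<bar>D\<bar> powr (p - 1)"
    using \<open>0 < \<eta> * D\<close> powr_add[of "\<bar>D\<bar>" "p - 2" 1] aD by simp
  finally have "(\<eta> * flux N p v r) powr (1 / (p - 1)) = r powr ((N - 1) / (p - 1)) * \<bar>D\<bar>"
    using assms(1,2) by (simp add: powr_mult powr_powr)
  moreover have "(N - 1) / (p - 1) + (1 - N) / (p - 1) = 0" by (simp add: add_divide_distrib[symmetric])
  then have "r powr ((N - 1) / (p - 1)) * r powr ((1 - N) / (p - 1)) = 1"
    using assms(2) by (simp flip: powr_add)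
  ultimately have "(\<eta> * flux N p v r) powr (1 / (p - 1)) * r powr ((1 - N) / (p - 1)) = \<bar>D\<bar>"
    by (simp add: mult_ac)
  then show ?thesis unfolding D_def[symmetric] aD using assms(3) by auto
qed

context radial
begin

definition rhs :: "real \<Rightarrow> real \<Rightarrow> real" where
  "rhs r a = mu * r powr (N - 1 - p) * a powr (p - 1) + r powr (N - 1 + s) * a powr q"

definition rhs' :: "real \<Rightarrow> real \<Rightarrow> real" where
  "rhs' r a = mu * r powr (N - 1 - p) * ((p - 1) * a powr (p - 1 - 1)) + r powr (N - 1 + s) * (q * a powr (q - 1))"

text \<open>The positive lower bound \<open>c1\<close> is the point: it makes the flux leave 0 at a
  linear rate.\<close>

lemma rhs_bounds:
  assumes "0 < b1" "0 < a1" "b1 \<le> b2" "a1 \<le> a2"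
  obtains c1 c2 C where "0 < c1" "0 \<le> C"
    "\<And>r a. r \<in> {b1..b2} \<Longrightarrow> a \<in> {a1..a2} \<Longrightarrow> c1 \<le> rhs r a \<and> rhs r a \<le> c2"
    "\<And>r a a'. r \<in> {b1..b2} \<Longrightarrow> a \<in> {a1..a2} \<Longrightarrow> a' \<in> {a1..a2} \<Longrightarrow> \<bar>rhs r a - rhs r a'\<bar> \<le> C * \<bar>a - a'\<bar>"
proof -
  define S where "S = {b1..b2} \<times> {a1..a2}"
  have S: "compact S" "S \<noteq> {}" using assms by (auto simp: S_def intro: compact_Times)
  have nz: "fst z \<noteq> 0" "snd z \<noteq> 0" if "z \<in> S" for z using that assms by (auto simp: S_def)
  have c: "continuous_on S (\<lambda>z. rhs (fst z) (snd z))" "continuous_on S (\<lambda>z. rhs' (fst z) (snd z))"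
    unfolding rhs_def rhs'_def using nz by (intro continuous_intros ballI; blast)+
  obtain z where z: "z \<in> S" "\<And>w. w \<in> S \<Longrightarrow> rhs (fst z) (snd z) \<le> rhs (fst w) (snd w)"
    using continuous_attains_inf[OF S c(1)] by blast
  obtain y where y: "\<And>w. w \<in> S \<Longrightarrow> rhs (fst w) (snd w) \<le> rhs (fst y) (snd y)"
    using continuous_attains_sup[OF S c(1)] by blast
  have "bounded ((\<lambda>z. rhs' (fst z) (snd z)) ` S)"
    by (intro compact_imp_bounded compact_continuous_image c S)
  then obtain C where C0: "0 < C" "\<forall>y\<in>(\<lambda>z. rhs' (fst z) (snd z)) ` S. norm y \<le> C"
    unfolding bounded_pos by blast
  then have C: "0 < C" "\<And>w. w \<in> S \<Longrightarrow> \<bar>rhs' (fst w) (snd w)\<bar> \<le> C" by auto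
  show thesis
  proof (rule that[of "rhs (fst z) (snd z)" C "rhs (fst y) (snd y)"])
    have "0 < fst z" "0 < snd z" using z(1) assms by (auto simp: S_def)
    then show "0 < rhs (fst z) (snd z)"
      unfolding rhs_def using mu_pos by (intro add_pos_nonneg mult_pos_pos) auto
    show "0 \<le> C" using C by simp
    fix r a assume ra: "r \<in> {b1..b2}" "a \<in> {a1..a2}"
    then have "(r, a) \<in> S" by (simp add: S_def)
    then show "rhs (fst z) (snd z) \<le> rhs r a \<and> rhs r a \<le> rhs (fst y) (snd y)"
      using z(2)[of "(r, a)"] y[of "(r, a)"] by simp
    fix a' assume a': "a' \<in> {a1..a2}"
    have "norm (rhs r a - rhs r a') \<le> C * norm (a - a')"
    proof (rule field_differentiable_bound[of "{a1..a2}" "rhs r" "rhs' r"])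
      fix u assume u: "u \<in> {a1..a2}"
      then have "0 < u" using assms by simp
      then have "(rhs r has_real_derivative rhs' r u) (at u)"
        unfolding rhs_def rhs'_def by (intro DERIV_add DERIV_cmult has_real_derivative_powr)
      then show "(rhs r has_real_derivative rhs' r u) (at u within {a1..a2})"
        by (rule has_field_derivative_at_within)
      show "norm (rhs' r u) \<le> C" using C(2)[of "(r, u)"] ra(1) u by (simp add: S_def)
    qed (use ra a' in auto)
    then show "\<bar>rhs r a - rhs r a'\<bar> \<le> C * \<bar>a - a'\<bar>" by simp
  qed
qed

context
  fixes R0 v w
  assumes R0: "0 < R0" and sv: "is_solution N p s mu q R0 v" and sw: "is_solution N p s mu q R0 w"
begin

text \<open>Where \<open>v' = 0\<close> the equation is degenerate or singular. There the fluxes of both solutions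
  are comparable to \<open>S = b - r\<close>, so that the loss \<open>S powr (1 / (p - 1) - 1)\<close> incurred in passing
  from the fluxes to the derivatives is compensated by the smallness \<open>O(S)\<close> of the difference
  of the fluxes; where \<open>v' \<noteq> 0\<close> one takes \<open>S = 1\<close>.\<close>

lemma sol_unique_step:
  assumes b: "R0 < b" "v b = w b" "deriv v b = deriv w b"
  shows "\<exists>d>0. \<forall>r\<in>{b - d..b}. v r = w r"
proof -
  define th where "th = 1 / (p - 1)"
  have th: "0 < th" using p1 by (simp add: th_def)
  define a where "a = v b"
  have a: "0 < a" using is_solutionD(1)[OF sv b(1)] by (simp add: a_def)
  have b0: "0 < b" using R0 b by simp
  obtain c1 c2 C where c: "0 < c1" "0 \<le> C"
    "\<And>r u. r \<in> {b / 2..b} \<Longrightarrow> u \<in> {a / 2..2 * a} \<Longrightarrow> c1 \<le> rhs r u \<and> rhs r u \<le> c2"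
    "\<And>r u u'. r \<in> {b / 2..b} \<Longrightarrow> u \<in> {a / 2..2 * a} \<Longrightarrow> u' \<in> {a / 2..2 * a} \<Longrightarrow>
       \<bar>rhs r u - rhs r u'\<bar> \<le> C * \<bar>u - u'\<bar>"
    by (rule rhs_bounds[of "b / 2" "a / 2" b "2 * a"]) (use a b0 in auto)
  note fD = is_solutionD(3)[OF sv, folded rhs_def] is_solutionD(3)[OF sw, folded rhs_def]
  let ?f = "flux N p v" and ?g = "flux N p w"
  have cont: "isCont v b" "isCont w b" "isCont ?f b" "isCont ?g b"
    using is_solutionD(2,3)[OF sv b(1)] is_solutionD(2,3)[OF sw b(1)] by (auto intro: DERIV_isCont)
  have nb: "eventually (\<lambda>r. a / 2 < v r \<and> v r < 2 * a \<and> a / 2 < w r \<and> w r < 2 * a) (at b)"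
    using cont(1,2) a b(2) unfolding isCont_def a_def
    by (intro eventually_conj order_tendstoD) auto
  have fb: "?f b = ?g b" using b(3) by (simp add: flux_def)
  \<comment> \<open>A common form for both cases. The condition
    \<open>S r powr (th - 1) * (b - r) <= 1\<close> is what converts a flux difference of order
    \<open>b - r\<close> into a derivative difference bounded by \<open>K * M\<close>.\<close>
  define P where "P = (\<lambda>k1 k2 S \<eta> r. R0 < r \<and> b / 2 < r \<and> a / 2 < v r \<and> v r < 2 * a \<and> a / 2 < w r \<and> w r < 2 * a \<and>
       0 < S r \<and> S r powr (th - 1) * (b - r) \<le> 1 \<and> k1 * S r \<le> \<eta> * ?f r \<and> \<eta> * ?f r \<le> k2 * S r \<and>
       k1 * S r \<le> \<eta> * ?g r \<and> \<eta> * ?g r \<le> k2 * S r)"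
  have "\<exists>d0 k1 k2 S \<eta>. 0 < d0 \<and> 0 < k1 \<and> (\<eta> = 1 \<or> \<eta> = - 1) \<and>
     (\<forall>r. b - d0 < r \<and> r < b \<longrightarrow> P k1 k2 S \<eta> r)"
  proof (cases "?f b = 0")
    case True
    from nb obtain d where d: "0 < d" "\<And>r. r \<noteq> b \<Longrightarrow> dist r b < d \<Longrightarrow> a / 2 < v r \<and> v r < 2 * a \<and> a / 2 < w r \<and> w r < 2 * a"
      unfolding eventually_at by blast
    define d0 where "d0 = min (min d 1) (min (b / 2) (b - R0))"
    have d0: "0 < d0" "d0 \<le> d" "d0 \<le> 1" "d0 \<le> b / 2" "d0 \<le> b - R0" using d(1) b b0 unfolding d0_def by linarith+
    have vw: "a / 2 \<le> v r \<and> v r \<le> 2 * a \<and> a / 2 \<le> w r \<and> w r \<le> 2 * a" if "b - d0 < r" "r \<le> b" for r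
      using d(2)[of r] that d0 a b(2) by (cases "r = b") (auto simp: dist_real_def a_def)
    \<comment> \<open>A flux that vanishes at \<open>b\<close> with slope between
      \<open>- c2\<close> and \<open>- c1\<close> is comparable to \<open>b - r\<close> to the left
      of \<open>b\<close>.\<close>
    have fl: "c1 * (b - r) \<le> flux N p z r \<and> flux N p z r \<le> c2 * (b - r)"
      if r: "b - d0 < r" "r < b" and z: "flux N p z b = 0"
        "\<And>u. r \<le> u \<Longrightarrow> u \<le> b \<Longrightarrow> (flux N p z has_real_derivative - rhs u (z u)) (at u) \<and> a / 2 \<le> z u \<and> z u \<le> 2 * a"
      for r z
    proof -
      have bd: "- c2 \<le> - rhs u (z u)" "- rhs u (z u) \<le> - c1" if "r \<le> u" "u \<le> b" for u
        using c(3)[of u "z u"] z(2)[OF that] that r d0 by auto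
      have "flux N p z r + (- c2) * (b - r) \<le> flux N p z b" "flux N p z b \<le> flux N p z r + (- c1) * (b - r)"
        by (rule DERIV_ge_imp_growth[where f' = "\<lambda>u. - rhs u (z u)"] DERIV_le_imp_growth[where f' = "\<lambda>u. - rhs u (z u)"];
            use r z(2) bd in auto)+
      then show ?thesis using z(1) by simp
    qed
    have "P c1 c2 (\<lambda>r. b - r) 1 r" if r: "b - d0 < r" "r < b" for r
    proof -
      have "R0 < r" "b / 2 < r" using r d0 by auto
      moreover have "(b - r) powr (th - 1) * (b - r) \<le> 1"
      proof -
        have "(b - r) powr (th - 1) * (b - r) = (b - r) powr th"
          using r powr_add[of "b - r" "th - 1" 1] by simp
        also have "\<dots> \<le> 1 powr th" using r d0 th by (intro powr_mono2) auto
        finally show ?thesis by simp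
      qed
      moreover have "c1 * (b - r) \<le> ?f r \<and> ?f r \<le> c2 * (b - r)"
        using True fD(1) vw r \<open>R0 < r\<close> by (intro fl) auto
      moreover have "c1 * (b - r) \<le> ?g r \<and> ?g r \<le> c2 * (b - r)"
        using True fb fD(2) vw r \<open>R0 < r\<close> by (intro fl) auto
      moreover have "a / 2 < v r \<and> v r < 2 * a \<and> a / 2 < w r \<and> w r < 2 * a"
        using d(2)[of r] r d0 by (auto simp: dist_real_def)
      ultimately show ?thesis using r unfolding P_def by simp
    qed
    then show ?thesis using d0(1) c(1) by blast
  next
    case False
    define \<eta> where "\<eta> = sgn (?f b)"
    define e where "e = \<bar>?f b\<bar>"
    have e: "0 < e" "\<eta> * ?f b = e" "\<eta> = 1 \<or> \<eta> = - 1" using False by (auto simp: e_def \<eta>_def sgn_if)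
    have t: "((\<lambda>r. \<eta> * ?f r) \<longlongrightarrow> e) (at b)" "((\<lambda>r. \<eta> * ?g r) \<longlongrightarrow> e) (at b)"
      using tendsto_mult_left[of ?f "?f b" "at b" \<eta>] tendsto_mult_left[of ?g "?g b" "at b" \<eta>] cont(3,4) fb e(2)
      by (simp_all add: isCont_def)
    have e2: "e / 2 < e" "e < 2 * e" using e(1) by auto
    have "eventually (\<lambda>r. (a / 2 < v r \<and> v r < 2 * a \<and> a / 2 < w r \<and> w r < 2 * a) \<and>
      e / 2 < \<eta> * ?f r \<and> \<eta> * ?f r < 2 * e \<and> e / 2 < \<eta> * ?g r \<and> \<eta> * ?g r < 2 * e) (at b)"
      using nb order_tendstoD(1)[OF t(1) e2(1)] order_tendstoD(2)[OF t(1) e2(2)]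
        order_tendstoD(1)[OF t(2) e2(1)] order_tendstoD(2)[OF t(2) e2(2)]
      by eventually_elim blast
    then obtain d where d: "0 < d" "\<And>r. r \<noteq> b \<Longrightarrow> dist r b < d \<Longrightarrow>
      (a / 2 < v r \<and> v r < 2 * a \<and> a / 2 < w r \<and> w r < 2 * a) \<and>
      e / 2 < \<eta> * ?f r \<and> \<eta> * ?f r < 2 * e \<and> e / 2 < \<eta> * ?g r \<and> \<eta> * ?g r < 2 * e"
      unfolding eventually_at by blast
    define d0 where "d0 = min (min d 1) (min (b / 2) (b - R0))"
    have d0: "0 < d0" "d0 \<le> d" "d0 \<le> 1" "d0 \<le> b / 2" "d0 \<le> b - R0" using d(1) b b0 unfolding d0_def by linarith+
    have "P (e / 2) (2 * e) (\<lambda>r. 1) \<eta> r" if r: "b - d0 < r" "r < b" for r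
    proof -
      have "R0 < r" "b / 2 < r" "b - r \<le> 1" using r d0 by auto
      moreover have "r \<noteq> b" "dist r b < d" using r d0 by (auto simp: dist_real_def)
      ultimately show ?thesis using d(2)[of r] unfolding P_def by simp
    qed
    moreover have "0 < e / 2" using e(1) by simp
    ultimately show ?thesis using d0(1) e(3) by blast
  qed
  then obtain d0 k1 k2 S \<eta> where d0: "0 < d0" "0 < k1" "\<eta> = 1 \<or> \<eta> = - (1::real)"
    and near': "\<And>r. b - d0 < r \<Longrightarrow> r < b \<Longrightarrow> P k1 k2 S \<eta> r" by blast
  note near = near'[unfolded P_def]
  define A where "A = th * (k1 powr (th - 1) + k2 powr (th - 1))"
  have "0 \<le> A" using th by (simp add: A_def)
  define B where "B = (b / 2) powr ((1 - N) / (p - 1))"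
  define K where "K = B * A * C"
  have "0 \<le> K" using \<open>0 \<le> A\<close> c(2) by (simp add: K_def B_def)
  have dbound: "\<bar>deriv v r - deriv w r\<bar> \<le> K * M"
    if r: "b - d0 < r" "r < b" and M: "0 \<le> M" "\<And>u. r \<le> u \<Longrightarrow> u \<le> b \<Longrightarrow> \<bar>v u - w u\<bar> \<le> M" for r M
  proof -
    note n = near[OF r]
    have r0: "0 < r" using n b0 by linarith
    have fg: "\<bar>?f r - ?g r\<bar> \<le> C * M * (b - r)"
    proof -
      have ab: "v u \<in> {a / 2..2 * a}" "w u \<in> {a / 2..2 * a}" "R0 < u" "u \<in> {b / 2..b}" if "r \<le> u" "u \<le> b" for u
        using near[of u] that r b a b0 by (cases "u = b"; auto simp: a_def)+
      have bd: "- (C * M) \<le> - rhs u (v u) - (- rhs u (w u))" "- rhs u (v u) - (- rhs u (w u)) \<le> C * M"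
        if "r \<le> u" "u \<le> b" for u
        using order_trans[OF c(4)[OF ab(4,1,2)[OF that]] mult_left_mono[OF M(2)[OF that] c(2)]] by linarith+
      have der: "((\<lambda>u. ?f u - ?g u) has_real_derivative - rhs u (v u) - (- rhs u (w u))) (at u)" if "r \<le> u" "u \<le> b" for u
        by (intro DERIV_diff fD ab(3) that)
      have "(?f r - ?g r) + (- (C * M)) * (b - r) \<le> ?f b - ?g b"
        by (rule DERIV_ge_imp_growth[OF _ der bd(1)]) (use r in auto)
      moreover have "?f b - ?g b \<le> (?f r - ?g r) + (C * M) * (b - r)"
        by (rule DERIV_le_imp_growth[OF _ der bd(2)]) (use r in auto)
      ultimately show ?thesis using fb by (simp add: abs_le_iff)
    qed
    have "0 < k1 * S r" using n d0 by simp
    then have pos: "0 < \<eta> * ?f r" "0 < \<eta> * ?g r" using n by linarith+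
    define Br where "Br = r powr ((1 - N) / (p - 1))"
    have "Br \<le> B" unfolding Br_def B_def using n b0 p1 pN
      by (intro powr_mono2') (auto simp: divide_le_0_iff)
    have "deriv v r - deriv w r = \<eta> * (((\<eta> * ?f r) powr th - (\<eta> * ?g r) powr th) * Br)"
      using deriv_from_flux[OF p1 r0 d0(3) pos(1)] deriv_from_flux[OF p1 r0 d0(3) pos(2)]
      by (simp add: th_def Br_def algebra_simps)
    then have "\<bar>deriv v r - deriv w r\<bar> = \<bar>(\<eta> * ?f r) powr th - (\<eta> * ?g r) powr th\<bar> * Br"
      using d0(3) by (auto simp: abs_mult Br_def)
    also have "\<dots> \<le> (A * S r powr (th - 1) * \<bar>\<eta> * ?f r - \<eta> * ?g r\<bar>) * Br"
      unfolding A_def using n d0(2) th by (intro mult_right_mono powr_diff_bound) (auto simp: Br_def)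
    also have "\<bar>\<eta> * ?f r - \<eta> * ?g r\<bar> = \<bar>?f r - ?g r\<bar>" using d0(3) by auto
    also have "(A * S r powr (th - 1) * \<bar>?f r - ?g r\<bar>) * Br \<le> (A * S r powr (th - 1) * (C * M * (b - r))) * Br"
      using fg \<open>0 \<le> A\<close> by (intro mult_right_mono mult_left_mono) (auto simp: Br_def)
    also have "\<dots> = (A * C * M * Br) * (S r powr (th - 1) * (b - r))" by simp
    also have "\<dots> \<le> (A * C * M * Br) * 1"
      using n \<open>0 \<le> A\<close> c(2) M(1) by (intro mult_left_mono) (auto simp: Br_def)
    also have "\<dots> \<le> A * C * M * B" using \<open>Br \<le> B\<close> \<open>0 \<le> A\<close> c(2) M(1) by (simp add: mult_left_mono)
    finally show ?thesis by (simp add: K_def mult_ac)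
  qed
  \<comment> \<open>The second term gives \<open>K * d <= 1 / 2\<close>, so the maximal difference
    \<open>M\<close> satisfies \<open>M <= M / 2\<close>.\<close>
  define d where "d = min (d0 / 2) (1 / (2 * (K + 1)))"
  have d: "0 < d" "d < d0" using d0(1) \<open>0 \<le> K\<close> by (auto simp: d_def)
  have Kd: "K * d \<le> 1 / 2"
  proof -
    have "K * d \<le> K * (1 / (2 * (K + 1)))" using \<open>0 \<le> K\<close> by (intro mult_left_mono) (auto simp: d_def)
    also have "\<dots> \<le> 1 / 2" using \<open>0 \<le> K\<close> by (simp add: field_simps)
    finally show ?thesis .
  qed
  have R: "R0 < u" if "b - d \<le> u" "u \<le> b" for u
    using near[of u] that d b by (cases "u = b") auto
  have "continuous_on {b - d..b} (\<lambda>u. \<bar>v u - w u\<bar>)"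
    using R by (intro continuous_intros continuous_on_subset[OF is_solution_continuous(1)[OF sv]]
        continuous_on_subset[OF is_solution_continuous(1)[OF sw]]) auto
  then obtain u where u: "u \<in> {b - d..b}" "\<And>r. r \<in> {b - d..b} \<Longrightarrow> \<bar>v r - w r\<bar> \<le> \<bar>v u - w u\<bar>"
    using continuous_attains_sup[of "{b - d..b}" "\<lambda>u. \<bar>v u - w u\<bar>"] d by auto
  define M where "M = \<bar>v u - w u\<bar>"
  have der: "((\<lambda>r. v r - w r) has_real_derivative deriv v r - deriv w r) (at r)" if "b - d \<le> r" "r \<le> b" for r
    by (intro DERIV_diff is_solutionD(2)[OF sv] is_solutionD(2)[OF sw] R that)
  have bd: "\<bar>deriv v r - deriv w r\<bar> \<le> K * M" if "b - d \<le> r" "r \<le> b" for r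
  proof (cases "r = b")
    case False
    then show ?thesis using that d u by (intro dbound) (auto simp: M_def)
  qed (use b(3) \<open>0 \<le> K\<close> in \<open>simp add: M_def\<close>)
  have bd': "- (K * M) \<le> deriv v r - deriv w r" "deriv v r - deriv w r \<le> K * M" if "b - d \<le> r" "r \<le> b" for r
    using bd[OF that] by linarith+
  have "(v u - w u) + (- (K * M)) * (b - u) \<le> v b - w b"
    by (rule DERIV_ge_imp_growth[OF _ der bd'(1)]) (use u in auto)
  moreover have "v b - w b \<le> (v u - w u) + (K * M) * (b - u)"
    by (rule DERIV_le_imp_growth[OF _ der bd'(2)]) (use u in auto)
  ultimately have "M \<le> K * M * (b - u)" using b(2) unfolding M_def by (simp add: abs_le_iff)
  also have "\<dots> \<le> K * M * d" using u(1) \<open>0 \<le> K\<close> by (intro mult_left_mono) (auto simp: M_def)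
  also have "\<dots> = (K * d) * M" by simp
  also have "\<dots> \<le> 1 / 2 * M" using Kd by (intro mult_right_mono) (auto simp: M_def)
  finally have "M \<le> 0" by simp
  then have "v r = w r" if "r \<in> {b - d..b}" for r using u(2)[OF that] by (simp add: M_def)
  then show ?thesis using d(1) by blast
qed

text \<open>Continuation to the left: if the infimum \<open>b\<close> of the radii beyond which the
  solutions agree exceeded \<open>R0\<close>, the values and derivatives would agree at
  \<open>b\<close> as limits from the right, and \<open>sol_unique_step\<close> would extend the
  agreement past \<open>b\<close>.\<close>

lemma sol_unique_backward:
  assumes eq: "\<And>r. R1 < r \<Longrightarrow> v r = w r" and "R0 < r"
  shows "v r = w r"
proof -
  define A where "A = {a. R0 \<le> a \<and> (\<forall>r>a. v r = w r)}"
  have "max R0 R1 \<in> A" using eq by (simp add: A_def)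
  then have ne: "A \<noteq> {}" by blast
  have bdd: "bdd_below A" by (auto simp: A_def intro: bdd_belowI)
  define b where "b = Inf A"
  have "R0 \<le> b" unfolding b_def using ne by (intro cInf_greatest) (auto simp: A_def)
  have bA: "v r = w r" if br: "b < r" for r
  proof -
    obtain a where "a \<in> A" "a < r" using cInf_lessD[OF ne, of r] br[unfolded b_def] by blast
    then show ?thesis by (auto simp: A_def)
  qed
  have "b = R0"
  proof (rule ccontr)
    assume "b \<noteq> R0"
    then have b: "R0 < b" using \<open>R0 \<le> b\<close> by simp
    have lim: "z b = z' b" if "isCont z b" "isCont z' b" "\<And>r. b < r \<Longrightarrow> z r = z' r" for z z' :: "real \<Rightarrow> real"
    proof -
      have "(z \<longlongrightarrow> z b) (at_right b)" "(z' \<longlongrightarrow> z' b) (at_right b)"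
        using that(1,2) by (auto simp: isCont_def intro: tendsto_within_subset)
      moreover have "eventually (\<lambda>r. z r = z' r) (at_right b)"
        using that(3) by (auto simp: eventually_at_right_field intro: exI[of _ "b + 1"])
      ultimately show ?thesis
        using Lim_transform_eventually tendsto_unique trivial_limit_at_right_real by metis
    qed
    have "deriv v r = deriv w r" if br: "b < r" for r
    proof -
      have "R0 < r" using br b by simp
      have "(w has_real_derivative deriv v r) (at r)"
        by (rule has_field_derivative_transform_within_open[OF is_solutionD(2)[OF sv \<open>R0 < r\<close>] open_greaterThan[of b]])
          (use br bA in auto)
      then show ?thesis by (simp add: DERIV_imp_deriv)
    qed
    moreover have "isCont (deriv v) b" "isCont (deriv w) b" "isCont v b" "isCont w b"
      using is_solution_continuous[OF sv] is_solution_continuous[OF sw] b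
      by (auto simp: continuous_on_eq_continuous_at)
    ultimately have "v b = w b" "deriv v b = deriv w b" using lim bA by blast+
    from sol_unique_step[OF b this] obtain d where d: "0 < d" "\<And>r. r \<in> {b - d..b} \<Longrightarrow> v r = w r" by blast
    define a where "a = max R0 (b - d)"
    have "v r = w r" if "a < r" for r
      using that d(2)[of r] bA[of r] by (cases "b < r") (auto simp: a_def)
    then have "a \<in> A" by (simp add: A_def a_def)
    then have "b \<le> a" unfolding b_def using bdd by (intro cInf_lower)
    then show False using b d(1) by (simp add: a_def)
  qed
  then show ?thesis using bA assms(2) by simp
qed

end

end

section \<open>Scaling\<close>

lemma rescale_deriv:
  assumes "is_solution N p s mu q R0 v" "0 < lam" "R0 < lam * r"
  shows "(rescale p s q lam v has_real_derivative lam powr gam p s q * (deriv v (lam * r) * lam)) (at r)"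
    "deriv (rescale p s q lam v) r = lam powr gam p s q * (deriv v (lam * r) * lam)"
proof -
  have "((\<lambda>r. lam * r) has_real_derivative lam) (at r)" by (auto intro!: derivative_eq_intros)
  from DERIV_cmult[OF DERIV_chain2[OF is_solutionD(2)[OF assms(1,3)] this], of "lam powr gam p s q"]
  show "(rescale p s q lam v has_real_derivative lam powr gam p s q * (deriv v (lam * r) * lam)) (at r)"
    unfolding rescale_def[abs_def] by simp
  then show "deriv (rescale p s q lam v) r = lam powr gam p s q * (deriv v (lam * r) * lam)"
    by (rule DERIV_imp_deriv)
qed

lemma rescale_inverse: "0 < lam \<Longrightarrow> rescale p s q (1 / lam) (rescale p s q lam v) = v"
  by (auto simp: rescale_def powr_divide)

context radial
begin

text \<open>Both terms on the right scale alike: \<open>E + N - p = g * (p - 1)\<close> and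
  \<open>E + N + s = g * q\<close>, the latter because \<open>k * g = p + s\<close>.\<close>

lemma rescale_solution:
  assumes R0: "0 < R0" and lam: "0 < lam" and sol: "is_solution N p s mu q R0 v"
  shows "is_solution N p s mu q (R0 / lam) (rescale p s q lam v)"
proof -
  have R: "R0 < lam * r" "0 < r" if "R0 / lam < r" for r
    using that lam R0 by (auto simp: pos_divide_less_eq mult.commute less_trans[OF divide_pos_pos[OF R0 lam]])
  define v' where "v' = (\<lambda>r. lam powr (g + 1) * deriv v (lam * r))"
  have lam1: "lam powr (g + 1) = lam powr g * lam" using lam by (simp add: powr_add)
  \<comment> \<open>The weight of the flux: that of the rescaled function at \<open>u\<close> is
    \<open>lam powr E\<close> times the old one at \<open>lam * u\<close>.\<close>
  define E where "E = (g + 1) * (p - 1) - (N - 1)"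
  show ?thesis
  proof (rule is_solutionI[where v' = v'])
    fix r assume r: "R0 / lam < r"
    note Rr = R[OF r]
    show "0 < rescale p s q lam v r"
      using is_solutionD(1)[OF sol Rr(1)] lam by (simp add: rescale_def)
    show "(rescale p s q lam v has_real_derivative v' r) (at r)"
      using rescale_deriv(1)[OF sol lam Rr(1)] by (simp add: v'_def lam1 mult_ac)
    have eq: "lam powr E * flux N p v (lam * u) = u powr (N - 1) * \<bar>v' u\<bar> powr (p - 2) * v' u"
      if "R0 / lam < u" for u
    proof -
      define D where "D = deriv v (lam * u)"
      have "\<bar>v' u\<bar> powr (p - 2) * v' u = (lam powr (g + 1)) powr (p - 2) * lam powr (g + 1) * (\<bar>D\<bar> powr (p - 2) * D)"
        by (simp add: v'_def D_def[symmetric] abs_mult powr_mult)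
      also have "(lam powr (g + 1)) powr (p - 2) * lam powr (g + 1) = lam powr ((g + 1) * (p - 1))"
        by (simp add: powr_powr algebra_simps flip: powr_add)
      also have "\<dots> = lam powr E * lam powr (N - 1)" unfolding powr_add[symmetric] by (simp add: E_def)
      finally show ?thesis by (simp add: flux_def D_def powr_mult mult_ac)
    qed
    have "((\<lambda>r. lam * r) has_real_derivative lam) (at r)" by (auto intro!: derivative_eq_intros)
    from DERIV_cmult[OF DERIV_chain2[OF is_solutionD(3)[OF sol Rr(1)] this], of "lam powr E"]
    have d: "((\<lambda>u. lam powr E * flux N p v (lam * u)) has_real_derivative
      lam powr E * (- (mu * (lam * r) powr (N - 1 - p) * v (lam * r) powr (p - 1)
        + (lam * r) powr (N - 1 + s) * v (lam * r) powr q) * lam)) (at r)" .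
    have e: "lam powr E * (- (mu * (lam * r) powr (N - 1 - p) * v (lam * r) powr (p - 1)
        + (lam * r) powr (N - 1 + s) * v (lam * r) powr q) * lam)
      = - (mu * r powr (N - 1 - p) * rescale p s q lam v r powr (p - 1)
        + r powr (N - 1 + s) * rescale p s q lam v r powr q)"
    proof -
      have e1: "lam powr E * lam powr (N - 1 - p) * lam = (lam powr g) powr (p - 1)"
      proof -
        have "E + (N - 1 - p) + 1 = g * (p - 1)" by (simp add: E_def algebra_simps)
        then show ?thesis using lam powr_add[of lam "E + (N - 1 - p)" 1] powr_add[of lam E "N - 1 - p"]
          by (simp add: powr_powr)
      qed
      have e2: "lam powr E * lam powr (N - 1 + s) * lam = (lam powr g) powr q"
      proof -
        have "E + (N - 1 + s) + 1 = g * q" using k_g by (simp add: E_def algebra_simps)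
        then show ?thesis using lam powr_add[of lam "E + (N - 1 + s)" 1] powr_add[of lam E "N - 1 + s"]
          by (simp add: powr_powr)
      qed
      show ?thesis unfolding rescale_def powr_mult e1[symmetric] e2[symmetric]
        by (simp add: algebra_simps)
    qed
    show "((\<lambda>r. r powr (N - 1) * \<bar>v' r\<bar> powr (p - 2) * v' r) has_real_derivative
      - (mu * r powr (N - 1 - p) * rescale p s q lam v r powr (p - 1)
        + r powr (N - 1 + s) * rescale p s q lam v r powr q)) (at r)"
      by (rule has_field_derivative_transform_within_open[OF d[unfolded e] open_greaterThan[of "R0 / lam"]])
        (use r eq in auto)
  next
    show "continuous_on {R0 / lam<..} v'"
      unfolding v'_def
      by (intro continuous_intros continuous_on_compose2[OF is_solution_continuous(2)[OF sol]])
        (use R in auto)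
    show "0 \<le> R0 / lam" using R0 lam by simp
  qed
qed

lemma rescale_solution_iff:
  assumes "0 < R0" "0 < lam"
  shows "is_solution N p s mu q (R0 / lam) (rescale p s q lam v) \<longleftrightarrow> is_solution N p s mu q R0 v"
proof
  assume "is_solution N p s mu q (R0 / lam) (rescale p s q lam v)"
  from rescale_solution[OF _ _ this, of "1 / lam"] assms
  show "is_solution N p s mu q R0 v" by (simp add: rescale_inverse)
qed (rule rescale_solution[OF assms])

lemma rescale_type_III:
  assumes lam: "0 < lam" and sol: "is_solution N p s mu q R0 v" and "type_III N p mu v"
  shows "type_III N p mu (rescale p s q lam v)"
proof -
  from assms(3) obtain C where C: "0 < C" "((\<lambda>r. r powr nu * v r) \<longlongrightarrow> C) at_top"
    and x: "((\<lambda>r. r * deriv v r / v r) \<longlongrightarrow> - nu) at_top"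
    unfolding type_III_def by blast
  have fl: "filterlim (\<lambda>r. lam * r) at_top at_top"
    by (rule filterlim_tendsto_pos_mult_at_top[OF tendsto_const lam filterlim_ident])
  have "((\<lambda>r. lam powr (g - nu) * ((lam * r) powr nu * v (lam * r))) \<longlongrightarrow> lam powr (g - nu) * C) at_top"
    by (intro tendsto_mult_left filterlim_compose[OF C(2) fl])
  moreover have "lam powr (g - nu) * ((lam * r) powr nu * v (lam * r)) = r powr nu * rescale p s q lam v r" for r
  proof -
    have "lam powr (g - nu) * lam powr nu = lam powr g" by (simp flip: powr_add)
    then show ?thesis by (simp add: rescale_def powr_mult)
  qed
  ultimately have "((\<lambda>r. r powr nu * rescale p s q lam v r) \<longlongrightarrow> lam powr (g - nu) * C) at_top" by simp
  moreover have "((\<lambda>r. r * deriv (rescale p s q lam v) r / rescale p s q lam v r) \<longlongrightarrow> - nu) at_top"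
  proof (rule Lim_transform_eventually)
    show "((\<lambda>r. (lam * r) * deriv v (lam * r) / v (lam * r)) \<longlongrightarrow> - nu) at_top"
      by (rule filterlim_compose[OF x fl])
    show "eventually (\<lambda>r. (lam * r) * deriv v (lam * r) / v (lam * r)
        = r * deriv (rescale p s q lam v) r / rescale p s q lam v r) at_top"
      using eventually_gt_at_top[of "R0 / lam"]
    proof eventually_elim
      case (elim r)
      then have "R0 < lam * r" using lam by (simp add: pos_divide_less_eq mult.commute)
      then show ?case using rescale_deriv(2)[OF sol lam] lam by (simp add: rescale_def)
    qed
  qed
  moreover have "0 < lam powr (g - nu) * C" using lam C(1) by simp
  ultimately show ?thesis unfolding type_III_def by blast
qed

text \<open>In logarithmic time the scaling is a translation by \<open>ln lam\<close>; the amplitude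
  cancels in \<open>x\<close>, and in \<open>Y\<close> it is absorbed because
  \<open>k * g = p + s\<close>.\<close>

lemma rescale_orbit:
  assumes lam: "0 < lam" and sol: "is_solution N p s mu q R0 v" and t: "R0 < lam * exp t"
  shows "orbit_of p s q (rescale p s q lam v) t = orbit_of p s q v (t + ln lam)"
proof -
  have e: "exp (t + ln lam) = lam * exp t" using lam by (simp add: exp_add)
  have "(exp t) powr (p + s) * (lam powr g * v (lam * exp t)) powr k = (lam * exp t) powr (p + s) * v (lam * exp t) powr k"
  proof -
    have "(lam powr g) powr k = lam powr (p + s)" using k_g by (simp add: powr_powr mult.commute)
    then show ?thesis by (simp add: powr_mult)
  qed
  moreover have "exp t * (lam powr g * (deriv v (lam * exp t) * lam)) / (lam powr g * v (lam * exp t))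
    = lam * exp t * deriv v (lam * exp t) / v (lam * exp t)" using lam by simp
  ultimately show ?thesis
    unfolding orbit_of_def e rescale_deriv(2)[OF sol lam t] by (simp only: rescale_def)
qed

lemma orbit_determines_value:
  assumes "0 < v (exp t)" "0 < w (exp t)" "orbit_of p s q v t = orbit_of p s q w t"
  shows "v (exp t) = w (exp t)"
proof -
  have "v (exp t) powr k = w (exp t) powr k" using assms(3) by (simp add: orbit_of_def)
  then have "(v (exp t) powr k) powr (1 / k) = (w (exp t) powr k) powr (1 / k)" by simp
  then show ?thesis using assms(1,2) k_pos by (simp add: powr_powr)
qed

section \<open>Correspondence between type (III) solutions and the upper branch\<close>

context
  fixes R0 v assumes R0: "0 < R0" and sol: "is_solution N p s mu q R0 v"
begin

text \<open>The closed half-line includes the time \<open>t\<close> itself, so \<open>v' < 0\<close>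
  is first extended by continuity to some \<open>a < exp t\<close>, and the orbit is taken on the
  larger open ray.\<close>

lemma sol_orbit_solves:
  assumes t: "ln R0 < t" and neg: "deriv v (exp t) < 0"
  shows "solves_on F quadrant {0..} (\<lambda>u. orbit_of p s q v (u + t))"
proof -
  have R: "R0 < exp t" using t R0 by (metis exp_less_cancel_iff exp_ln)
  have "isCont (deriv v) (exp t)"
    using is_solution_continuous(2)[OF sol] R by (auto simp: continuous_on_eq_continuous_at)
  then have "eventually (\<lambda>r. deriv v r < 0) (at (exp t))"
    using neg by (auto simp: isCont_def intro: order_tendstoD)
  then obtain d where d: "0 < d" "\<And>r. r \<noteq> exp t \<Longrightarrow> dist r (exp t) < d \<Longrightarrow> deriv v r < 0"
    unfolding eventually_at by blast
  define a where "a = max ((R0 + exp t) / 2) (exp t - d / 2)"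
  have a: "R0 < a" "a < exp t" "0 < a" using R R0 d(1) by (auto simp: a_def max_def)
  have nega: "deriv v r < 0" if "a < r" for r
  proof (cases "exp t \<le> r")
    case True
    then show ?thesis using deriv_neg_persists[OF R0 sol R neg] by blast
  next
    case False
    then show ?thesis using that d by (intro d(2)) (auto simp: a_def dist_real_def)
  qed
  have "pflow (ln a) (\<lambda>t. fst (orbit_of p s q v t)) (\<lambda>t. snd (orbit_of p s q v t))"
    by (rule sol_pflow[OF R0 sol]) (use a R0 nega in auto)
  moreover have "ln a < t" using a by (metis exp_less_cancel_iff exp_ln)
  ultimately have "solves_on F quadrant {t..} (\<lambda>t. (fst (orbit_of p s q v t), snd (orbit_of p s q v t)))"
    by (intro pflow_solves_on) auto
  from solves_on_shift_atLeast[OF this, of t] show ?thesis by simp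
qed

text \<open>Conversely, a single time with \<open>v' < 0\<close> suffices: by uniqueness the orbit
  of \<open>v\<close> from there on is the one that converges to the saddle.\<close>

lemma type_III_iff:
  "type_III N p mu v \<longleftrightarrow> (\<forall>t>ln R0. deriv v (exp t) < 0 \<longrightarrow> orbit_of p s q v t \<in> UB)"
proof (intro iffI allI impI)
  fix t assume "type_III N p mu v" and t: "ln R0 < t" "deriv v (exp t) < 0"
  then have "((\<lambda>u. orbit_of p s q v (u + t)) \<longlongrightarrow> P_plus N p mu) at_top"
    by (intro filterlim_compose[OF decay_of_type_III[OF R0 sol] filterlim_add_const_at_top])
  from upper_branchI[OF sol_orbit_solves[OF t] this, of 0] show "orbit_of p s q v t \<in> UB" by simp
next
  assume UB: "\<forall>t>ln R0. deriv v (exp t) < 0 \<longrightarrow> orbit_of p s q v t \<in> UB"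
  obtain T where T: "ln R0 \<le> T" "\<And>r. exp T < r \<Longrightarrow> deriv v r < 0"
    using sol_pflow_eventually[OF R0 sol] by blast
  define t where "t = T + 1"
  have t: "ln R0 < t" "deriv v (exp t) < 0" using T by (auto simp: t_def)
  then obtain c where c: "solves_on F quadrant {0..} c" "c 0 = orbit_of p s q v t" "(c \<longlongrightarrow> P_plus N p mu) at_top"
    using UB upper_branchE by metis
  have eq: "c u = orbit_of p s q v (u + t)" if "0 \<le> u" for u
    using solves_on_unique[OF solves_on_half_plane[OF c(1)] solves_on_half_plane[OF sol_orbit_solves[OF t]] is_interval_ci, of 0 u]
      c(2) that by simp
  have "((\<lambda>t. snd (orbit_of p s q v t)) \<longlongrightarrow> 0) at_top"
  proof (rule Lim_transform_eventually)
    show "((\<lambda>u. snd (c (u + (- t)))) \<longlongrightarrow> 0) at_top"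
      by (rule filterlim_compose[OF tendsto_P_plus(2)[OF c(3)] filterlim_add_const_at_top])
    show "eventually (\<lambda>u. snd (c (u + (- t))) = snd (orbit_of p s q v u)) at_top"
      using eventually_ge_at_top[of t] by eventually_elim (simp add: eq)
  qed
  then show "type_III N p mu v" by (rule type_III_of_decay[OF R0 sol])
qed

end

text \<open>Backward extension of the orbit through \<open>z\<close> leaves room to the left of
  \<open>t\<close>, so that \<open>exp t\<close> is an interior point of the interval of the
  solution; a time shift places \<open>z\<close> at any prescribed \<open>t\<close>.\<close>

lemma upper_branch_realised:
  assumes "z \<in> UB"
  shows "\<exists>R0 v. 0 < R0 \<and> R0 < exp t \<and> is_solution N p s mu q R0 v \<and> type_III N p mu v \<and>
    deriv v (exp t) < 0 \<and> orbit_of p s q v t = z"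
proof -
  obtain a c where c: "a < 0" "solves_on F quadrant {a..} c" "c 0 = z" "(c \<longlongrightarrow> P_plus N p mu) at_top"
    using upper_branch_extend[OF assms] by blast
  have "solves_on F quadrant {a - (- t)..} (\<lambda>u. c (u + (- t)))" by (rule solves_on_shift_atLeast[OF c(2)])
  note pf = solves_on_pflow[OF this]
  define T where "T = a - (- t)"
  have "T < t" using c(1) by (simp add: T_def)
  note V = pflow_sol[OF pf[folded T_def]]
  obtain v where v: "is_solution N p s mu q (exp T) v"
    "\<And>t. T < t \<Longrightarrow> deriv v (exp t) < 0" "\<And>u. T < u \<Longrightarrow> orbit_of p s q v u = c (u + (- t))"
    by (rule that[OF V(1,2)]) (simp_all only: V(3) prod.collapse)
  have "((\<lambda>u. snd (orbit_of p s q v u)) \<longlongrightarrow> 0) at_top"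
  proof (rule Lim_transform_eventually)
    show "((\<lambda>u. snd (c (u + (- t)))) \<longlongrightarrow> 0) at_top"
      by (rule filterlim_compose[OF tendsto_P_plus(2)[OF c(4)] filterlim_add_const_at_top])
    show "eventually (\<lambda>u. snd (c (u + (- t))) = snd (orbit_of p s q v u)) at_top"
      using eventually_gt_at_top[of T] by eventually_elim (simp add: v(3))
  qed
  then have "type_III N p mu v" by (rule type_III_of_decay[OF exp_gt_zero v(1)])
  then show ?thesis using v \<open>T < t\<close> c(3)
    by (intro exI[of _ "exp T"] exI[of _ v]) simp
qed

lemma type_III_exists:
  assumes "0 < R0"
  shows "\<exists>v. is_solution N p s mu q R0 v \<and> type_III N p mu v"
proof -
  obtain z where "z \<in> UB" using upper_branch_nonempty by blast
  from upper_branch_realised[OF this, of "ln R0"] assms show ?thesis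
    using is_solution_mono less_imp_le by (metis exp_ln)
qed

text \<open>The orbits of \<open>v\<close> and \<open>w\<close> meet, so they differ by a time
  shift, which is a scaling. The scaling is unique because \<open>Y\<close> is eventually strictly
  decreasing along the orbit, so that two different shifts give different values of
  \<open>Y\<close>.\<close>

lemma rescale_unique:
  assumes R0: "0 < R0" and R1: "0 < R1"
    and v: "is_solution N p s mu q R0 v" "type_III N p mu v"
    and w: "is_solution N p s mu q R1 w" "type_III N p mu w"
  shows "\<exists>!lam. 0 < lam \<and> (\<forall>r>max R1 (R0 / lam). w r = rescale p s q lam v r)"
proof (rule ex_ex1I)
  obtain Tv where Tv: "ln R0 \<le> Tv" "\<And>r. exp Tv < r \<Longrightarrow> deriv v r < 0"
    using sol_pflow_eventually[OF R0 v(1)] by blast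
  obtain Tw where Tw: "ln R1 \<le> Tw" "\<And>r. exp Tw < r \<Longrightarrow> deriv w r < 0"
    using sol_pflow_eventually[OF R1 w(1)] by blast
  have tv: "ln R0 < Tv + 1" "deriv v (exp (Tv + 1)) < 0" and tw: "ln R1 < Tw + 1" "deriv w (exp (Tw + 1)) < 0"
    using Tv Tw by auto
  define cv where "cv = (\<lambda>u. orbit_of p s q v (u + (Tv + 1)))"
  define cw where "cw = (\<lambda>u. orbit_of p s q w (u + (Tw + 1)))"
  have cv: "solves_on F quadrant {0..} cv" "(cv \<longlongrightarrow> P_plus N p mu) at_top"
    unfolding cv_def by (rule sol_orbit_solves[OF R0 v(1) tv]
      filterlim_compose[OF decay_of_type_III[OF R0 v] filterlim_add_const_at_top])+
  have cw: "solves_on F quadrant {0..} cw" "(cw \<longlongrightarrow> P_plus N p mu) at_top"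
    unfolding cw_def by (rule sol_orbit_solves[OF R1 w(1) tw]
      filterlim_compose[OF decay_of_type_III[OF R1 w] filterlim_add_const_at_top])+
  obtain t1 t2 where t: "0 < t1" "0 < t2" "cv t1 = cw t2"
    using upper_orbits_meet[OF cv(1) cw(1) cv(2) cw(2)] by blast
  have same: "cv (u + t1) = cw (u + t2)" if "0 \<le> u" for u
  proof -
    have "solves_on F half_plane {0..} (\<lambda>u. cv (u + t1))" "solves_on F half_plane {0..} (\<lambda>u. cw (u + t2))"
      using t solves_on_shift_right[OF solves_on_half_plane[OF cv(1)]]
        solves_on_shift_right[OF solves_on_half_plane[OF cw(1)]] by auto
    from solves_on_unique[OF this is_interval_ci, of 0 u] show ?thesis using t that by simp
  qed
  \<comment> \<open>The difference of the actual logarithmic times at which the two orbits pass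
    through the common point.\<close>
  define b where "b = (t1 + Tv) - (t2 + Tw)"
  define lam where "lam = exp b"
  have lam: "0 < lam" "ln lam = b" by (auto simp: lam_def)
  define T where "T = t2 + Tw + 1"
  have eq: "w r = rescale p s q lam v r" if r: "exp T < r" for r
  proof -
    define u where "u = ln r"
    have "0 < r" using r exp_gt_zero[of T] by linarith
    then have ru: "r = exp u" by (simp add: u_def)
    then have Tu: "T < u" using r by simp
    have "ln R0 < b + u" "ln R1 < u" using Tu Tv(1) Tw(1) t(1,2) by (auto simp: b_def T_def)
    then have "exp (ln R0) < exp (b + u)" "exp (ln R1) < exp u" by simp_all
    then have e1: "R0 < lam * exp u" and e2: "R1 < exp u" using R0 R1 by (auto simp: lam_def exp_add)
    have "orbit_of p s q w u = cw ((u - T) + t2)" by (simp add: cw_def T_def)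
    also have "\<dots> = cv ((u - T) + t1)" using same[of "u - T"] Tu by simp
    also have "\<dots> = orbit_of p s q v (u + ln lam)" by (simp add: cv_def T_def lam b_def algebra_simps)
    also have "\<dots> = orbit_of p s q (rescale p s q lam v) u" by (rule rescale_orbit[OF lam(1) v(1) e1, symmetric])
    finally have "orbit_of p s q w u = orbit_of p s q (rescale p s q lam v) u" .
    moreover have "0 < w (exp u)" "0 < rescale p s q lam v (exp u)"
      using is_solutionD(1)[OF w(1) e2] is_solutionD(1)[OF v(1) e1] lam(1) by (auto simp: rescale_def)
    ultimately show ?thesis unfolding ru by (intro orbit_determines_value)
  qed
  define R where "R = max R1 (R0 / lam)"
  have R: "0 < R" "R1 \<le> R" "R0 / lam \<le> R" using R1 by (auto simp: R_def)
  \<comment> \<open>The orbits give equality for large \<open>r\<close> only; backward uniqueness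
    carries it to the whole common interval, across possible zeros of \<open>v'\<close>.\<close>
  have "w r = rescale p s q lam v r" if "R < r" for r
    by (rule sol_unique_backward[OF R(1) is_solution_mono[OF w(1) R(2)]
          is_solution_mono[OF rescale_solution[OF R0 lam(1) v(1)] R(3)] eq that])
  then show "\<exists>lam. 0 < lam \<and> (\<forall>r>max R1 (R0 / lam). w r = rescale p s q lam v r)"
    using lam(1) unfolding R_def by blast
next
  fix a b assume a: "0 < a \<and> (\<forall>r>max R1 (R0 / a). w r = rescale p s q a v r)"
    and b: "0 < b \<and> (\<forall>r>max R1 (R0 / b). w r = rescale p s q b v r)"
  obtain T where T: "ln R0 \<le> T" and pf: "pflow T (\<lambda>t. fst (orbit_of p s q v t)) (\<lambda>t. snd (orbit_of p s q v t))"
    using sol_pflow_eventually[OF R0 v(1)] by metis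
  have lim: "((\<lambda>t. snd (orbit_of p s q v t)) \<longlongrightarrow> 0) at_top"
    by (rule tendsto_P_plus(2)[OF decay_of_type_III[OF R0 v]])
  obtain S where S: "T < S" "\<And>t. S \<le> t \<Longrightarrow> g < fst (orbit_of p s q v t)"
    using pflow_x_gt_g[OF pf lim] by blast
  have dec: "snd (orbit_of p s q v t') < snd (orbit_of p s q v t)" if tt: "S \<le> t" "t < t'" for t t'
  proof (rule DERIV_neg_imp_decreasing[OF tt(2)])
    fix u assume u: "t \<le> u" "u \<le> t'"
    then have "T < u" "S \<le> u" using tt S(1) by auto
    note D = pflowD(2,4)[OF pf this(1)] S(2)[OF this(2)]
    have "k * snd (orbit_of p s q v u) * (g - fst (orbit_of p s q v u)) < 0"
      using D k_pos by (intro mult_pos_neg mult_pos_pos) auto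
    then show "\<exists>y. ((\<lambda>t. snd (orbit_of p s q v t)) has_real_derivative y) (at u) \<and> y < 0"
      using D(2) by blast
  qed
  \<comment> \<open>A radius at which both representations of \<open>w\<close> hold and both shifted
    times lie beyond \<open>S\<close>, where \<open>Y\<close> is strictly decreasing.\<close>
  define r where "r = max (max R1 (R0 / a)) (max (R0 / b) (max (exp S / a) (exp S / b))) + 1"
  have r: "R1 < r" "R0 / a < r" "R0 / b < r" "exp S / a < r" "exp S / b < r" unfolding r_def by linarith+
  have r0: "0 < r" using r(1) R1 by simp
  define t where "t = ln r"
  have et: "exp t = r" using r0 by (simp add: t_def)
  have orb: "snd (orbit_of p s q (rescale p s q c v) t) = snd (orbit_of p s q v (t + ln c))" "S \<le> t + ln c"
    if "0 < c" "R0 / c < r" "exp S / c < r" for c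
  proof -
    have "R0 < c * exp t" "exp S < c * r" using that et by (auto simp: pos_divide_less_eq mult.commute)
    then show "snd (orbit_of p s q (rescale p s q c v) t) = snd (orbit_of p s q v (t + ln c))"
      using rescale_orbit[OF that(1) v(1)] by simp
    have "exp S < exp (t + ln c)" using \<open>exp S < c * r\<close> that(1) et by (simp add: exp_add mult.commute)
    then show "S \<le> t + ln c" by simp
  qed
  have "rescale p s q a v r = rescale p s q b v r" using a b r by auto
  then have "snd (orbit_of p s q (rescale p s q a v) t) = snd (orbit_of p s q (rescale p s q b v) t)"
    by (simp add: orbit_of_def et)
  then have eq: "snd (orbit_of p s q v (t + ln a)) = snd (orbit_of p s q v (t + ln b))"
    using orb(1)[of a] orb(1)[of b] a b r by simp
  have "t + ln a = t + ln b"
    using dec[of "t + ln a" "t + ln b"] dec[of "t + ln b" "t + ln a"] eq orb(2)[of a] orb(2)[of b] a b r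
    by (cases "t + ln a" "t + ln b" rule: linorder_cases) auto
  then show "a = b" using a b by simp
qed

end

theorem theorem1p6:
  fixes N p s mu q :: real
  assumes "1 < p" and "p < N" and "- p < s"
    and "0 < mu" and "mu < ((N - p) / p) powr p"
    and "q_S N p s mu < q" and "q < p_star N p s - 1"
  shows
    "\<comment> \<open>exactly one of (I), (III)\<close>
     (\<forall>R0 v. 0 < R0 \<longrightarrow> is_solution N p s mu q R0 v \<longrightarrow>
        (type_I N p s mu q R0 v \<or> type_III N p mu v) \<and>
        \<not> (type_I N p s mu q R0 v \<and> type_III N p mu v)) \<and>
     \<comment> \<open>both occur\<close>
     (\<forall>R0>0. (\<exists>v. is_solution N p s mu q R0 v \<and> type_I N p s mu q R0 v) \<and>
             (\<exists>v. is_solution N p s mu q R0 v \<and> type_III N p mu v)) \<and>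
     \<comment> \<open>the branch of the stable manifold of the saddle in the upper half plane is one orbit\<close>
     hyperbolic_saddle (vec_field N p s mu q) (P_plus N p mu) \<and>
     upper_branch N p s mu q \<in> components (W_s N p s mu q - {P_plus N p mu}) \<and>
     (\<exists>z\<in>quadrant. upper_branch N p s mu q = orbit_through (vec_field N p s mu q) quadrant z) \<and>
     \<comment> \<open>solutions of type (III) correspond to that orbit\<close>
     (\<forall>R0 v. 0 < R0 \<longrightarrow> is_solution N p s mu q R0 v \<longrightarrow>
        (\<exists>R1\<ge>R0. \<forall>r>R1. deriv v r < 0) \<and>
        (type_III N p mu v \<longleftrightarrow>
          (\<forall>t>ln R0. deriv v (exp t) < 0 \<longrightarrow> orbit_of p s q v t \<in> upper_branch N p s mu q))) \<and>
     (\<forall>z\<in>upper_branch N p s mu q. \<forall>t. \<exists>R0 v. 0 < R0 \<and> R0 < exp t \<and>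
        is_solution N p s mu q R0 v \<and> type_III N p mu v \<and>
        deriv v (exp t) < 0 \<and> orbit_of p s q v t = z) \<and>
     \<comment> \<open>invariance under the scaling\<close>
     (\<forall>R0 v lam. 0 < R0 \<longrightarrow> 0 < lam \<longrightarrow>
        (is_solution N p s mu q (R0 / lam) (rescale p s q lam v) \<longleftrightarrow> is_solution N p s mu q R0 v)) \<and>
     (\<forall>R0 v lam. 0 < R0 \<longrightarrow> 0 < lam \<longrightarrow> is_solution N p s mu q R0 v \<longrightarrow> type_III N p mu v \<longrightarrow>
        type_III N p mu (rescale p s q lam v)) \<and>
     \<comment> \<open>type (III) is a one-parameter family, parametrised by the scaling\<close>
     (\<forall>R0 v R1 w. 0 < R0 \<longrightarrow> 0 < R1 \<longrightarrow>
        is_solution N p s mu q R0 v \<longrightarrow> type_III N p mu v \<longrightarrow>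
        is_solution N p s mu q R1 w \<longrightarrow> type_III N p mu w \<longrightarrow>
        (\<exists>!lam. 0 < lam \<and> (\<forall>r>max R1 (R0 / lam). w r = rescale p s q lam v r)))"
proof -
  interpret radial N p s mu q by unfold_locales (use assms in auto)
  obtain z where z: "z \<in> UB" using upper_branch_nonempty by blast
  show ?thesis
  proof (intro conjI, goal_cases)
    case 1
    show ?case using type_dichotomy types_exclusive by blast
  next
    case 2
    show ?case using type_I_exists type_III_exists by blast
  next
    case 3
    show ?case by (rule P_plus_saddle)
  next
    case 4
    show ?case by (rule upper_branch_component)
  next
    case 5
    show ?case using z upper_branch_eq_orbit upper_branch_quadrant by blast
  next
    case 6
    show ?case using deriv_neg_eventually type_III_iff by blast
  next
    case 7
    show ?case using upper_branch_realised by blast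
  next
    case 8
    show ?case using rescale_solution_iff by blast
  next
    case 9
    show ?case using rescale_type_III by blast
  next
    case 10
    show ?case using rescale_unique by blast
  qed
qed

end
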